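(* Let $\mathcal T=(T(t))_{t\ge0}$ be a $C_0$-semigroup on a Hilbert space $H$, and let $\tau_1>0$ be such that $T(\tau_1)$ is similar to a contraction on $H$. Then for every $\tau_2\in(0,\tau_1]$ there exist a Hilbert space $K$, $A\in\mathcal L(K,H)$, $B\in\mathcal L(H,K)$ and a unitary $C_0$-group $\mathcal U=(U(t))_{t\in\mathbb R}$ on $K$ such that $$T(t)=AU(t)B,\qquad t\ge\tau_2,$$ and $$\|A\|\|B\|\le C(T(\tau_1))\,M^2\sqrt{\tau_1/\tau_2},$$ where $M=\sup_{t\in[0,\tau_1]}\|T(t)\|$.
   Context: For $T\in\mathcal L(H)$, its similarity constant is $C(T)=\inf\{\|R\|\|R^{-1}\|: R\in\mathcal L(H)\text{ invertible},\ \|RTR^{-1}\|\le1\}$, with $C(T)=\infty$ if $T$ is not similar to a contraction (i.e. if no such $R$ exists). *)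

theory Defs
  imports "HOL-Analysis.Analysis"
begin

record 'a hspace =
  hs_carrier :: "'a set"
  hs_zero :: 'a
  hs_add :: "'a \<Rightarrow> 'a \<Rightarrow> 'a"
  hs_smul :: "complex \<Rightarrow> 'a \<Rightarrow> 'a"
  hs_inner :: "'a \<Rightarrow> 'a \<Rightarrow> complex"

definition hs_diff :: "'a hspace \<Rightarrow> 'a \<Rightarrow> 'a \<Rightarrow> 'a" where
  "hs_diff H x y = hs_add H x (hs_smul H (-1) y)"

definition hs_norm :: "'a hspace \<Rightarrow> 'a \<Rightarrow> real" where
  "hs_norm H x = sqrt (Re (hs_inner H x x))"

definition hilbert_space :: "'a hspace \<Rightarrow> bool" where
  "hilbert_space H \<longleftrightarrow>
     (let V = hs_carrier H; z = hs_zero H; ad = hs_add H; sm = hs_smul H; ip = hs_inner H in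
      \<comment> \<open>complex vector space\<close>
      z \<in> V \<and>
      (\<forall>x\<in>V. \<forall>y\<in>V. ad x y \<in> V) \<and>
      (\<forall>a. \<forall>x\<in>V. sm a x \<in> V) \<and>
      (\<forall>x\<in>V. \<forall>y\<in>V. \<forall>w\<in>V. ad (ad x y) w = ad x (ad y w)) \<and>
      (\<forall>x\<in>V. \<forall>y\<in>V. ad x y = ad y x) \<and>
      (\<forall>x\<in>V. ad z x = x) \<and>
      (\<forall>x\<in>V. \<exists>y\<in>V. ad x y = z) \<and>
      (\<forall>a. \<forall>x\<in>V. \<forall>y\<in>V. sm a (ad x y) = ad (sm a x) (sm a y)) \<and>
      (\<forall>a b. \<forall>x\<in>V. sm (a + b) x = ad (sm a x) (sm b x)) \<and>
      (\<forall>a b. \<forall>x\<in>V. sm (a * b) x = sm a (sm b x)) \<and>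
      (\<forall>x\<in>V. sm 1 x = x) \<and>
      \<comment> \<open>inner product, linear in the first argument\<close>
      (\<forall>x\<in>V. \<forall>y\<in>V. ip x y = cnj (ip y x)) \<and>
      (\<forall>x\<in>V. \<forall>y\<in>V. \<forall>w\<in>V. ip (ad x y) w = ip x w + ip y w) \<and>
      (\<forall>a. \<forall>x\<in>V. \<forall>y\<in>V. ip (sm a x) y = a * ip x y) \<and>
      (\<forall>x\<in>V. Im (ip x x) = 0 \<and> Re (ip x x) \<ge> 0) \<and>
      (\<forall>x\<in>V. ip x x = 0 \<longrightarrow> x = z) \<and>
      \<comment> \<open>completeness w.r.t. the induced norm\<close>
      (\<forall>s :: nat \<Rightarrow> 'a. (\<forall>n. s n \<in> V) \<longrightarrow>
          (\<forall>e>0. \<exists>N. \<forall>m\<ge>N. \<forall>n\<ge>N. hs_norm H (hs_diff H (s m) (s n)) < e) \<longrightarrow>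
          (\<exists>l\<in>V. \<forall>e>0. \<exists>N. \<forall>n\<ge>N. hs_norm H (hs_diff H (s n) l) < e)))"

definition bounded_op :: "'a hspace \<Rightarrow> 'b hspace \<Rightarrow> ('a \<Rightarrow> 'b) \<Rightarrow> bool" where
  "bounded_op H K f \<longleftrightarrow>
     (\<forall>x\<in>hs_carrier H. f x \<in> hs_carrier K) \<and>
     (\<forall>x\<in>hs_carrier H. \<forall>y\<in>hs_carrier H. f (hs_add H x y) = hs_add K (f x) (f y)) \<and>
     (\<forall>a. \<forall>x\<in>hs_carrier H. f (hs_smul H a x) = hs_smul K a (f x)) \<and>
     (\<exists>C. \<forall>x\<in>hs_carrier H. hs_norm K (f x) \<le> C * hs_norm H x)"

definition op_norm :: "'a hspace \<Rightarrow> 'b hspace \<Rightarrow> ('a \<Rightarrow> 'b) \<Rightarrow> real" where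
  "op_norm H K f = Sup {hs_norm K (f x) | x. x \<in> hs_carrier H \<and> hs_norm H x \<le> 1}"

definition inverse_ops :: "'a hspace \<Rightarrow> ('a \<Rightarrow> 'a) \<Rightarrow> ('a \<Rightarrow> 'a) \<Rightarrow> bool" where
  "inverse_ops H R Ri \<longleftrightarrow> bounded_op H H R \<and> bounded_op H H Ri \<and>
     (\<forall>x\<in>hs_carrier H. Ri (R x) = x \<and> R (Ri x) = x)"

definition similar_to_contraction :: "'a hspace \<Rightarrow> ('a \<Rightarrow> 'a) \<Rightarrow> bool" where
  "similar_to_contraction H S \<longleftrightarrow>
     (\<exists>R Ri. inverse_ops H R Ri \<and> op_norm H H (\<lambda>x. R (S (Ri x))) \<le> 1)"

text \<open>Similarity constant C(S); the infimum of the empty set in ereal is \<infinity>.\<close>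
definition sim_const :: "'a hspace \<Rightarrow> ('a \<Rightarrow> 'a) \<Rightarrow> ereal" where
  "sim_const H S = Inf {ereal (op_norm H H R * op_norm H H Ri) | R Ri.
       inverse_ops H R Ri \<and> op_norm H H (\<lambda>x. R (S (Ri x))) \<le> 1}"

definition c0_semigroup :: "'a hspace \<Rightarrow> (real \<Rightarrow> 'a \<Rightarrow> 'a) \<Rightarrow> bool" where
  "c0_semigroup H T \<longleftrightarrow>
     (\<forall>t\<ge>0. bounded_op H H (T t)) \<and>
     (\<forall>x\<in>hs_carrier H. T 0 x = x) \<and>
     (\<forall>s\<ge>0. \<forall>t\<ge>0. \<forall>x\<in>hs_carrier H. T (s + t) x = T s (T t x)) \<and>
     (\<forall>x\<in>hs_carrier H. \<forall>e>0. \<exists>d>0. \<forall>t. 0 < t \<and> t < d \<longrightarrow>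
         hs_norm H (hs_diff H (T t x) x) < e)"

definition unitary_op :: "'a hspace \<Rightarrow> ('a \<Rightarrow> 'a) \<Rightarrow> bool" where
  "unitary_op K u \<longleftrightarrow> bounded_op K K u \<and> u ` hs_carrier K = hs_carrier K \<and>
     (\<forall>x\<in>hs_carrier K. \<forall>y\<in>hs_carrier K. hs_inner K (u x) (u y) = hs_inner K x y)"

definition unitary_c0_group :: "'a hspace \<Rightarrow> (real \<Rightarrow> 'a \<Rightarrow> 'a) \<Rightarrow> bool" where
  "unitary_c0_group K U \<longleftrightarrow>
     (\<forall>t. unitary_op K (U t)) \<and>
     (\<forall>x\<in>hs_carrier K. U 0 x = x) \<and>
     (\<forall>s t. \<forall>x\<in>hs_carrier K. U (s + t) x = U s (U t x)) \<and>
     (\<forall>x\<in>hs_carrier K. \<forall>e>0. \<exists>d>0. \<forall>t. \<bar>t\<bar> < d \<longrightarrow>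
         hs_norm K (hs_diff K (U t x) x) < e)"

end

theory Submission
  imports Defs
begin

text \<open>Put \<open>S = T(\<tau>1)\<close>. A compactness argument yields an equivalent inner product \<open>p\<close>, with
  \<open>\<parallel>x\<parallel>\<^sup>2 \<le> p(x, x) \<le> C(S)\<^sup>2 \<parallel>x\<parallel>\<^sup>2\<close>, for which \<open>S\<close> is a contraction. On formal sums of
  symbols \<open>U(r) B x\<close> consider the translation invariant form
    \<open>\<langle>U(r) B x, U(r') B y\<rangle> = \<integral> p (T(s + r - min r r') x) (T(s + r' - min r r') y) ds\<close>,
  the integral being over \<open>[0, \<tau>1]\<close>. If all times of a formal sum are at least \<open>q\<close>, its square norm
  is at least \<open>\<integral> p(v(s), v(s)) ds\<close> with \<open>v(s) = \<Sum> T(s + r - q) x\<close>: removing the terms with the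
  smallest time reduces this to the fact that \<open>\<integral> p(v(s), v(s)) ds\<close> does not increase when the
  integrand is shifted to the right, because \<open>v(s + \<tau>1) = S v(s)\<close>. Hence the form is positive and
  \<open>U\<close> acts unitarily on the completion \<open>K\<close> by translation. The bound on \<open>B\<close> is immediate. For
  \<open>q = \<tau>2\<close> one has \<open>\<Sum> T(r) x = T(\<tau>2 - s) v(s)\<close> for all \<open>s\<close> in \<open>[0, \<tau>2]\<close>, so the
  assignment \<open>U(r) B x \<mapsto> T(r) x\<close>, \<open>r \<ge> \<tau>2\<close>, is bounded by \<open>M / sqrt \<tau>2\<close> and extends to \<open>A\<close>.\<close>

section \<open>Inner product geometry on carriers\<close>

text \<open>The constant shapes the renorming: similarities nearly attaining C(S) only give C(S) +
  1/n, so a limit is taken of the inner products that they induce, not of the operators. The final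
  bound is the product of \<open>sqrt \<tau>1 * C * M\<close> for B and
  \<open>M / sqrt \<tau>2\<close> for A. The form is based at \<open>min r r'\<close> since T runs
  forward only: this is the largest base for which both arguments of T stay nonnegative on the whole
  window. As the base depends on the pair, positivity is not visible; it is visible for a base
  common to all terms, whence the comparison of the two kernels. Formal sums obey no vector space
  laws and the form may degenerate. Hence \<open>pre_hilbert\<close> speaks of inner products only,
  so that lists under concatenation are an instance. Bounded antilinear functionals then serve as
  the completion: they absorb the quotient by null vectors, and operators on them can be defined by
  Riesz representation. The carrier type \<open>real \<Rightarrow> 'h\<close> prescribed for K is
  reached at the very end through an injection.\<close>

locale pre_hilbert =
  fixes E :: "'e hspace"
  assumes zero_closed: "hs_zero E \<in> hs_carrier E"
    and add_closed: "\<And>x y. x \<in> hs_carrier E \<Longrightarrow> y \<in> hs_carrier E \<Longrightarrow> hs_add E x y \<in> hs_carrier E"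
    and smul_closed: "\<And>a x. x \<in> hs_carrier E \<Longrightarrow> hs_smul E a x \<in> hs_carrier E"
    and inner_commute: "\<And>x y. x \<in> hs_carrier E \<Longrightarrow> y \<in> hs_carrier E \<Longrightarrow> hs_inner E x y = cnj (hs_inner E y x)"
    and inner_add_left: "\<And>x y z. x \<in> hs_carrier E \<Longrightarrow> y \<in> hs_carrier E \<Longrightarrow> z \<in> hs_carrier E \<Longrightarrow>
          hs_inner E (hs_add E x y) z = hs_inner E x z + hs_inner E y z"
    and inner_smul_left: "\<And>a x y. x \<in> hs_carrier E \<Longrightarrow> y \<in> hs_carrier E \<Longrightarrow>
          hs_inner E (hs_smul E a x) y = a * hs_inner E x y"
    and inner_zero_left: "\<And>x. x \<in> hs_carrier E \<Longrightarrow> hs_inner E (hs_zero E) x = 0"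
    and inner_nonneg: "\<And>x. x \<in> hs_carrier E \<Longrightarrow> 0 \<le> Re (hs_inner E x x)"
begin

abbreviation "V \<equiv> hs_carrier E"
abbreviation ip where "ip \<equiv> hs_inner E"
abbreviation nrm where "nrm \<equiv> hs_norm E"

lemma diff_closed: "x \<in> V \<Longrightarrow> y \<in> V \<Longrightarrow> hs_diff E x y \<in> V"
  by (simp add: hs_diff_def add_closed smul_closed)

lemmas closed = zero_closed add_closed smul_closed diff_closed

lemma inner_add_right: "x \<in> V \<Longrightarrow> y \<in> V \<Longrightarrow> z \<in> V \<Longrightarrow> ip z (hs_add E x y) = ip z x + ip z y"
  by (metis add_closed complex_cnj_add inner_add_left inner_commute)

lemma inner_smul_right: "x \<in> V \<Longrightarrow> y \<in> V \<Longrightarrow> ip x (hs_smul E a y) = cnj a * ip x y"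
  by (metis smul_closed complex_cnj_mult inner_smul_left inner_commute)

lemma inner_diff_left: "x \<in> V \<Longrightarrow> y \<in> V \<Longrightarrow> z \<in> V \<Longrightarrow> ip (hs_diff E x y) z = ip x z - ip y z"
  by (simp add: hs_diff_def inner_add_left inner_smul_left closed)

lemma inner_diff_right: "x \<in> V \<Longrightarrow> y \<in> V \<Longrightarrow> z \<in> V \<Longrightarrow> ip z (hs_diff E x y) = ip z x - ip z y"
  by (simp add: hs_diff_def inner_add_right inner_smul_right closed)

lemmas inner_simps = inner_add_left inner_add_right inner_smul_left inner_smul_right
  inner_diff_left inner_diff_right

lemma norm_nonneg: "x \<in> V \<Longrightarrow> 0 \<le> nrm x"
  by (simp add: hs_norm_def inner_nonneg)

lemma norm_sq: "x \<in> V \<Longrightarrow> (nrm x)\<^sup>2 = Re (ip x x)"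
  by (simp add: hs_norm_def inner_nonneg)

lemma inner_self: "x \<in> V \<Longrightarrow> ip x x = of_real ((nrm x)\<^sup>2)"
  using inner_commute[of x x] by (simp add: norm_sq complex_eq_iff)

lemma Re_inner_commute: "x \<in> V \<Longrightarrow> y \<in> V \<Longrightarrow> Re (ip y x) = Re (ip x y)"
  using inner_commute[of y x] by simp

lemma norm_add_sq:
  "x \<in> V \<Longrightarrow> y \<in> V \<Longrightarrow> (nrm (hs_add E x y))\<^sup>2 = (nrm x)\<^sup>2 + (nrm y)\<^sup>2 + 2 * Re (ip x y)"
  by (simp add: norm_sq closed inner_simps Re_inner_commute[of x y])

lemma norm_diff_sq:
  "x \<in> V \<Longrightarrow> y \<in> V \<Longrightarrow> (nrm (hs_diff E x y))\<^sup>2 = (nrm x)\<^sup>2 + (nrm y)\<^sup>2 - 2 * Re (ip x y)"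
  by (simp add: norm_sq closed inner_simps Re_inner_commute[of x y])

lemma norm_smul: "x \<in> V \<Longrightarrow> nrm (hs_smul E a x) = cmod a * nrm x"
proof -
  assume x: "x \<in> V"
  have "ip (hs_smul E a x) (hs_smul E a x) = (a * cnj a) * ip x x"
    using x by (simp add: closed inner_simps)
  also have "\<dots> = of_real ((cmod a)\<^sup>2 * (nrm x)\<^sup>2)"
    using x by (simp only: complex_norm_square[symmetric] inner_self of_real_mult)
  finally have "(nrm (hs_smul E a x))\<^sup>2 = (cmod a * nrm x)\<^sup>2"
    using x by (simp add: norm_sq[OF smul_closed] power_mult_distrib)
  thus ?thesis using x by (simp add: norm_nonneg closed power2_eq_iff_nonneg)
qed

lemma norm_diff_commute: "x \<in> V \<Longrightarrow> y \<in> V \<Longrightarrow> nrm (hs_diff E x y) = nrm (hs_diff E y x)"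
  by (simp add: hs_norm_def inner_simps closed)

lemma cauchy_schwarz:
  assumes x: "x \<in> V" and y: "y \<in> V"
  shows "cmod (ip x y) \<le> nrm x * nrm y"
proof -
  define B where "B = (cmod (ip x y))\<^sup>2"
  have B0: "0 \<le> B" by (simp add: B_def)
  have q: "0 \<le> (nrm x)\<^sup>2 - 2 * t * B + t\<^sup>2 * B * (nrm y)\<^sup>2" for t :: real
  proof -
    \<comment> \<open>This multiple of y makes the mixed term real, which leaves a quadratic
      polynomial in the real variable t.\<close>
    define a where "a = of_real t * ip x y"
    have "0 \<le> (nrm (hs_diff E x (hs_smul E a y)))\<^sup>2" by simp
    also have "\<dots> = (nrm x)\<^sup>2 + (cmod a)\<^sup>2 * (nrm y)\<^sup>2 - 2 * Re (cnj a * ip x y)"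
      using x y by (simp add: norm_diff_sq closed norm_smul inner_smul_right power_mult_distrib)
    also have "cnj a * ip x y = of_real (t * B)"
      unfolding a_def B_def using complex_norm_square[of "ip x y"] by (simp add: mult.commute mult.left_commute)
    also have "(cmod a)\<^sup>2 = t\<^sup>2 * B"
      by (simp add: a_def B_def norm_mult power_mult_distrib)
    finally show ?thesis by (simp add: algebra_simps)
  qed
  have "B \<le> (nrm x)\<^sup>2 * (nrm y)\<^sup>2"
  proof (cases "nrm y = 0")
    case True
    \<comment> \<open>For a null vector y the polynomial is affine in t with slope -2 B and would
      become negative for large t unless B = 0.\<close>
    have "B = 0"
    proof (rule ccontr)
      assume "B \<noteq> 0"
      hence "B > 0" using B0 by simp
      with q[of "((nrm x)\<^sup>2 + 1) / (2 * B)"] True show False by (simp add: field_simps)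
    qed
    thus ?thesis by simp
  next
    case False
    hence p: "(nrm y)\<^sup>2 > 0" by simp
    \<comment> \<open>The minimizer of the polynomial is \<open>t = 1 / d\<close> with d the square
      of \<open>nrm y\<close>.\<close>
    have "(1 / d)\<^sup>2 * B * d = B / d" if "d > 0" for d :: real
      using that by (simp add: power2_eq_square)
    from this[OF p] have "0 \<le> (nrm x)\<^sup>2 - B / (nrm y)\<^sup>2"
      using q[of "1 / (nrm y)\<^sup>2"] by simp
    thus ?thesis using p by (simp add: field_simps)
  qed
  hence "(cmod (ip x y))\<^sup>2 \<le> (nrm x * nrm y)\<^sup>2" by (simp add: B_def power_mult_distrib)
  thus ?thesis using x y by (meson norm_nonneg mult_nonneg_nonneg power2_le_imp_le)
qed

lemma norm_triangle:
  assumes x: "x \<in> V" and y: "y \<in> V"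
  shows "nrm (hs_add E x y) \<le> nrm x + nrm y"
proof -
  have "Re (ip x y) \<le> nrm x * nrm y"
    using cauchy_schwarz[OF x y] complex_Re_le_cmod[of "ip x y"] by linarith
  hence "(nrm (hs_add E x y))\<^sup>2 \<le> (nrm x + nrm y)\<^sup>2"
    using x y by (simp add: norm_add_sq power2_sum)
  thus ?thesis using x y by (meson norm_nonneg add_nonneg_nonneg power2_le_imp_le)
qed

lemma norm_triangle_diff:
  assumes x: "x \<in> V" and y: "y \<in> V"
  shows "nrm (hs_diff E x y) \<le> nrm x + nrm y"
  using norm_triangle[of x "hs_smul E (-1) y"] x y by (simp add: hs_diff_def closed norm_smul)

text \<open>\<open>x - z\<close> and \<open>(x - y) + (y - z)\<close> need not be equal as vectors
  here, but expanding the inner products shows that their norms agree.\<close>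

lemma dist_triangle_hs:
  assumes "x \<in> V" "y \<in> V" "z \<in> V"
  shows "nrm (hs_diff E x z) \<le> nrm (hs_diff E x y) + nrm (hs_diff E y z)"
proof -
  have "nrm (hs_diff E x z) = nrm (hs_add E (hs_diff E x y) (hs_diff E y z))"
    using assms by (simp add: hs_norm_def inner_simps closed)
  thus ?thesis using norm_triangle[of "hs_diff E x y" "hs_diff E y z"] assms by (simp add: closed)
qed

lemma norm_le_norm_diff:
  assumes "x \<in> V" "y \<in> V"
  shows "nrm x \<le> nrm y + nrm (hs_diff E x y)"
proof -
  have "nrm x = nrm (hs_add E y (hs_diff E x y))"
    using assms by (simp add: hs_norm_def inner_simps closed)
  thus ?thesis using norm_triangle[of y "hs_diff E x y"] assms by (simp add: closed)
qed

section \<open>Cauchy sequences and bounded antilinear functionals\<close>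

definition Cauchy_seq :: "(nat \<Rightarrow> 'e) \<Rightarrow> bool" where
  "Cauchy_seq s \<longleftrightarrow> (\<forall>n. s n \<in> V) \<and>
     (\<forall>e>0. \<exists>N. \<forall>m\<ge>N. \<forall>n\<ge>N. nrm (hs_diff E (s m) (s n)) < e)"

lemma Cauchy_seqD: "Cauchy_seq s \<Longrightarrow> s n \<in> V"
  by (simp add: Cauchy_seq_def)

lemma Cauchy_seq_bounded:
  assumes "Cauchy_seq s"
  obtains b where "b > 0" "\<And>n. nrm (s n) \<le> b"
proof -
  have V: "s n \<in> V" for n using assms by (rule Cauchy_seqD)
  obtain N where N: "\<And>m n. m \<ge> N \<Longrightarrow> n \<ge> N \<Longrightarrow> nrm (hs_diff E (s m) (s n)) < 1"
    using assms unfolding Cauchy_seq_def by (meson zero_less_one)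
  define b where "b = Max ((\<lambda>n. nrm (s n)) ` {..N}) + 1"
  have le: "nrm (s n) \<le> b - 1" if "n \<le> N" for n
    using that by (simp add: b_def)
  have "nrm (s n) \<le> b" for n
  proof (cases "n \<le> N")
    case False
    then show ?thesis using N[of n N] norm_le_norm_diff[of "s n" "s N"] V le[of N] by fastforce
  qed (use le in fastforce)
  moreover have "b > 0" using le[of 0] norm_nonneg[OF V, of 0] by simp
  ultimately show ?thesis using that by blast
qed

text \<open>Functionals \<open>x \<mapsto> ip h x\<close> are of this kind, the inner product being
  linear in its first argument.\<close>

definition antilinear :: "('e \<Rightarrow> complex) \<Rightarrow> bool" where
  "antilinear F \<longleftrightarrow> (\<forall>x\<in>V. \<forall>y\<in>V. F (hs_add E x y) = F x + F y) \<and>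
     (\<forall>a. \<forall>x\<in>V. F (hs_smul E a x) = cnj a * F x)"

lemma antilinear_add: "antilinear F \<Longrightarrow> x \<in> V \<Longrightarrow> y \<in> V \<Longrightarrow> F (hs_add E x y) = F x + F y"
  by (simp add: antilinear_def)

lemma antilinear_smul: "antilinear F \<Longrightarrow> x \<in> V \<Longrightarrow> F (hs_smul E a x) = cnj a * F x"
  by (simp add: antilinear_def)

lemma antilinear_diff: "antilinear F \<Longrightarrow> x \<in> V \<Longrightarrow> y \<in> V \<Longrightarrow> F (hs_diff E x y) = F x - F y"
  by (simp add: hs_diff_def antilinear_add antilinear_smul closed)

lemmas antilinear_simps = antilinear_add antilinear_smul antilinear_diff

text \<open>A minimizing sequence of \<open>J w = nrm w ^ 2 - 2 Re (F w)\<close> is Cauchy by the parallelogram law and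
  represents \<open>F\<close> in the limit.\<close>

lemma functional_Cauchy_seq:
  assumes F: "antilinear F" and bd: "\<And>x. x \<in> V \<Longrightarrow> cmod (F x) \<le> a * nrm x"
  obtains w where "Cauchy_seq w" "\<And>x. x \<in> V \<Longrightarrow> (\<lambda>n. ip (w n) x) \<longlonglongrightarrow> F x"
proof -
  define J where "J x = (nrm x)\<^sup>2 - 2 * Re (F x)" for x
  have lower: "- (a\<^sup>2) \<le> J x" if "x \<in> V" for x
  proof -
    have "Re (F x) \<le> a * nrm x" using bd[OF that] complex_Re_le_cmod[of "F x"] by linarith
    moreover have "0 \<le> (nrm x - a)\<^sup>2" by simp
    ultimately show ?thesis by (simp add: J_def power2_diff algebra_simps)
  qed
  define m where "m = Inf (J ` V)"
  have bb: "bdd_below (J ` V)" using lower by (intro bdd_belowI2) auto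
  have mle: "m \<le> J x" if "x \<in> V" for x
    unfolding m_def using bb that by (simp add: cINF_lower)
  have "\<exists>x\<in>V. J x < m + 1 / real (Suc n)" for n
    using cInf_lessD[of "J ` V" "m + 1 / real (Suc n)"] zero_closed unfolding m_def by auto
  then obtain w where w: "\<And>n. w n \<in> V" "\<And>n. J (w n) < m + 1 / real (Suc n)" by metis
  have par: "(nrm (hs_diff E x y))\<^sup>2 \<le> 2 * (J x - m) + 2 * (J y - m)" if "x \<in> V" "y \<in> V" for x y
  proof -
    define u where "u = hs_smul E (1/2) (hs_add E x y)"
    have "u \<in> V" using that by (simp add: u_def closed)
    have "J u = (nrm (hs_add E x y))\<^sup>2 / 4 - Re (F x + F y)"
      using that F by (simp add: J_def u_def norm_smul closed antilinear_simps power_divide add_divide_distrib)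
    hence "(nrm (hs_diff E x y))\<^sup>2 = 2 * J x + 2 * J y - 4 * J u"
      using that by (simp add: J_def norm_diff_sq norm_add_sq field_simps)
    with mle[OF \<open>u \<in> V\<close>] show ?thesis by simp
  qed
  have "Cauchy_seq w"
    unfolding Cauchy_seq_def
  proof (intro conjI allI impI w(1))
    fix e :: real assume e: "e > 0"
    then obtain N where N: "inverse (real (Suc N)) < e\<^sup>2 / 4"
      using reals_Archimedean[of "e\<^sup>2 / 4"] by auto
    show "\<exists>N. \<forall>i\<ge>N. \<forall>j\<ge>N. nrm (hs_diff E (w i) (w j)) < e"
    proof (intro exI allI impI)
      fix i j assume ij: "N \<le> i" "N \<le> j"
      have *: "1 / real (Suc k) < e\<^sup>2 / 4" if "N \<le> k" for k
      proof -
        have "1 / real (Suc k) \<le> inverse (real (Suc N))"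
          using that by (simp add: field_simps)
        thus ?thesis using N by linarith
      qed
      have "(nrm (hs_diff E (w i) (w j)))\<^sup>2 < e\<^sup>2"
      proof -
        have "J (w k) - m < e\<^sup>2 / 4" if "N \<le> k" for k
          using w(2)[of k] *[OF that] by simp
        note this[OF ij(1)] this[OF ij(2)]
        moreover have "D < d" if "D \<le> 2 * u + 2 * v" "u < d / 4" "v < d / 4" for D d u v :: real
          using that by linarith
        ultimately show ?thesis using par[OF w(1) w(1), of i j] by blast
      qed
      thus "nrm (hs_diff E (w i) (w j)) < e" using e by (simp add: power2_less_imp_less)
    qed
  qed
  moreover have "(\<lambda>n. ip (w n) x) \<longlonglongrightarrow> F x" if x: "x \<in> V" for x
  proof -
    have est: "(cmod (ip (w n) x - F x))\<^sup>2 \<le> (1 + (nrm x)\<^sup>2) * (1 / real (Suc n))" for n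
    proof -
      define z where "z = ip (w n) x - F x"
      \<comment> \<open>The competitor is w n + c x with c = -t z. With this t the quadratic term
        uses up at most half of the linear gain; the summand 1 keeps t meaningful for a null vector
        x.\<close>
      define t where "t = 1 / (1 + (nrm x)\<^sup>2)"
      have p1: "1 + (nrm x)\<^sup>2 > 0" by (simp add: add_pos_nonneg)
      have t: "t > 0" "t * (nrm x)\<^sup>2 \<le> 1" using p1 by (auto simp: t_def field_simps)
      define c where "c = - of_real t * z"
      have "m \<le> J (hs_add E (w n) (hs_smul E c x))" by (rule mle) (simp add: x w closed)
      also have "\<dots> = J (w n) + (cmod c)\<^sup>2 * (nrm x)\<^sup>2 + 2 * Re (cnj c * z)"
        using x w F by (simp add: J_def norm_add_sq closed norm_smul inner_simps antilinear_simps
            power_mult_distrib z_def algebra_simps)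
      also have "cnj c * z = - of_real (t * (cmod z)\<^sup>2)"
        unfolding c_def using complex_norm_square[of z] by (simp add: mult.commute mult.left_commute)
      also have "(cmod c)\<^sup>2 = t\<^sup>2 * (cmod z)\<^sup>2"
        by (simp add: c_def norm_mult power_mult_distrib)
      finally have "2 * (t * (cmod z)\<^sup>2) \<le> 1 / real (Suc n) + (t * (nrm x)\<^sup>2) * (t * (cmod z)\<^sup>2)"
        using w(2)[of n] by (simp add: power2_eq_square algebra_simps)
      moreover have "(t * (nrm x)\<^sup>2) * (t * (cmod z)\<^sup>2) \<le> 1 * (t * (cmod z)\<^sup>2)"
        using t by (intro mult_right_mono) auto
      ultimately have "t * (cmod z)\<^sup>2 \<le> 1 / real (Suc n)" by linarith
      thus ?thesis unfolding z_def[symmetric] using p1 by (simp add: t_def field_simps)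
    qed
    have "(\<lambda>n. (1 + (nrm x)\<^sup>2) * (1 / real (Suc n))) \<longlonglongrightarrow> (1 + (nrm x)\<^sup>2) * 0"
      using LIMSEQ_inverse_real_of_nat by (intro tendsto_mult_left) (simp add: inverse_eq_divide)
    hence lim0: "(\<lambda>n. (1 + (nrm x)\<^sup>2) * (1 / real (Suc n))) \<longlonglongrightarrow> 0" by simp
    have "(\<lambda>n. (cmod (ip (w n) x - F x))\<^sup>2) \<longlonglongrightarrow> 0"
      by (rule tendsto_sandwich[OF _ _ tendsto_const lim0]) (use est in simp_all)
    from tendsto_real_sqrt[OF this] have "(\<lambda>n. cmod (ip (w n) x - F x)) \<longlonglongrightarrow> 0" by simp
    thus ?thesis by (simp add: LIM_zero_iff tendsto_norm_zero_iff)
  qed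
  ultimately show ?thesis using that by blast
qed

text \<open>Split \<open><d n, d n> = <d n, d n - d N> + <d n, d N>\<close>: the first term is small
  by the Cauchy property and boundedness, the second because d N is a fixed test vector. No limit
  vector is involved, so the argument works before completion.\<close>

lemma Cauchy_seq_weakly_null:
  assumes d: "Cauchy_seq d" and z: "\<And>x. x \<in> V \<Longrightarrow> (\<lambda>n. ip (d n) x) \<longlonglongrightarrow> 0"
  shows "(\<lambda>n. nrm (d n)) \<longlonglongrightarrow> 0"
proof -
  have V: "d n \<in> V" for n using d by (rule Cauchy_seqD)
  obtain b where b: "b > 0" "\<And>n. nrm (d n) \<le> b" using Cauchy_seq_bounded[OF d] by blast
  have "(\<lambda>n. (nrm (d n))\<^sup>2) \<longlonglongrightarrow> 0"
  proof (rule LIMSEQ_I)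
    fix e :: real assume e: "e > 0"
    hence "e / (2 * b) > 0" using b by simp
    then obtain N where N: "\<And>m n. m \<ge> N \<Longrightarrow> n \<ge> N \<Longrightarrow> nrm (hs_diff E (d m) (d n)) < e / (2 * b)"
      using d unfolding Cauchy_seq_def by meson
    obtain N' where N': "\<And>n. n \<ge> N' \<Longrightarrow> cmod (ip (d n) (d N)) < e / 2"
      using LIMSEQ_D[OF z[OF V[of N]], of "e/2"] e by auto
    show "\<exists>no. \<forall>n\<ge>no. norm ((nrm (d n))\<^sup>2 - 0) < e"
    proof (intro exI allI impI)
      fix n assume n: "max N N' \<le> n"
      have "(nrm (d n))\<^sup>2 = Re (ip (d n) (hs_diff E (d n) (d N))) + Re (ip (d n) (d N))"
        using V by (simp add: norm_sq inner_simps)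
      also have "\<dots> \<le> nrm (d n) * nrm (hs_diff E (d n) (d N)) + cmod (ip (d n) (d N))"
        using cauchy_schwarz[OF V diff_closed[OF V V], of n n N] complex_Re_le_cmod
        by (meson add_mono order_trans)
      also have "nrm (d n) * nrm (hs_diff E (d n) (d N)) \<le> b * (e / (2 * b))"
        using b(1) b(2)[of n] N[of n N] n norm_nonneg[OF V] norm_nonneg[OF diff_closed[OF V V]]
        by (intro mult_mono) (simp_all add: less_imp_le)
      also have "b * (e / (2 * b)) = e / 2" using b by simp
      also have "cmod (ip (d n) (d N)) < e / 2" using N'[of n] n by simp
      finally show "norm ((nrm (d n))\<^sup>2 - 0) < e" by simp
    qed
  qed
  from tendsto_real_sqrt[OF this] show ?thesis by (simp add: norm_nonneg V)
qed

text \<open>Letting k tend to infinity in the Cauchy estimate for \<open>ip (w n - w k) x\<close>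
  makes the weak convergence uniform on the unit ball.\<close>

lemma Cauchy_seq_uniform:
  assumes w: "Cauchy_seq w" and F: "\<And>x. x \<in> V \<Longrightarrow> (\<lambda>n. ip (w n) x) \<longlonglongrightarrow> F x" and e: "e > 0"
  obtains N where "\<And>n x. n \<ge> N \<Longrightarrow> x \<in> V \<Longrightarrow> cmod (ip (w n) x - F x) \<le> e * nrm x"
proof -
  have V: "w n \<in> V" for n using w by (rule Cauchy_seqD)
  obtain N where N: "\<And>m n. m \<ge> N \<Longrightarrow> n \<ge> N \<Longrightarrow> nrm (hs_diff E (w m) (w n)) < e"
    using w e unfolding Cauchy_seq_def by meson
  have "cmod (ip (w n) x - F x) \<le> e * nrm x" if "n \<ge> N" "x \<in> V" for n x
  proof (rule tendsto_upperbound)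
    show "(\<lambda>k. cmod (ip (w n) x - ip (w k) x)) \<longlonglongrightarrow> cmod (ip (w n) x - F x)"
      by (intro tendsto_intros F that)
    have "cmod (ip (w n) x - ip (w k) x) \<le> e * nrm x" if k: "k \<ge> N" for k
    proof -
      have "cmod (ip (w n) x - ip (w k) x) = cmod (ip (hs_diff E (w n) (w k)) x)"
        using V \<open>x \<in> V\<close> by (simp add: inner_simps)
      also have "\<dots> \<le> nrm (hs_diff E (w n) (w k)) * nrm x"
        using V \<open>x \<in> V\<close> by (intro cauchy_schwarz closed)
      also have "\<dots> \<le> e * nrm x"
        using N[OF \<open>n \<ge> N\<close> k] \<open>x \<in> V\<close> by (intro mult_right_mono) (auto simp: norm_nonneg)
      finally show ?thesis .
    qed
    thus "\<forall>\<^sub>F k in sequentially. cmod (ip (w n) x - ip (w k) x) \<le> e * nrm x"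
      by (auto simp: eventually_sequentially)
  qed simp
  thus ?thesis using that by blast
qed

end

section \<open>Completion\<close>

context pre_hilbert
begin

text \<open>Vanishing outside \<open>V\<close> makes functionals that agree on \<open>V\<close>
  equal as functions; with pointwise operations the vector space laws then hold literally.\<close>

definition dual_set :: "('e \<Rightarrow> complex) set" where
  "dual_set = {F. (\<forall>x. x \<notin> V \<longrightarrow> F x = 0) \<and> antilinear F \<and> (\<exists>a. \<forall>x\<in>V. cmod (F x) \<le> a * nrm x)}"

text \<open>Such a sequence stands for a limit that may not exist in the space. The inner product of
  the completion evaluates one functional along a sequence representing the other.\<close>

definition represents :: "(nat \<Rightarrow> 'e) \<Rightarrow> ('e \<Rightarrow> complex) \<Rightarrow> bool" where
  "represents w F \<longleftrightarrow> Cauchy_seq w \<and> (\<forall>x\<in>V. (\<lambda>n. ip (w n) x) \<longlonglongrightarrow> F x)"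

definition repr :: "('e \<Rightarrow> complex) \<Rightarrow> nat \<Rightarrow> 'e" where
  "repr F = (SOME w. represents w F)"

text \<open>The completion, realized as the space of bounded antilinear functionals; a vector \<open>k\<close> of it
  is the functional \<open>x \<mapsto> \<langle>k, x\<rangle>\<close>.\<close>

definition completion :: "('e \<Rightarrow> complex) hspace" where
  "completion = \<lparr>hs_carrier = dual_set, hs_zero = (\<lambda>_. 0), hs_add = (\<lambda>F G x. F x + G x),
     hs_smul = (\<lambda>a F x. a * F x), hs_inner = (\<lambda>F G. lim (\<lambda>n. F (repr G n)))\<rparr>"

lemma completion_simps [simp]:
  "hs_carrier completion = dual_set" "hs_zero completion = (\<lambda>_. 0)"
  "hs_add completion F G = (\<lambda>x. F x + G x)" "hs_smul completion a F = (\<lambda>x. a * F x)"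
  by (simp_all add: completion_def)

lemma completion_diff [simp]: "hs_diff completion F G = (\<lambda>x. F x - G x)"
  by (simp add: hs_diff_def)

lemma dual_setI:
  "(\<And>x. x \<notin> V \<Longrightarrow> F x = 0) \<Longrightarrow> antilinear F \<Longrightarrow> (\<And>x. x \<in> V \<Longrightarrow> cmod (F x) \<le> a * nrm x) \<Longrightarrow> F \<in> dual_set"
  by (auto simp: dual_set_def)

lemma dual_setD:
  assumes "F \<in> dual_set"
  shows "\<And>x. x \<notin> V \<Longrightarrow> F x = 0" "antilinear F"
  using assms by (auto simp: dual_set_def)

lemma dual_set_bound:
  assumes "F \<in> dual_set"
  obtains a where "a > 0" "\<And>x. x \<in> V \<Longrightarrow> cmod (F x) \<le> a * nrm x"
proof -
  obtain a where a: "\<forall>x\<in>V. cmod (F x) \<le> a * nrm x" using assms by (auto simp: dual_set_def)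
  have "cmod (F x) \<le> (\<bar>a\<bar> + 1) * nrm x" if "x \<in> V" for x
  proof -
    have "a * nrm x \<le> (\<bar>a\<bar> + 1) * nrm x"
      using norm_nonneg[OF that] by (intro mult_right_mono) auto
    thus ?thesis using a that by fastforce
  qed
  thus ?thesis using that[of "\<bar>a\<bar> + 1"] by simp
qed

lemma represents_repr:
  assumes F: "F \<in> dual_set"
  shows "represents (repr F) F"
proof -
  obtain a where a: "a > 0" "\<And>x. x \<in> V \<Longrightarrow> cmod (F x) \<le> a * nrm x" by (rule dual_set_bound[OF F], rule that)
  obtain w where "Cauchy_seq w" "\<And>x. x \<in> V \<Longrightarrow> (\<lambda>n. ip (w n) x) \<longlonglongrightarrow> F x"
    by (rule functional_Cauchy_seq[OF dual_setD(2)[OF F] a(2)], assumption, rule that)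
  hence "represents w F" by (simp add: represents_def)
  thus ?thesis unfolding repr_def by (rule someI[where P = "\<lambda>w. represents w F"])
qed

lemma representsD:
  assumes "represents w F"
  shows "Cauchy_seq w" "\<And>n. w n \<in> V" "\<And>x. x \<in> V \<Longrightarrow> (\<lambda>n. ip (w n) x) \<longlonglongrightarrow> F x"
  using assms by (auto simp: represents_def Cauchy_seqD)

lemma dual_set_zero: "(\<lambda>_. 0) \<in> dual_set"
  by (rule dual_setI[where a = 0]) (auto simp: antilinear_def)

lemma antilinear_plus: "antilinear F \<Longrightarrow> antilinear G \<Longrightarrow> antilinear (\<lambda>x. F x + G x)"
  by (simp add: antilinear_def algebra_simps)

lemma antilinear_scale: "antilinear F \<Longrightarrow> antilinear (\<lambda>x. c * F x)"
  by (simp add: antilinear_def algebra_simps)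

lemma dual_set_add: "F \<in> dual_set \<Longrightarrow> G \<in> dual_set \<Longrightarrow> (\<lambda>x. F x + G x) \<in> dual_set"
proof -
  assume F: "F \<in> dual_set" and G: "G \<in> dual_set"
  obtain a where a: "a > 0" "\<And>x. x \<in> V \<Longrightarrow> cmod (F x) \<le> a * nrm x" by (rule dual_set_bound[OF F], rule that)
  obtain b where b: "b > 0" "\<And>x. x \<in> V \<Longrightarrow> cmod (G x) \<le> b * nrm x" by (rule dual_set_bound[OF G], rule that)
  have "cmod (F x + G x) \<le> (a + b) * nrm x" if "x \<in> V" for x
    using norm_triangle_ineq[of "F x" "G x"] a(2)[OF that] b(2)[OF that] by (simp add: algebra_simps)
  thus ?thesis using F G
    by (intro dual_setI[where a = "a + b"] antilinear_plus) (simp_all add: dual_setD)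
qed

lemma dual_set_smul: "F \<in> dual_set \<Longrightarrow> (\<lambda>x. c * F x) \<in> dual_set"
proof -
  assume F: "F \<in> dual_set"
  obtain a where a: "a > 0" "\<And>x. x \<in> V \<Longrightarrow> cmod (F x) \<le> a * nrm x" by (rule dual_set_bound[OF F], rule that)
  have "cmod (c * F x) \<le> (cmod c * a) * nrm x" if "x \<in> V" for x
    using mult_left_mono[OF a(2)[OF that], of "cmod c"] by (simp add: norm_mult mult.assoc)
  thus ?thesis using F
    by (intro dual_setI[where a = "cmod c * a"] antilinear_scale) (simp_all add: dual_setD)
qed

text \<open>A bounded antilinear functional maps Cauchy sequences of vectors to Cauchy sequences of
  numbers, so the limit that defines the inner product exists.\<close>

lemma completion_inner_lim:
  assumes F: "F \<in> dual_set" and G: "G \<in> dual_set"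
  shows "(\<lambda>n. F (repr G n)) \<longlonglongrightarrow> hs_inner completion F G"
proof -
  note w = representsD[OF represents_repr[OF G]]
  obtain a where a: "a > 0" "\<And>x. x \<in> V \<Longrightarrow> cmod (F x) \<le> a * nrm x" by (rule dual_set_bound[OF F], rule that)
  have "Cauchy (\<lambda>n. F (repr G n))"
  proof (rule CauchyI)
    fix e :: real assume e: "e > 0"
    hence "e / a > 0" using a by simp
    then obtain N where N: "\<And>m n. m \<ge> N \<Longrightarrow> n \<ge> N \<Longrightarrow> nrm (hs_diff E (repr G m) (repr G n)) < e / a"
      using w(1) unfolding Cauchy_seq_def by meson
    have "norm (F (repr G m) - F (repr G n)) < e" if "m \<ge> N" "n \<ge> N" for m n
    proof -
      have "norm (F (repr G m) - F (repr G n)) = norm (F (hs_diff E (repr G m) (repr G n)))"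
        using dual_setD(2)[OF F] w(2) by (simp add: antilinear_simps)
      also have "\<dots> \<le> a * nrm (hs_diff E (repr G m) (repr G n))" using w(2) by (intro a(2) closed)
      also have "\<dots> < a * (e / a)" using N[OF that] a(1) by (intro mult_strict_left_mono)
      finally show ?thesis using a(1) by simp
    qed
    thus "\<exists>M. \<forall>m\<ge>M. \<forall>n\<ge>M. norm (F (repr G m) - F (repr G n)) < e" by blast
  qed
  thus ?thesis by (simp add: completion_def convergent_LIMSEQ_iff[symmetric] Cauchy_convergent)
qed

text \<open>An expression symmetric in F and G, from which conjugate symmetry and positivity follow.
  F may be replaced by its approximants because they converge to it uniformly on bounded sets and
  \<open>repr G\<close> is bounded.\<close>

lemma repr_inner_lim:
  assumes F: "F \<in> dual_set" and G: "G \<in> dual_set"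
  shows "(\<lambda>n. ip (repr F n) (repr G n)) \<longlonglongrightarrow> hs_inner completion F G"
proof -
  note w = representsD[OF represents_repr[OF F]] and v = representsD[OF represents_repr[OF G]]
  obtain b where b: "b > 0" "\<And>n. nrm (repr G n) \<le> b" by (rule Cauchy_seq_bounded[OF v(1)], rule that)
  have "(\<lambda>n. ip (repr F n) (repr G n) - F (repr G n)) \<longlonglongrightarrow> 0"
  proof (rule LIMSEQ_I)
    fix e :: real assume "e > 0"
    hence e: "e / (2 * b) > 0" using b by simp
    obtain N where N: "\<And>n x. n \<ge> N \<Longrightarrow> x \<in> V \<Longrightarrow> cmod (ip (repr F n) x - F x) \<le> e / (2 * b) * nrm x"
      using Cauchy_seq_uniform[OF w(1) w(3) e] by blast
    have "norm (ip (repr F n) (repr G n) - F (repr G n) - 0) < e" if "n \<ge> N" for n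
    proof -
      have "norm (ip (repr F n) (repr G n) - F (repr G n) - 0) \<le> e / (2 * b) * nrm (repr G n)"
        using N[OF that v(2)] by simp
      also have "\<dots> \<le> e / (2 * b) * b" using e b by (intro mult_left_mono) auto
      also have "\<dots> < e" using b \<open>e > 0\<close> by simp
      finally show ?thesis .
    qed
    thus "\<exists>no. \<forall>n\<ge>no. norm (ip (repr F n) (repr G n) - F (repr G n) - 0) < e" by blast
  qed
  from tendsto_add[OF this completion_inner_lim[OF F G]] show ?thesis by (simp only: diff_add_cancel add_0)
qed

lemma completion_inner_commute:
  assumes F: "F \<in> dual_set" and G: "G \<in> dual_set"
  shows "hs_inner completion F G = cnj (hs_inner completion G F)"
proof -
  have "(\<lambda>n. ip (repr F n) (repr G n)) = (\<lambda>n. cnj (ip (repr G n) (repr F n)))"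
    by (intro ext inner_commute representsD(2)[OF represents_repr] F G)
  thus ?thesis
    using LIMSEQ_unique[OF repr_inner_lim[OF F G]] tendsto_cnj[OF repr_inner_lim[OF G F]] by simp
qed

lemma completion_inner_nonneg: "F \<in> dual_set \<Longrightarrow> 0 \<le> Re (hs_inner completion F F)"
  by (rule tendsto_lowerbound[OF tendsto_Re[OF repr_inner_lim]])
    (simp_all add: inner_nonneg representsD[OF represents_repr])

lemma completion_inner_smul:
  assumes F: "F \<in> dual_set" and G: "G \<in> dual_set"
  shows "hs_inner completion (\<lambda>x. a * F x) G = a * hs_inner completion F G"
  by (rule LIMSEQ_unique[OF completion_inner_lim[OF dual_set_smul[OF F] G]
        tendsto_mult_left[OF completion_inner_lim[OF F G]]])

lemma completion_inner_add:
  assumes F: "F \<in> dual_set" and G: "G \<in> dual_set" and K: "K \<in> dual_set"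
  shows "hs_inner completion (\<lambda>x. F x + G x) K = hs_inner completion F K + hs_inner completion G K"
  by (rule LIMSEQ_unique[OF completion_inner_lim[OF dual_set_add[OF F G] K]
        tendsto_add[OF completion_inner_lim[OF F K] completion_inner_lim[OF G K]]])

lemma completion_inner_zero: "G \<in> dual_set \<Longrightarrow> hs_inner completion (\<lambda>x. 0) G = 0"
  using completion_inner_smul[of G G 0] by simp

lemma completion_pre_hilbert: "pre_hilbert completion"
  by (rule pre_hilbert.intro; unfold completion_simps)
    (rule dual_set_zero dual_set_add dual_set_smul completion_inner_commute completion_inner_add
      completion_inner_smul completion_inner_zero completion_inner_nonneg; assumption)+

abbreviation cnrm where "cnrm \<equiv> hs_norm completion"

lemma repr_norm_lim:
  assumes F: "F \<in> dual_set"
  shows "(\<lambda>n. nrm (repr F n)) \<longlonglongrightarrow> cnrm F"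
  unfolding hs_norm_def by (intro tendsto_real_sqrt tendsto_Re repr_inner_lim F)

lemma completion_norm_nonneg: "F \<in> dual_set \<Longrightarrow> 0 \<le> cnrm F"
  using pre_hilbert.norm_nonneg[OF completion_pre_hilbert] by simp

lemma completion_bound:
  assumes F: "F \<in> dual_set" and x: "x \<in> V"
  shows "cmod (F x) \<le> cnrm F * nrm x"
proof (rule LIMSEQ_le)
  note w = representsD[OF represents_repr[OF F]]
  show "(\<lambda>n. cmod (ip (repr F n) x)) \<longlonglongrightarrow> cmod (F x)" by (intro tendsto_norm w x)
  show "(\<lambda>n. nrm (repr F n) * nrm x) \<longlonglongrightarrow> cnrm F * nrm x"
    by (intro tendsto_mult_right repr_norm_lim F)
  show "\<exists>N. \<forall>n\<ge>N. cmod (ip (repr F n) x) \<le> nrm (repr F n) * nrm x"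
    by (intro exI allI impI cauchy_schwarz w x)
qed

text \<open>F is tested on its own approximants: \<open><F, F>\<close> is the limit of
  \<open>F (repr F n)\<close>, so its modulus is at most \<open>a * cnrm F\<close>. Together with
  \<open>completion_bound\<close> this identifies \<open>cnrm\<close> as the norm of a
  functional.\<close>

lemma completion_norm_le:
  assumes F: "F \<in> dual_set" and a: "0 \<le> a" "\<And>x. x \<in> V \<Longrightarrow> cmod (F x) \<le> a * nrm x"
  shows "cnrm F \<le> a"
proof -
  note w = representsD[OF represents_repr[OF F]]
  have "cmod (hs_inner completion F F) \<le> a * cnrm F"
  proof (rule LIMSEQ_le)
    show "(\<lambda>n. cmod (F (repr F n))) \<longlonglongrightarrow> cmod (hs_inner completion F F)"
      by (intro tendsto_norm completion_inner_lim F)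
    show "(\<lambda>n. a * nrm (repr F n)) \<longlonglongrightarrow> a * cnrm F"
      by (intro tendsto_mult_left repr_norm_lim F)
    show "\<exists>N. \<forall>n\<ge>N. cmod (F (repr F n)) \<le> a * nrm (repr F n)"
      by (intro exI allI impI a w)
  qed
  moreover have "cmod (hs_inner completion F F) = (cnrm F)\<^sup>2"
    using pre_hilbert.inner_self[OF completion_pre_hilbert, of F] F by (simp add: norm_power)
  ultimately have "cnrm F * cnrm F \<le> a * cnrm F" by (simp add: power2_eq_square)
  thus ?thesis using completion_norm_nonneg[OF F] a(1) by (cases "cnrm F = 0") auto
qed

text \<open>The Riesz map. Null vectors go to the zero functional, which replaces the formation of a
  quotient.\<close>

definition embed :: "'e \<Rightarrow> 'e \<Rightarrow> complex" where
  "embed e = (\<lambda>x. if x \<in> V then ip e x else 0)"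

lemma embed_in: "e \<in> V \<Longrightarrow> embed e \<in> dual_set"
  by (rule dual_setI[where a = "nrm e"])
    (simp_all add: embed_def antilinear_def inner_add_right inner_smul_right closed cauchy_schwarz)

text \<open>The reproducing property. The chosen sequence \<open>repr (embed e)\<close> need not be
  constant, but its difference from e is Cauchy and weakly null, hence null in norm, and F is
  bounded.\<close>

lemma inner_embed:
  assumes F: "F \<in> dual_set" and e: "e \<in> V"
  shows "hs_inner completion F (embed e) = F e"
proof -
  note G = embed_in[OF e]
  note w = representsD[OF represents_repr[OF G]]
  define d where "d n = hs_diff E (repr (embed e) n) e" for n
  have d: "Cauchy_seq d"
  proof -
    have "nrm (hs_diff E (d m) (d n)) = nrm (hs_diff E (repr (embed e) m) (repr (embed e) n))" for m n
      using w(2) e by (simp add: d_def hs_norm_def inner_simps closed)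
    thus ?thesis using w(1,2) e by (simp add: Cauchy_seq_def d_def closed)
  qed
  have d0: "(\<lambda>n. nrm (d n)) \<longlonglongrightarrow> 0"
  proof (rule Cauchy_seq_weakly_null[OF d])
    fix x assume x: "x \<in> V"
    have "(\<lambda>n. ip (repr (embed e) n) x - ip e x) \<longlonglongrightarrow> embed e x - ip e x"
      by (intro tendsto_diff w x tendsto_const)
    thus "(\<lambda>n. ip (d n) x) \<longlonglongrightarrow> 0"
      using x e w(2) by (simp add: d_def inner_simps embed_def)
  qed
  obtain a where a: "a > 0" "\<And>x. x \<in> V \<Longrightarrow> cmod (F x) \<le> a * nrm x" by (rule dual_set_bound[OF F], rule that)
  have ad0: "(\<lambda>n. a * nrm (d n)) \<longlonglongrightarrow> 0" using tendsto_mult_left[OF d0, of a] by simp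
  have le: "norm (F (repr (embed e) n) - F e) \<le> a * nrm (d n)" for n
  proof -
    have "F (d n) = F (repr (embed e) n) - F e"
      unfolding d_def by (rule antilinear_diff[OF dual_setD(2)[OF F] w(2) e])
    thus ?thesis using a(2)[OF Cauchy_seqD[OF d], of n] by simp
  qed
  have "(\<lambda>n. F (repr (embed e) n) - F e) \<longlonglongrightarrow> 0"
    by (rule Lim_null_comparison[OF _ ad0]) (simp add: le)
  hence "(\<lambda>n. F (repr (embed e) n)) \<longlonglongrightarrow> F e" by (simp add: LIM_zero_iff)
  thus ?thesis by (rule LIMSEQ_unique[OF completion_inner_lim[OF F G]])
qed

lemma inner_embed_embed: "e \<in> V \<Longrightarrow> f \<in> V \<Longrightarrow> hs_inner completion (embed e) (embed f) = ip e f"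
  by (simp add: inner_embed embed_in) (simp add: embed_def)

lemma norm_embed: "e \<in> V \<Longrightarrow> cnrm (embed e) = nrm e"
  by (simp add: hs_norm_def inner_embed_embed)

text \<open>The approximants in \<open>repr F\<close> converge to F uniformly on the unit ball,
  which is convergence in the norm of the completion.\<close>

lemma embed_dense:
  assumes F: "F \<in> dual_set" and e: "e > 0"
  obtains x where "x \<in> V" "cnrm (\<lambda>y. F y - embed x y) \<le> e"
proof -
  note w = representsD[OF represents_repr[OF F]]
  obtain N where N: "\<And>n x. n \<ge> N \<Longrightarrow> x \<in> V \<Longrightarrow> cmod (ip (repr F n) x - F x) \<le> e * nrm x"
    using Cauchy_seq_uniform[OF w(1) w(3) e] by blast
  have "hs_diff completion F (embed (repr F N)) \<in> dual_set"
    using pre_hilbert.diff_closed[OF completion_pre_hilbert] F embed_in w(2) by simp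
  hence "cnrm (\<lambda>y. F y - embed (repr F N) y) \<le> e"
    using N[of N] e by (intro completion_norm_le) (auto simp: embed_def norm_minus_commute)
  thus ?thesis using that w(2) by blast
qed

text \<open>Completeness is that of a dual space: a Cauchy sequence converges pointwise, the limit
  inherits antilinearity and boundedness, and sending one index to infinity in the Cauchy condition
  gives convergence in norm.\<close>

theorem completion_hilbert: "hilbert_space completion"
proof -
  interpret C: pre_hilbert completion by (rule completion_pre_hilbert)
  have definite: "F = (\<lambda>_. 0)" if F: "F \<in> dual_set" and 0: "hs_inner completion F F = 0" for F
  proof
    fix x
    show "F x = 0"
      using completion_bound[OF F, of x] dual_setD(1)[OF F, of x] 0
      by (cases "x \<in> V") (auto simp: hs_norm_def)
  qed
  have complete: "\<exists>l\<in>dual_set. \<forall>e>0. \<exists>N. \<forall>n\<ge>N. cnrm (\<lambda>x. s n x - l x) < e"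
    if s: "\<And>n. s n \<in> dual_set"
      and cau: "\<And>e. e > 0 \<Longrightarrow> \<exists>N. \<forall>m\<ge>N. \<forall>n\<ge>N. cnrm (\<lambda>x. s m x - s n x) < e" for s :: "nat \<Rightarrow> 'e \<Rightarrow> complex"
  proof -
    have sd: "(\<lambda>x. s m x - s n x) \<in> dual_set" for m n using C.diff_closed[of "s m" "s n"] s by simp
    have pc: "convergent (\<lambda>n. s n x)" for x
    proof (cases "x \<in> V")
      case True
      have "Cauchy (\<lambda>n. s n x)"
      proof (rule CauchyI)
        fix e :: real assume e: "e > 0"
        \<comment> \<open>The added 1 avoids dividing by the norm of a null vector.\<close>
        have p: "nrm x + 1 > 0" using norm_nonneg[OF True] by simp
        obtain N where N: "\<And>m n. m \<ge> N \<Longrightarrow> n \<ge> N \<Longrightarrow> cnrm (\<lambda>x. s m x - s n x) < e / (nrm x + 1)"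
          using cau[OF divide_pos_pos[OF e p]] by blast
        have "norm (s m x - s n x) < e" if "m \<ge> N" "n \<ge> N" for m n
        proof -
          have "norm (s m x - s n x) \<le> cnrm (\<lambda>x. s m x - s n x) * nrm x"
            using completion_bound[OF sd True] .
          also have "\<dots> \<le> cnrm (\<lambda>x. s m x - s n x) * (nrm x + 1)"
            using completion_norm_nonneg[OF sd] by (intro mult_left_mono) auto
          also have "\<dots> < e" using N[OF that] p by (simp add: field_simps)
          finally show ?thesis .
        qed
        thus "\<exists>M. \<forall>m\<ge>M. \<forall>n\<ge>M. norm (s m x - s n x) < e" by blast
      qed
      thus ?thesis by (simp add: Cauchy_convergent)
    next
      case False
      hence "s n x = 0" for n using dual_setD(1)[OF s] by blast
      thus ?thesis by (simp add: convergent_const)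
    qed
    define l where "l x = lim (\<lambda>n. s n x)" for x
    have l: "(\<lambda>n. s n x) \<longlonglongrightarrow> l x" for x
      using pc by (simp add: l_def convergent_LIMSEQ_iff)
    have anti: "antilinear l"
      unfolding antilinear_def
    proof (intro conjI ballI allI)
      fix x y a assume x: "x \<in> V"
      have "(\<lambda>n. s n (hs_smul E a x)) = (\<lambda>n. cnj a * s n x)"
        by (intro ext antilinear_smul dual_setD(2)[OF s] x)
      thus "l (hs_smul E a x) = cnj a * l x"
        using LIMSEQ_unique[OF l[of "hs_smul E a x"]] tendsto_mult_left[OF l[of x]] by simp
      assume y: "y \<in> V"
      have "(\<lambda>n. s n (hs_add E x y)) = (\<lambda>n. s n x + s n y)"
        by (intro ext antilinear_add dual_setD(2)[OF s] x y)
      thus "l (hs_add E x y) = l x + l y"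
        using LIMSEQ_unique[OF l[of "hs_add E x y"]] tendsto_add[OF l[of x] l[of y]] by simp
    qed
    have close: "\<exists>N. \<forall>n\<ge>N. \<forall>x\<in>V. cmod (s n x - l x) \<le> e * nrm x" if e: "e > 0" for e
    proof -
      obtain N where N: "\<And>m n. m \<ge> N \<Longrightarrow> n \<ge> N \<Longrightarrow> cnrm (\<lambda>x. s m x - s n x) < e"
        using cau[OF e] by blast
      have "cmod (s n x - l x) \<le> e * nrm x" if "n \<ge> N" "x \<in> V" for n x
      proof (rule tendsto_upperbound)
        show "(\<lambda>k. cmod (s n x - s k x)) \<longlonglongrightarrow> cmod (s n x - l x)" by (intro tendsto_intros l)
        have "cmod (s n x - s k x) \<le> e * nrm x" if "k \<ge> N" for k
        proof -
          have "cmod (s n x - s k x) \<le> cnrm (\<lambda>x. s n x - s k x) * nrm x"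
            using completion_bound[OF sd \<open>x \<in> V\<close>] .
          also have "\<dots> \<le> e * nrm x"
            using N[OF \<open>n \<ge> N\<close> that] norm_nonneg[OF \<open>x \<in> V\<close>] by (intro mult_right_mono) auto
          finally show ?thesis .
        qed
        thus "\<forall>\<^sub>F k in sequentially. cmod (s n x - s k x) \<le> e * nrm x"
          by (auto simp: eventually_sequentially)
      qed simp
      thus ?thesis by blast
    qed
    have l0: "l x = 0" if "x \<notin> V" for x
      using l[of x] dual_setD(1)[OF s that] by (simp add: LIMSEQ_const_iff)
    have lin: "l \<in> dual_set"
    proof -
      obtain N where N: "\<forall>x\<in>V. cmod (s N x - l x) \<le> 1 * nrm x" using close[of 1] by auto
      have "cmod (l x) \<le> (cnrm (s N) + 1) * nrm x" if "x \<in> V" for x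
      proof -
        have "cmod (l x) \<le> cmod (s N x) + cmod (s N x - l x)"
          by (metis add.commute norm_minus_commute norm_triangle_sub)
        also have "\<dots> \<le> cnrm (s N) * nrm x + 1 * nrm x"
          by (intro add_mono completion_bound s that N[rule_format])
        finally show ?thesis by (simp add: algebra_simps)
      qed
      thus ?thesis using l0 anti by (intro dual_setI) auto
    qed
    have "\<exists>N. \<forall>n\<ge>N. cnrm (\<lambda>x. s n x - l x) < e" if e: "e > 0" for e
    proof -
      obtain N where N: "\<And>n x. n \<ge> N \<Longrightarrow> x \<in> V \<Longrightarrow> cmod (s n x - l x) \<le> e / 2 * nrm x"
        using close[of "e / 2"] e by auto
      have "cnrm (\<lambda>x. s n x - l x) < e" if "n \<ge> N" for n
      proof -
        have "(\<lambda>x. s n x - l x) \<in> dual_set" using C.diff_closed[of "s n" l] s lin by simp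
        hence "cnrm (\<lambda>x. s n x - l x) \<le> e / 2"
          using N[OF that] e by (intro completion_norm_le) auto
        thus ?thesis using e by simp
      qed
      thus ?thesis by blast
    qed
    thus ?thesis using lin by blast
  qed
  have neg: "\<exists>y\<in>dual_set. (\<lambda>t. x t + y t) = (\<lambda>_. 0)" if "x \<in> dual_set" for x
    using dual_set_smul[OF that, of "-1"] by (intro bexI[of _ "\<lambda>t. - 1 * x t"]) auto
  note ax = C.inner_commute C.inner_add_left C.inner_smul_left C.inner_nonneg
  have im: "Im (hs_inner completion F F) = 0" if "F \<in> dual_set" for F
    using C.inner_self[of F] that by simp
  show ?thesis
    unfolding hilbert_space_def Let_def completion_simps completion_diff
  proof (intro conjI allI ballI impI)
    fix x y assume "x \<in> dual_set" "y \<in> dual_set"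
    then show "hs_inner completion x y = cnj (hs_inner completion y x)" by (intro ax) auto
  next
    fix x y w assume "x \<in> dual_set" "y \<in> dual_set" "w \<in> dual_set"
    then show "hs_inner completion (\<lambda>t. x t + y t) w = hs_inner completion x w + hs_inner completion y w"
      using ax(2)[of x y w] by simp
  next
    fix a x y assume "x \<in> dual_set" "y \<in> dual_set"
    then show "hs_inner completion (\<lambda>t. a * x t) y = a * hs_inner completion x y"
      using ax(3)[of x y a] by simp
  next
    fix x assume "x \<in> dual_set"
    then show "0 \<le> Re (hs_inner completion x x)" using ax(4)[of x] by simp
  next
    fix x assume "x \<in> dual_set" "hs_inner completion x x = 0"
    then show "x = (\<lambda>_. 0)" by (rule definite)
  next
    fix s :: "nat \<Rightarrow> 'e \<Rightarrow> complex"
    assume "\<forall>n. s n \<in> dual_set" "\<forall>e>0. \<exists>N. \<forall>m\<ge>N. \<forall>n\<ge>N. cnrm (\<lambda>x. s m x - s n x) < e"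
    then show "\<exists>l\<in>dual_set. \<forall>e>0. \<exists>N. \<forall>n\<ge>N. cnrm (\<lambda>x. s n x - l x) < e"
      by (intro complete) blast+
  qed ((rule dual_set_zero dual_set_add dual_set_smul neg im; assumption) | (rule ext, simp add: algebra_simps))+
qed

end

text \<open>\<open>eqI\<close> condenses definiteness and the vector space laws into the form that
  suits operators given by Riesz representation: vectors are compared through their inner
  products.\<close>

locale hilbert = pre_hilbert E for E :: "'e hspace" +
  assumes eqI: "\<And>x y. x \<in> hs_carrier E \<Longrightarrow> y \<in> hs_carrier E \<Longrightarrow>
      (\<And>z. z \<in> hs_carrier E \<Longrightarrow> hs_inner E x z = hs_inner E y z) \<Longrightarrow> x = y"
    and complete: "\<And>s. Cauchy_seq s \<Longrightarrow> \<exists>l\<in>hs_carrier E. (\<lambda>n. hs_norm E (hs_diff E (s n) l)) \<longlonglongrightarrow> 0"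

lemma hilbert_space_pre_hilbert:
  assumes "hilbert_space H"
  shows "pre_hilbert H"
proof -
  let ?V = "hs_carrier H" and ?ip = "hs_inner H"
  note H = assms[unfolded hilbert_space_def Let_def]
  have a1: "hs_zero H \<in> ?V"
    and a2: "\<forall>x\<in>?V. \<forall>y\<in>?V. hs_add H x y \<in> ?V"
    and a3: "\<forall>a. \<forall>x\<in>?V. hs_smul H a x \<in> ?V"
    and a4: "\<forall>x\<in>?V. \<forall>y\<in>?V. ?ip x y = cnj (?ip y x)"
    and a5: "\<forall>x\<in>?V. \<forall>y\<in>?V. \<forall>w\<in>?V. ?ip (hs_add H x y) w = ?ip x w + ?ip y w"
    and a6: "\<forall>a. \<forall>x\<in>?V. \<forall>y\<in>?V. ?ip (hs_smul H a x) y = a * ?ip x y"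
    and a8: "\<forall>x\<in>?V. hs_add H (hs_zero H) x = x"
    and a7: "\<forall>x\<in>?V. Im (?ip x x) = 0 \<and> Re (?ip x x) \<ge> 0"
    using H by - (elim conjE; assumption)+
  show ?thesis
  proof (rule pre_hilbert.intro)
    show "hs_zero H \<in> ?V" by (rule a1)
    show "hs_add H x y \<in> ?V" if "x \<in> ?V" "y \<in> ?V" for x y using a2 that by blast
    show "hs_smul H a x \<in> ?V" if "x \<in> ?V" for a x using a3 that by blast
    show "?ip x y = cnj (?ip y x)" if "x \<in> ?V" "y \<in> ?V" for x y by (rule a4[rule_format, OF that])
    show "?ip (hs_add H x y) w = ?ip x w + ?ip y w" if "x \<in> ?V" "y \<in> ?V" "w \<in> ?V" for x y w
      by (rule a5[rule_format, OF that])
    show "?ip (hs_smul H a x) y = a * ?ip x y" if "x \<in> ?V" "y \<in> ?V" for a x y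
      by (rule a6[rule_format, OF that])
    show "?ip (hs_zero H) x = 0" if x: "x \<in> ?V" for x
    proof -
      have "?ip (hs_add H (hs_zero H) (hs_zero H)) x = ?ip (hs_zero H) x + ?ip (hs_zero H) x"
        by (rule a5[rule_format, OF a1 a1 x])
      thus ?thesis using a8 a1 by simp
    qed
    show "0 \<le> Re (?ip x x)" if "x \<in> ?V" for x using a7 that by blast
  qed
qed

lemma hilbert_space_hilbert:
  fixes H :: "'h hspace"
  assumes "hilbert_space H"
  shows "hilbert H"
proof -
  interpret pre_hilbert H using assms by (rule hilbert_space_pre_hilbert)
  note H = assms[unfolded hilbert_space_def Let_def]
  have assoc: "\<forall>x\<in>V. \<forall>y\<in>V. \<forall>w\<in>V. hs_add H (hs_add H x y) w = hs_add H x (hs_add H y w)"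
    and comm: "\<forall>x\<in>V. \<forall>y\<in>V. hs_add H x y = hs_add H y x"
    and zero: "\<forall>x\<in>V. hs_add H (hs_zero H) x = x"
    and distr: "\<forall>a b. \<forall>x\<in>V. hs_smul H (a + b) x = hs_add H (hs_smul H a x) (hs_smul H b x)"
    and one: "\<forall>x\<in>V. hs_smul H 1 x = x"
    and definite: "\<forall>x\<in>V. ip x x = 0 \<longrightarrow> x = hs_zero H"
    and compl: "\<forall>s :: nat \<Rightarrow> 'h. (\<forall>n. s n \<in> V) \<longrightarrow>
          (\<forall>e>0. \<exists>N. \<forall>m\<ge>N. \<forall>n\<ge>N. nrm (hs_diff H (s m) (s n)) < e) \<longrightarrow>
          (\<exists>l\<in>V. \<forall>e>0. \<exists>N. \<forall>n\<ge>N. nrm (hs_diff H (s n) l) < e)"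
    using H by - (elim conjE; assumption)+
  have ext: "x = y" if x: "x \<in> V" and y: "y \<in> V" and eq: "\<And>z. z \<in> V \<Longrightarrow> ip x z = ip y z" for x y
  proof -
    \<comment> \<open>Both 0 y and x + (-1) y have inner product zero with themselves, so
      definiteness makes them the zero vector; the laws of addition then give x = y.\<close>
    define m where "m = hs_smul H (-1) y"
    have m: "m \<in> V" using y by (simp add: m_def closed)
    have z0: "hs_smul H 0 y = hs_zero H"
      by (rule definite[rule_format]) (use y in \<open>simp_all add: closed inner_simps\<close>)
    have "hs_add H m y = hs_smul H (- 1 + 1) y"
      using distr[rule_format, OF y, of "-1" 1] one y by (simp add: m_def)
    hence my: "hs_add H m y = hs_zero H" using z0 by simp
    have xm: "hs_add H x m = hs_zero H"
      by (rule definite[rule_format]) (use x y m eq in \<open>simp_all add: m_def closed inner_simps\<close>)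
    have "x = hs_add H (hs_zero H) x" using zero x by simp
    also have "\<dots> = hs_add H x (hs_zero H)" using comm x zero_closed by blast
    also have "\<dots> = hs_add H (hs_add H x m) y" using assoc x y m my by simp
    also have "\<dots> = y" using xm zero y by simp
    finally show ?thesis .
  qed
  have lim: "\<exists>l\<in>V. (\<lambda>n. nrm (hs_diff H (s n) l)) \<longlonglongrightarrow> 0" if cs: "Cauchy_seq s" for s :: "nat \<Rightarrow> 'h"
  proof -
    from cs have s: "\<And>n. s n \<in> V" by (rule Cauchy_seqD)
    obtain l where l: "l \<in> V" "\<forall>e>0. \<exists>N. \<forall>n\<ge>N. nrm (hs_diff H (s n) l) < e"
      using compl[THEN spec, of s] cs unfolding Cauchy_seq_def by blast
    have "(\<lambda>n. nrm (hs_diff H (s n) l)) \<longlonglongrightarrow> 0"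
      unfolding LIMSEQ_iff using l s by (simp add: norm_nonneg closed)
    thus ?thesis using l(1) by blast
  qed
  show ?thesis by (intro hilbert.intro hilbert_axioms.intro pre_hilbert_axioms ext lim)
qed

context hilbert
begin

text \<open>The minimizing sequence of \<open>functional_Cauchy_seq\<close> now has a limit, and
  that limit represents F.\<close>

lemma riesz:
  assumes F: "antilinear F" and bd: "\<And>x. x \<in> V \<Longrightarrow> cmod (F x) \<le> a * nrm x"
  shows "\<exists>h\<in>V. \<forall>x\<in>V. ip h x = F x"
proof -
  obtain w where w: "Cauchy_seq w" "\<And>x. x \<in> V \<Longrightarrow> (\<lambda>n. ip (w n) x) \<longlonglongrightarrow> F x"
    by (rule functional_Cauchy_seq[OF F bd], assumption, rule that)
  obtain h where h: "h \<in> V" "(\<lambda>n. nrm (hs_diff E (w n) h)) \<longlonglongrightarrow> 0" using complete[OF w(1)] by blast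
  have "ip h x = F x" if x: "x \<in> V" for x
  proof -
    have lim: "(\<lambda>n. nrm (hs_diff E (w n) h) * nrm x) \<longlonglongrightarrow> 0" using tendsto_mult_right[OF h(2), of "nrm x"] by simp
    have "norm (ip (w n) x - ip h x) \<le> nrm (hs_diff E (w n) h) * nrm x" for n
      using cauchy_schwarz[OF diff_closed[OF Cauchy_seqD[OF w(1)] h(1)] x, of n] Cauchy_seqD[OF w(1)] h(1) x
      by (simp add: inner_simps)
    hence "(\<lambda>n. ip (w n) x - ip h x) \<longlonglongrightarrow> 0"
      by (intro Lim_null_comparison[OF _ lim]) simp
    hence "(\<lambda>n. ip (w n) x) \<longlonglongrightarrow> ip h x" by (simp add: LIM_zero_iff)
    thus ?thesis by (rule LIMSEQ_unique[OF _ w(2)[OF x]])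
  qed
  thus ?thesis using h(1) by blast
qed

end

section \<open>Uniform boundedness and semigroups\<close>

lemma bounded_opD:
  assumes "bounded_op H K f"
  shows "\<And>x. x \<in> hs_carrier H \<Longrightarrow> f x \<in> hs_carrier K"
    "\<And>x y. x \<in> hs_carrier H \<Longrightarrow> y \<in> hs_carrier H \<Longrightarrow> f (hs_add H x y) = hs_add K (f x) (f y)"
    "\<And>a x. x \<in> hs_carrier H \<Longrightarrow> f (hs_smul H a x) = hs_smul K a (f x)"
  using assms by (auto simp: bounded_op_def)

lemma bounded_op_diff:
  assumes "bounded_op H K f" "pre_hilbert H" "x \<in> hs_carrier H" "y \<in> hs_carrier H"
  shows "f (hs_diff H x y) = hs_diff K (f x) (f y)"
  using assms pre_hilbert.smul_closed[OF assms(2,4), of "-1"] by (simp add: hs_diff_def bounded_opD[OF assms(1)])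

lemma norm_zero_hs: "pre_hilbert H \<Longrightarrow> hs_norm H (hs_zero H) = 0"
  by (simp add: hs_norm_def pre_hilbert.inner_zero_left pre_hilbert.zero_closed)

lemma op_norm_bdd_above:
  assumes "pre_hilbert H" and f: "bounded_op H K f"
  shows "bdd_above {hs_norm K (f x) | x. x \<in> hs_carrier H \<and> hs_norm H x \<le> 1}"
proof -
  interpret pre_hilbert H by fact
  obtain C where C: "\<forall>x\<in>V. hs_norm K (f x) \<le> C * nrm x" using f by (auto simp: bounded_op_def)
  have "hs_norm K (f x) \<le> \<bar>C\<bar>" if x: "x \<in> V" "nrm x \<le> 1" for x
  proof -
    have "hs_norm K (f x) \<le> C * nrm x" using C x(1) by blast
    also have "\<dots> \<le> \<bar>C\<bar> * 1" using x norm_nonneg by (intro mult_mono) auto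
    finally show ?thesis by simp
  qed
  thus ?thesis by (intro bdd_aboveI[of _ "\<bar>C\<bar>"]) blast
qed

lemma op_norm_ge:
  assumes "pre_hilbert H" "bounded_op H K f" "x \<in> hs_carrier H" "hs_norm H x \<le> 1"
  shows "hs_norm K (f x) \<le> op_norm H K f"
  unfolding op_norm_def
  by (intro cSup_upper op_norm_bdd_above assms CollectI exI[of _ x] conjI refl)

lemma op_norm_nonneg:
  assumes "pre_hilbert H" "pre_hilbert K" "bounded_op H K f"
  shows "0 \<le> op_norm H K f"
proof -
  have "0 \<le> hs_norm K (f (hs_zero H))"
    by (intro pre_hilbert.norm_nonneg[OF assms(2)] bounded_opD[OF assms(3)] pre_hilbert.zero_closed assms)
  also have "\<dots> \<le> op_norm H K f"
    by (rule op_norm_ge) (simp_all add: assms norm_zero_hs pre_hilbert.zero_closed)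
  finally show ?thesis .
qed

lemma op_norm_bound:
  assumes H: "pre_hilbert H" and K: "pre_hilbert K" and f: "bounded_op H K f" and x: "x \<in> hs_carrier H"
  shows "hs_norm K (f x) \<le> op_norm H K f * hs_norm H x"
proof (cases "hs_norm H x = 0")
  case True
  obtain C where "\<forall>x\<in>hs_carrier H. hs_norm K (f x) \<le> C * hs_norm H x" using f by (auto simp: bounded_op_def)
  with True x show ?thesis by force
next
  case False
  define u where "u = hs_smul H (of_real (1 / hs_norm H x)) x"
  have pos: "hs_norm H x > 0" using False pre_hilbert.norm_nonneg[OF H x] by simp
  have u: "u \<in> hs_carrier H" "hs_norm H u = 1"
    using pos x by (simp_all add: u_def pre_hilbert.smul_closed[OF H] pre_hilbert.norm_smul[OF H] norm_divide)
  have "hs_norm K (f u) = hs_norm K (f x) / hs_norm H x"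
    using pos x bounded_opD[OF f] by (simp add: u_def pre_hilbert.norm_smul[OF K] norm_divide)
  moreover have "hs_norm K (f u) \<le> op_norm H K f" using op_norm_ge[OF H f u(1)] u(2) by simp
  ultimately show ?thesis using pos by (simp add: pos_divide_le_eq)
qed

lemma op_norm_least:
  assumes "pre_hilbert H" "\<And>x. x \<in> hs_carrier H \<Longrightarrow> hs_norm H x \<le> 1 \<Longrightarrow> hs_norm K (f x) \<le> c"
  shows "op_norm H K f \<le> c"
  unfolding op_norm_def
proof (rule cSup_least)
  have "hs_norm H (hs_zero H) \<le> 1" using norm_zero_hs[OF assms(1)] by simp
  with pre_hilbert.zero_closed[OF assms(1)]
  show "{hs_norm K (f x) | x. x \<in> hs_carrier H \<and> hs_norm H x \<le> 1} \<noteq> {}" by blast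
qed (use assms(2) in blast)

lemma op_norm_le:
  assumes "pre_hilbert H" "0 \<le> c" "\<And>x. x \<in> hs_carrier H \<Longrightarrow> hs_norm K (f x) \<le> c * hs_norm H x"
  shows "op_norm H K f \<le> c"
proof (rule op_norm_least[OF assms(1)])
  fix x assume x: "x \<in> hs_carrier H" "hs_norm H x \<le> 1"
  have "hs_norm K (f x) \<le> c * hs_norm H x" using assms(3) x by simp
  also have "\<dots> \<le> c * 1" using x assms(2) by (intro mult_left_mono)
  finally show "hs_norm K (f x) \<le> c" by simp
qed

text \<open>Let v have length at most r and be nearly norming. Since
  \<open>2 f v = f (x + v) - f (x - v)\<close>, one of \<open>x + v\<close> and \<open>x - v\<close>
  has an image at least as long as \<open>f v\<close>. The factor 2/3 leaves room for a supremum
  that is not attained.\<close>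

lemma op_norm_nearly_attained:
  assumes H: "pre_hilbert H" and K: "pre_hilbert K" and f: "bounded_op H K f" and pos: "0 < op_norm H K f"
    and x: "x \<in> hs_carrier H" and r: "0 < r"
  obtains y where "y \<in> hs_carrier H" "hs_norm H (hs_diff H y x) \<le> r"
    "2/3 * r * op_norm H K f \<le> hs_norm K (f y)"
proof -
  interpret H: pre_hilbert H by fact
  interpret K: pre_hilbert K by fact
  have "\<not> op_norm H K f \<le> 2/3 * op_norm H K f" using pos by simp
  then obtain u where u: "u \<in> H.V" "H.nrm u \<le> 1" "2/3 * op_norm H K f < K.nrm (f u)"
    using op_norm_least[OF H, of K f "2/3 * op_norm H K f"] not_le by blast
  define v where "v = hs_smul H (of_real r) u"
  have v: "v \<in> H.V" "H.nrm v \<le> r" and fv: "K.nrm (f v) = r * K.nrm (f u)"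
    using u r bounded_opD[OF f] by (simp_all add: v_def H.closed H.norm_smul K.norm_smul mult_left_le)
  let ?p = "hs_add H x v" and ?m = "hs_diff H x v"
  have pm: "?p \<in> H.V" "?m \<in> H.V" using x v by (simp_all add: H.closed)
  have "f ?p = hs_add K (f x) (f v)" "f ?m = hs_diff K (f x) (f v)"
    using bounded_opD[OF f] bounded_op_diff[OF f H] x v by auto
  moreover have "K.nrm (hs_diff K (hs_add K (f x) (f v)) (hs_diff K (f x) (f v))) = K.nrm (hs_smul K 2 (f v))"
    using bounded_opD(1)[OF f] x v by (simp add: hs_norm_def K.inner_simps K.closed)
  ultimately have "2 * K.nrm (f v) = K.nrm (hs_diff K (f ?p) (f ?m))"
    using bounded_opD(1)[OF f] v by (simp add: K.norm_smul)
  also have "\<dots> \<le> K.nrm (f ?p) + K.nrm (f ?m)"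
    by (intro K.norm_triangle_diff bounded_opD(1)[OF f] pm)
  finally have "r * K.nrm (f u) \<le> K.nrm (f ?p) \<or> r * K.nrm (f u) \<le> K.nrm (f ?m)" using fv by linarith
  moreover have "2/3 * r * op_norm H K f \<le> r * K.nrm (f u)"
    using mult_left_mono[OF less_imp_le[OF u(3)] less_imp_le[OF r]] by (simp add: mult_ac)
  moreover have "H.nrm (hs_diff H ?p x) = H.nrm v" "H.nrm (hs_diff H ?m x) = H.nrm v"
    using x v by (simp_all add: hs_norm_def H.inner_simps H.closed)
  ultimately show ?thesis using that[OF pm(1)] that[OF pm(2)] v(2) by fastforce
qed

text \<open>Gliding hump, after Sokal: the \<open>k\<close>-th step has length at most \<open>3\<^sup>-\<^sup>k\<close> and makes \<open>S k\<close> large,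
  and all later steps together are too short to undo this.\<close>

lemma uniform_boundedness:
  fixes T :: "nat \<Rightarrow> 'a \<Rightarrow> 'b"
  assumes "hilbert H" and K: "pre_hilbert K" and T: "\<And>n. bounded_op H K (T n)"
    and pw: "\<And>x. x \<in> hs_carrier H \<Longrightarrow> \<exists>b. \<forall>n. hs_norm K (T n x) \<le> b"
  shows "\<exists>b. \<forall>n. op_norm H K (T n) \<le> b"
proof (rule ccontr)
  assume "\<nexists>b. \<forall>n. op_norm H K (T n) \<le> b"
  \<comment> \<open>The rate 4 is chosen to beat the step lengths \<open>1 / 3^k\<close>: the
    product grows like \<open>(4/3)^k\<close>.\<close>
  hence "\<forall>k. \<exists>n. op_norm H K (T n) > 4 ^ k" by (meson not_le)
  from choice[OF this] obtain \<sigma> where \<sigma>: "\<And>k. op_norm H K (T (\<sigma> k)) > 4 ^ k" by blast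
  define S where "S k = T (\<sigma> k)" for k
  interpret H: hilbert H by fact
  interpret K: pre_hilbert K by fact
  have S: "bounded_op H K (S k)" for k by (simp add: S_def T)
  have S4: "op_norm H K (S k) > 4 ^ k" for k using \<sigma> by (simp add: S_def)
  have S0: "op_norm H K (S k) > 0" for k using S4[of k] by (meson less_trans zero_less_numeral zero_less_power)
  have "\<exists>x. x 0 = hs_zero H \<and> (\<forall>k. x k \<in> H.V \<and> x (Suc k) \<in> H.V \<and> H.nrm (hs_diff H (x (Suc k)) (x k)) \<le> 1 / 3 ^ k
      \<and> 2/3 * (1 / 3 ^ k) * op_norm H K (S k) \<le> K.nrm (S k (x (Suc k))))"
  proof -
    have "\<forall>k. \<forall>x\<in>H.V. \<exists>y\<in>H.V. H.nrm (hs_diff H y x) \<le> 1 / 3 ^ k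
      \<and> 2/3 * (1 / 3 ^ k) * op_norm H K (S k) \<le> K.nrm (S k y)"
    proof (intro allI ballI)
      fix k x assume "x \<in> H.V"
      then obtain y where "y \<in> H.V" "H.nrm (hs_diff H y x) \<le> 1 / 3 ^ k"
        "2/3 * (1 / 3 ^ k) * op_norm H K (S k) \<le> K.nrm (S k y)"
        by (rule op_norm_nearly_attained[OF H.pre_hilbert_axioms K S S0, where r = "1 / 3 ^ k"]) auto
      thus "\<exists>y\<in>H.V. H.nrm (hs_diff H y x) \<le> 1 / 3 ^ k
        \<and> 2/3 * (1 / 3 ^ k) * op_norm H K (S k) \<le> K.nrm (S k y)" by blast
    qed
    hence "\<forall>k. \<exists>y. \<forall>x\<in>H.V. y x \<in> H.V \<and> H.nrm (hs_diff H (y x) x) \<le> 1 / 3 ^ k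
        \<and> 2/3 * (1 / 3 ^ k) * op_norm H K (S k) \<le> K.nrm (S k (y x))"
      by (intro allI bchoice) blast
    from choice[OF this] obtain Y where Y: "\<forall>k. \<forall>x\<in>H.V. Y k x \<in> H.V \<and> H.nrm (hs_diff H (Y k x) x) \<le> 1 / 3 ^ k
        \<and> 2/3 * (1 / 3 ^ k) * op_norm H K (S k) \<le> K.nrm (S k (Y k x))"
      by blast
    define x where "x = rec_nat (hs_zero H) Y"
    have x: "x 0 = hs_zero H" "\<And>k. x (Suc k) = Y k (x k)" by (simp_all add: x_def)
    have "x k \<in> H.V" for k by (induction k) (simp_all add: x H.zero_closed Y)
    thus ?thesis using x Y by (intro exI[of _ x]) simp
  qed
  then obtain x where x': "\<forall>k. x k \<in> H.V \<and> x (Suc k) \<in> H.V \<and> H.nrm (hs_diff H (x (Suc k)) (x k)) \<le> 1 / 3 ^ k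
      \<and> 2/3 * (1 / 3 ^ k) * op_norm H K (S k) \<le> K.nrm (S k (x (Suc k)))" by blast
  have x: "\<And>k. x k \<in> H.V" "\<And>k. H.nrm (hs_diff H (x (Suc k)) (x k)) \<le> 1 / 3 ^ k"
    "\<And>k. 2/3 * (1 / 3 ^ k) * op_norm H K (S k) \<le> K.nrm (S k (x (Suc k)))"
    using x' by simp_all
  \<comment> \<open>The geometric sum of the lengths of the steps k, ..., k + j - 1.\<close>
  have geo: "H.nrm (hs_diff H (x (k + j)) (x k)) \<le> 3/2 * (1 / 3 ^ k) * (1 - 1 / 3 ^ j)" for k j
  proof (induction j)
    case 0
    have "H.nrm (hs_diff H (x k) (x k)) = 0" using x(1) by (simp add: hs_norm_def H.inner_simps H.closed)
    then show ?case by simp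
  next
    case (Suc j)
    have "H.nrm (hs_diff H (x (k + Suc j)) (x k))
        \<le> H.nrm (hs_diff H (x (Suc (k + j))) (x (k + j))) + H.nrm (hs_diff H (x (k + j)) (x k))"
      using H.dist_triangle_hs x(1) by simp
    also have "\<dots> \<le> 1 / 3 ^ (k + j) + 3/2 * (1 / 3 ^ k) * (1 - 1 / 3 ^ j)"
      by (intro add_mono x(2) Suc.IH)
    also have "\<dots> = 3/2 * (1 / 3 ^ k) * (1 - 1 / 3 ^ Suc j)"
      by (simp add: power_add field_simps)
    finally show ?case .
  qed
  have geo': "H.nrm (hs_diff H (x m) (x k)) \<le> 3/2 * (1 / 3 ^ k)" if km: "k \<le> m" for k m
  proof -
    obtain j where j: "m = k + j" using le_Suc_ex[OF km] by blast
    have "3/2 * (1 / 3 ^ k) * (1 - 1 / 3 ^ j) \<le> 3/2 * (1 / 3 ^ k) * (1::real)"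
      by (intro mult_left_mono) auto
    thus ?thesis using geo[of k j] unfolding j by linarith
  qed
  have lim3: "(\<lambda>k. 3/2 * (1 / 3 ^ k) :: real) \<longlonglongrightarrow> 0"
    using tendsto_mult_left[OF LIMSEQ_realpow_zero[of "1/3"], of "3/2"] by (simp add: power_one_over)
  have cau: "H.Cauchy_seq x"
    unfolding H.Cauchy_seq_def
  proof (intro conjI allI impI x(1))
    fix e :: real assume "e > 0"
    then obtain N where N: "3/2 * (1 / 3 ^ N) < e / 2"
      using LIMSEQ_D[OF lim3, of "e/2"] by (auto simp: abs_less_iff)
    show "\<exists>N. \<forall>m\<ge>N. \<forall>n\<ge>N. H.nrm (hs_diff H (x m) (x n)) < e"
    proof (intro exI allI impI)
      fix m n assume "N \<le> m" "N \<le> n"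
      have "H.nrm (hs_diff H (x m) (x n)) \<le> H.nrm (hs_diff H (x m) (x N)) + H.nrm (hs_diff H (x N) (x n))"
        by (intro H.dist_triangle_hs x)
      also have "H.nrm (hs_diff H (x N) (x n)) = H.nrm (hs_diff H (x n) (x N))"
        by (intro H.norm_diff_commute x)
      finally show "H.nrm (hs_diff H (x m) (x n)) < e"
        using geo'[OF \<open>N \<le> m\<close>] geo'[OF \<open>N \<le> n\<close>] N by linarith
    qed
  qed
  then obtain l where l: "l \<in> H.V" "(\<lambda>n. H.nrm (hs_diff H (x n) l)) \<longlonglongrightarrow> 0" using H.complete by blast
  \<comment> \<open>What remains from index k + 1 on: 3/2 of \<open>1 / 3^(k+1)\<close> is 1/2 of
    \<open>1 / 3^k\<close>.\<close>
  have close: "H.nrm (hs_diff H (x (Suc k)) l) \<le> 1/2 * (1 / 3 ^ k)" for k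
  proof (rule tendsto_lowerbound)
    show "(\<lambda>n. 1/2 * (1 / 3 ^ k) + H.nrm (hs_diff H (x n) l)) \<longlonglongrightarrow> 1/2 * (1 / 3 ^ k)"
      using tendsto_add[OF tendsto_const l(2)] by simp
    have "H.nrm (hs_diff H (x (Suc k)) l) \<le> 1/2 * (1 / 3 ^ k) + H.nrm (hs_diff H (x n) l)" if "Suc k \<le> n" for n
      using H.dist_triangle_hs[OF x(1) x(1) l(1), of "Suc k" n] H.norm_diff_commute[OF x(1) x(1), of "Suc k" n]
        geo'[OF that] by simp
    thus "\<forall>\<^sub>F n in sequentially. H.nrm (hs_diff H (x (Suc k)) l) \<le> 1/2 * (1 / 3 ^ k) + H.nrm (hs_diff H (x n) l)"
      unfolding eventually_sequentially by blast
  qed simp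
  \<comment> \<open>The gain 2/3 minus the possible loss 1/2 leaves 1/6 of
    \<open>op_norm H K (S k) / 3^k\<close>, where the norm exceeds \<open>4^k\<close>.\<close>
  have grow: "1/6 * (4/3) ^ k \<le> K.nrm (S k l)" for k
  proof -
    have "K.nrm (S k (x (Suc k))) \<le> K.nrm (S k l) + K.nrm (S k (hs_diff H (x (Suc k)) l))"
      using K.norm_le_norm_diff bounded_opD(1)[OF S] x(1) l(1) by (simp add: bounded_op_diff[OF S H.pre_hilbert_axioms])
    also have "K.nrm (S k (hs_diff H (x (Suc k)) l)) \<le> op_norm H K (S k) * H.nrm (hs_diff H (x (Suc k)) l)"
      by (intro op_norm_bound H.pre_hilbert_axioms K S H.closed x l)
    also have "\<dots> \<le> op_norm H K (S k) * (1/2 * (1 / 3 ^ k))"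
      using close S0[of k] by (intro mult_left_mono) auto
    finally have "1/6 * (1 / 3 ^ k) * op_norm H K (S k) \<le> K.nrm (S k l)"
      using x(3)[of k] by (simp add: field_simps)
    moreover have "1/6 * (1 / 3 ^ k) * 4 ^ k \<le> 1/6 * (1 / 3 ^ k) * op_norm H K (S k)"
      using S4[of k] by (intro mult_left_mono) auto
    ultimately show ?thesis by (simp add: power_divide)
  qed
  obtain b where b: "\<And>n. K.nrm (T n l) \<le> b" using pw[OF l(1)] by blast
  obtain k where "(4/3) ^ k > 6 * b" using real_arch_pow[of "4/3" "6 * b"] by auto
  with grow[of k] b[of "\<sigma> k"] show False by (simp add: S_def)
qed

section \<open>Local boundedness and strong continuity of a semigroup\<close>

locale c0_semi = hilbert H for H :: "'h hspace" +
  fixes T :: "real \<Rightarrow> 'h \<Rightarrow> 'h"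
  assumes c0: "c0_semigroup H T"
begin

lemma T_bounded_op: "0 \<le> t \<Longrightarrow> bounded_op H H (T t)"
  using c0 by (simp add: c0_semigroup_def)

lemmas T_closed = bounded_opD(1)[OF T_bounded_op]
lemmas T_add = bounded_opD(2)[OF T_bounded_op]
lemmas T_smul = bounded_opD(3)[OF T_bounded_op]
lemmas T_diff = bounded_op_diff[OF T_bounded_op pre_hilbert_axioms]

lemma T_zero: "x \<in> V \<Longrightarrow> T 0 x = x"
  using c0 unfolding c0_semigroup_def by blast

lemma T_plus: "0 \<le> s \<Longrightarrow> 0 \<le> t \<Longrightarrow> x \<in> V \<Longrightarrow> T (s + t) x = T s (T t x)"
  using c0 unfolding c0_semigroup_def by blast

lemma T_right_continuous:
  assumes x: "x \<in> V" and e: "0 < e"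
  obtains d where "0 < d" "\<And>t. 0 \<le> t \<Longrightarrow> t < d \<Longrightarrow> nrm (hs_diff H (T t x) x) < e"
proof -
  have "\<forall>x\<in>V. \<forall>e>0. \<exists>d>0. \<forall>t. 0 < t \<and> t < d \<longrightarrow> nrm (hs_diff H (T t x) x) < e"
    using c0 unfolding c0_semigroup_def by (elim conjE)
  from this[rule_format, OF x e] obtain d
    where d: "d > 0" "\<And>t. 0 < t \<Longrightarrow> t < d \<Longrightarrow> nrm (hs_diff H (T t x) x) < e" by blast
  have "nrm (hs_diff H (T 0 x) x) < e"
    using x e by (simp add: T_zero hs_norm_def inner_simps closed)
  hence "nrm (hs_diff H (T t x) x) < e" if "0 \<le> t" "t < d" for t
    using d(2)[of t] that by (cases "t = 0") simp_all
  thus ?thesis using that[OF d(1)] by blast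
qed

lemma T_bound: "0 \<le> t \<Longrightarrow> x \<in> V \<Longrightarrow> nrm (T t x) \<le> op_norm H H (T t) * nrm x"
  by (intro op_norm_bound pre_hilbert_axioms T_bounded_op)

lemma T_op_norm_nonneg: "0 \<le> t \<Longrightarrow> 0 \<le> op_norm H H (T t)"
  by (intro op_norm_nonneg pre_hilbert_axioms T_bounded_op)

text \<open>Otherwise some times t n tending to 0 give unbounded norms. Strong continuity at 0
  bounds every sequence \<open>T (t n) x\<close>, finitely many terms by their maximum and the rest
  by \<open>nrm x + 1\<close>, which contradicts uniform boundedness.\<close>

lemma T_bounded_near_zero: "\<exists>d>0. \<exists>b. \<forall>t\<in>{0..d}. op_norm H H (T t) \<le> b"
proof (rule ccontr)
  assume neg: "\<not> ?thesis"
  have "\<exists>t\<in>{0..inverse (real (Suc n))}. op_norm H H (T t) > real n" for n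
    using neg by (metis inverse_positive_iff_positive not_le of_nat_0_less_iff zero_less_Suc)
  then obtain t where t: "\<And>n. 0 \<le> t n" "\<And>n. t n \<le> inverse (real (Suc n))" "\<And>n. op_norm H H (T (t n)) > real n"
    by (metis atLeastAtMost_iff)
  have "\<exists>b. \<forall>n. op_norm H H (T (t n)) \<le> b"
  proof (rule uniform_boundedness[OF hilbert_axioms pre_hilbert_axioms])
    show "bounded_op H H (T (t n))" for n by (intro T_bounded_op t)
    fix x assume x: "x \<in> V"
    obtain d where d: "d > 0" "\<And>t. 0 \<le> t \<Longrightarrow> t < d \<Longrightarrow> nrm (hs_diff H (T t x) x) < 1"
      by (rule T_right_continuous[OF x zero_less_one], rule that)
    obtain N where N: "inverse (real (Suc N)) < d" using reals_Archimedean[OF d(1)] by blast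
    define b where "b = Max ((\<lambda>n. nrm (T (t n) x)) ` {..N}) + (nrm x + 1)"
    have "nrm (T (t n) x) \<le> b" for n
    proof (cases "n \<le> N")
      case True
      have "nrm (T (t n) x) \<le> Max ((\<lambda>n. nrm (T (t n) x)) ` {..N})" using True by simp
      thus ?thesis using norm_nonneg[OF x] by (simp add: b_def)
    next
      case False
      have "0 \<le> nrm (T (t 0) x)" by (intro norm_nonneg T_closed t x)
      also have "\<dots> \<le> Max ((\<lambda>n. nrm (T (t n) x)) ` {..N})" by simp
      finally have M: "0 \<le> Max ((\<lambda>n. nrm (T (t n) x)) ` {..N})" .
      have "inverse (real (Suc n)) \<le> inverse (real (Suc N))" using False by (simp add: field_simps)
      hence "t n < d" using t(2)[of n] N by linarith
      hence "nrm (hs_diff H (T (t n) x) x) < 1" by (intro d t)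
      moreover have "nrm (T (t n) x) \<le> nrm x + nrm (hs_diff H (T (t n) x) x)"
        by (intro norm_le_norm_diff T_closed t x)
      ultimately show ?thesis using M by (simp add: b_def)
    qed
    thus "\<exists>b. \<forall>n. nrm (T (t n) x) \<le> b" by blast
  qed
  then obtain b where b: "\<And>n. op_norm H H (T (t n)) \<le> b" by blast
  obtain n :: nat where "b < real n" using reals_Archimedean2 by blast
  with b[of n] t(3)[of n] show False by linarith
qed

text \<open>The bound near 0 is carried along steps of length d by the semigroup law. It makes the
  supremum M a genuine bound, since \<open>Sup\<close> of an unbounded set of reals says
  nothing.\<close>

lemma T_locally_bounded: "bdd_above ((\<lambda>t. op_norm H H (T t)) ` {0..c})"
proof -
  obtain d b where d: "d > 0" and b: "\<And>t. 0 \<le> t \<Longrightarrow> t \<le> d \<Longrightarrow> op_norm H H (T t) \<le> b"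
    using T_bounded_near_zero by force
  have b0: "0 \<le> b" using b[of 0] T_op_norm_nonneg[of 0] d by simp
  have step: "\<exists>B\<ge>0. \<forall>t. 0 \<le> t \<and> t \<le> real n * d \<longrightarrow> op_norm H H (T t) \<le> B" for n
  proof (induction n)
    case 0
    have "op_norm H H (T t) \<le> b" if "0 \<le> t" "t \<le> real 0 * d" for t using that d by (intro b) auto
    then show ?case using b0 by blast
  next
    case (Suc n)
    then obtain B where B: "0 \<le> B" "\<And>t. 0 \<le> t \<Longrightarrow> t \<le> real n * d \<Longrightarrow> op_norm H H (T t) \<le> B" by blast
    \<comment> \<open>The sum dominates both b, for t up to d, and \<open>b * B\<close>, for later
      t.\<close>
    have "op_norm H H (T t) \<le> b + b * B" if t: "0 \<le> t" "t \<le> real (Suc n) * d" for t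
    proof (cases "t \<le> d")
      case True
      thus ?thesis using b[OF t(1)] b0 B(1) by (meson add_increasing2 mult_nonneg_nonneg)
    next
      case False
      have s: "0 \<le> t - d" "t - d \<le> real n * d" using False t by (auto simp: algebra_simps)
      have "op_norm H H (T t) \<le> b * B"
      proof (rule op_norm_le[OF pre_hilbert_axioms])
        show "0 \<le> b * B" using b0 B(1) by simp
        fix x assume x: "x \<in> V"
        have "T t x = T d (T (t - d) x)" using T_plus[of d "t - d" x] d s x by simp
        hence "nrm (T t x) \<le> op_norm H H (T d) * nrm (T (t - d) x)"
          using d s x by (simp add: T_bound T_closed)
        also have "\<dots> \<le> b * (B * nrm x)"
        proof (rule mult_mono)
          show "op_norm H H (T d) \<le> b" using b[of d] d by simp
          have "nrm (T (t - d) x) \<le> op_norm H H (T (t - d)) * nrm x" by (intro T_bound s x)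
          also have "\<dots> \<le> B * nrm x" by (intro mult_right_mono B s norm_nonneg x)
          finally show "nrm (T (t - d) x) \<le> B * nrm x" .
          show "0 \<le> nrm (T (t - d) x)" by (intro norm_nonneg T_closed s x)
        qed (rule b0)
        finally show "nrm (T t x) \<le> b * B * nrm x" by (simp add: mult.assoc)
      qed
      thus ?thesis using b0 by linarith
    qed
    moreover have "0 \<le> b + b * B" using b0 B(1) by simp
    ultimately show ?case by blast
  qed
  obtain n :: nat where "c < real n * d" using ex_less_of_nat_mult[OF d] by blast
  moreover obtain B where "\<forall>t. 0 \<le> t \<and> t \<le> real n * d \<longrightarrow> op_norm H H (T t) \<le> B" using step[of n] by blast
  ultimately show ?thesis by (intro bdd_aboveI2[of _ _ B]) simp
qed

definition M :: "real \<Rightarrow> real" where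
  "M c = (SUP t\<in>{0..c}. op_norm H H (T t))"

lemma op_norm_le_M: "0 \<le> t \<Longrightarrow> t \<le> c \<Longrightarrow> op_norm H H (T t) \<le> M c"
  unfolding M_def by (intro cSUP_upper T_locally_bounded) auto

lemma T_norm_le: "0 \<le> t \<Longrightarrow> t \<le> c \<Longrightarrow> x \<in> V \<Longrightarrow> nrm (T t x) \<le> M c * nrm x"
  using T_bound[of t x] mult_right_mono[OF op_norm_le_M[of t c] norm_nonneg[of x]] by linarith

lemma M_nonneg: "0 \<le> c \<Longrightarrow> 0 \<le> M c"
  using op_norm_le_M[of 0 c] T_op_norm_nonneg[of 0] by linarith

text \<open>Factoring out T at the smaller time reduces differences to right continuity at 0,
  uniformly for s up to c. Continuity from the left follows from the same estimate.\<close>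

lemma T_dist_le:
  assumes "0 \<le> s" "s \<le> t" "s \<le> c" "x \<in> V"
  shows "nrm (hs_diff H (T t x) (T s x)) \<le> M c * nrm (hs_diff H (T (t - s) x) x)"
proof -
  have "T t x = T s (T (t - s) x)" using T_plus[of s "t - s" x] assms by simp
  hence "nrm (hs_diff H (T t x) (T s x)) = nrm (T s (hs_diff H (T (t - s) x) x))"
    using assms by (simp add: T_diff T_closed)
  also have "\<dots> \<le> M c * nrm (hs_diff H (T (t - s) x) x)"
    using assms by (intro T_norm_le closed T_closed) auto
  finally show ?thesis .
qed

lemma T_dist:
  assumes "0 \<le> s" "s \<le> c" "0 \<le> t" "t \<le> c" "x \<in> V"
  shows "nrm (hs_diff H (T s x) (T t x)) \<le> M c * nrm (hs_diff H (T \<bar>s - t\<bar> x) x)"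
proof (cases "s \<le> t")
  case True
  have "nrm (hs_diff H (T s x) (T t x)) = nrm (hs_diff H (T t x) (T s x))"
    using assms by (intro norm_diff_commute T_closed)
  thus ?thesis using T_dist_le[of s t c x] assms True by simp
next
  case False
  thus ?thesis using T_dist_le[of t s c x] assms by simp
qed

lemma T_uniformly_continuous:
  assumes c: "0 \<le> c" and x: "x \<in> V" and e: "0 < e"
  obtains d where "0 < d"
    "\<And>s t. 0 \<le> s \<Longrightarrow> s \<le> c \<Longrightarrow> 0 \<le> t \<Longrightarrow> t \<le> c \<Longrightarrow> \<bar>s - t\<bar> < d \<Longrightarrow> nrm (hs_diff H (T s x) (T t x)) < e"
proof -
  \<comment> \<open>The 1 is added because M c may be 0.\<close>
  have p: "0 < M c + 1" using M_nonneg[OF c] by simp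
  obtain d where d: "0 < d" "\<And>t. 0 \<le> t \<Longrightarrow> t < d \<Longrightarrow> nrm (hs_diff H (T t x) x) < e / (M c + 1)"
    by (rule T_right_continuous[OF x divide_pos_pos[OF e p]], rule that)
  have "nrm (hs_diff H (T s x) (T t x)) < e"
    if st: "0 \<le> s" "s \<le> c" "0 \<le> t" "t \<le> c" "\<bar>s - t\<bar> < d" for s t
  proof -
    let ?n = "nrm (hs_diff H (T \<bar>s - t\<bar> x) x)"
    have "nrm (hs_diff H (T s x) (T t x)) \<le> M c * ?n" by (intro T_dist st x)
    also have "\<dots> \<le> (M c + 1) * ?n" by (intro mult_right_mono norm_nonneg closed T_closed x) auto
    also have "\<dots> < (M c + 1) * (e / (M c + 1))" using p by (intro mult_strict_left_mono d st) auto
    finally show ?thesis using p by simp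
  qed
  thus ?thesis using that[OF d(1)] by blast
qed

end

section \<open>Renorming\<close>

text \<open>Tychonoff's theorem. Over an uncountable index set a convergent subsequence may fail to
  exist, so the cluster point L is approached along a filter finer than
  \<open>sequentially\<close>.\<close>

lemma compact_cluster_filter:
  fixes q :: "nat \<Rightarrow> 'i \<Rightarrow> 'b::topological_space"
  assumes K: "\<And>i. compact (K i)" and q: "\<And>n i. q n i \<in> K i"
  obtains L G where "G \<noteq> bot" "G \<le> sequentially" "\<And>i. ((\<lambda>n. q n i) \<longlongrightarrow> L i) G"
proof -
  have "compact (PiE UNIV K)"
    using compactin_PiE[of "\<lambda>_. euclidean" UNIV K] K by (simp add: euclidean_product_topology)
  moreover have "eventually (\<lambda>f. f \<in> PiE UNIV K) (filtermap q sequentially)"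
    using q by (simp add: eventually_filtermap PiE_iff)
  moreover have "filtermap q sequentially \<noteq> bot" by (simp add: filtermap_bot_iff)
  ultimately obtain L where L: "inf (nhds L) (filtermap q sequentially) \<noteq> bot"
    unfolding compact_filter by blast
  \<comment> \<open>Generated by the preimages of neighbourhoods of L and the tails of the naturals;
    that L is a cluster point means that these sets meet.\<close>
  define G where "G = inf (filtercomap q (nhds L)) sequentially"
  have "G \<noteq> bot"
  proof
    assume "G = bot"
    hence "eventually (\<lambda>_. False) G" by simp
    then obtain P Q where PQ: "eventually P (filtercomap q (nhds L))" "eventually Q sequentially"
      "\<And>n. P n \<Longrightarrow> Q n \<Longrightarrow> False"
      unfolding G_def eventually_inf by blast
    then obtain A where A: "eventually A (nhds L)" "\<And>n. A (q n) \<Longrightarrow> P n"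
      unfolding eventually_filtercomap by blast
    have "eventually (\<lambda>f. \<exists>n. Q n \<and> f = q n) (filtermap q sequentially)"
      unfolding eventually_filtermap using PQ(2) by (rule eventually_mono) blast
    with A(1) have "eventually (\<lambda>_. False) (inf (nhds L) (filtermap q sequentially))"
      unfolding eventually_inf using A(2) PQ(3) by blast
    with L show False by (simp add: trivial_limit_def)
  qed
  moreover have "G \<le> sequentially" by (simp add: G_def)
  moreover have "((\<lambda>n. q n i) \<longlongrightarrow> L i) G" for i
  proof -
    have qL: "(q \<longlongrightarrow> L) G"
      unfolding G_def by (rule filterlim_mono[OF filterlim_filtercomap order_refl]) simp
    show ?thesis
    proof (rule topological_tendstoI)
      fix S assume S: "open S" "L i \<in> S"
      have "open ((\<lambda>f :: 'i \<Rightarrow> 'b. f i) -` S)"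
        using open_vimage[OF S(1) continuous_on_product_coordinates] .
      from topological_tendstoD[OF qL this] S(2) show "eventually (\<lambda>n. q n i \<in> S) G" by simp
    qed
  qed
  ultimately show ?thesis by (rule that)
qed

lemma bounded_op_compose:
  assumes H: "pre_hilbert H" and K: "pre_hilbert K" and L: "pre_hilbert L"
    and f: "bounded_op H K f" and g: "bounded_op K L g"
  shows "bounded_op H L (\<lambda>x. g (f x))"
proof -
  have "hs_norm L (g (f x)) \<le> (op_norm K L g * op_norm H K f) * hs_norm H x" if x: "x \<in> hs_carrier H" for x
  proof -
    have "hs_norm L (g (f x)) \<le> op_norm K L g * hs_norm K (f x)"
      by (intro op_norm_bound K L g bounded_opD(1)[OF f] x)
    also have "\<dots> \<le> op_norm K L g * (op_norm H K f * hs_norm H x)"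
      by (intro mult_left_mono op_norm_bound H K f x op_norm_nonneg L g)
    finally show ?thesis by (simp add: mult.assoc)
  qed
  thus ?thesis
    unfolding bounded_op_def using bounded_opD[OF f] bounded_opD[OF g]
    by (intro conjI ballI allI exI[of _ "op_norm K L g * op_norm H K f"]) simp_all
qed

lemma hs_inner_update_simps:
  "hs_carrier (H\<lparr>hs_inner := p\<rparr>) = hs_carrier H" "hs_zero (H\<lparr>hs_inner := p\<rparr>) = hs_zero H"
  "hs_add (H\<lparr>hs_inner := p\<rparr>) = hs_add H" "hs_smul (H\<lparr>hs_inner := p\<rparr>) = hs_smul H"
  "hs_inner (H\<lparr>hs_inner := p\<rparr>) = p"
  by simp_all

lemma pre_hilbert_scaled_pullback:
  assumes H: "pre_hilbert H" and R: "bounded_op H H R" and a: "0 \<le> a"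
  shows "pre_hilbert (H\<lparr>hs_inner := \<lambda>x y. of_real a * hs_inner H (R x) (R y)\<rparr>)"
proof -
  interpret pre_hilbert H by fact
  have z: "R (hs_zero H) \<in> V" by (intro bounded_opD(1)[OF R] zero_closed)
  have Rz: "ip (R (hs_zero H)) y = 0" if y: "y \<in> V" for y
  proof -
    have "nrm (R (hs_zero H)) \<le> op_norm H H R * nrm (hs_zero H)"
      by (intro op_norm_bound pre_hilbert_axioms R zero_closed)
    hence "nrm (R (hs_zero H)) = 0" using norm_nonneg[OF z] norm_zero_hs[OF H] by simp
    thus ?thesis using cauchy_schwarz[OF z y] by simp
  qed
  show ?thesis
  proof (rule pre_hilbert.intro; unfold hs_inner_update_simps)
    fix x y assume x: "x \<in> V" and y: "y \<in> V"
    show "of_real a * ip (R x) (R y) = cnj (of_real a * ip (R y) (R x))"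
      using inner_commute[OF bounded_opD(1)[OF R x] bounded_opD(1)[OF R y]] by simp
  qed (use a in \<open>simp_all add: closed bounded_opD[OF R] inner_add_left inner_smul_left algebra_simps Rz inner_nonneg\<close>)
qed

text \<open>The infimum defining \<open>sim_const\<close> is attained in the sense of renormings: the inner products
  \<open>c * \<langle>R x, R y\<rangle>\<close> of a minimizing sequence lie in a compact product of discs, and every condition
  imposed on them is closed and involves finitely many coordinates.\<close>

lemma contractive_renorming:
  fixes H :: "'h hspace" and S :: "'h \<Rightarrow> 'h"
  assumes H: "pre_hilbert H" and S: "bounded_op H H S" and sim: "similar_to_contraction H S"
  obtains p C where "pre_hilbert (H\<lparr>hs_inner := p\<rparr>)" "0 \<le> C" "sim_const H S = ereal C"
    "\<And>x. x \<in> hs_carrier H \<Longrightarrow> (hs_norm H x)\<^sup>2 \<le> Re (p x x)"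
    "\<And>x. x \<in> hs_carrier H \<Longrightarrow> Re (p x x) \<le> C\<^sup>2 * (hs_norm H x)\<^sup>2"
    "\<And>x. x \<in> hs_carrier H \<Longrightarrow> Re (p (S x) (S x)) \<le> Re (p x x)"
proof -
  interpret pre_hilbert H by fact
  define D where "D = {ereal (op_norm H H R * op_norm H H Ri) | R Ri.
       inverse_ops H R Ri \<and> op_norm H H (\<lambda>x. R (S (Ri x))) \<le> 1}"
  have simD: "sim_const H S = Inf D" by (simp add: sim_const_def D_def)
  have inv: "bounded_op H H R" "bounded_op H H Ri" if "inverse_ops H R Ri" for R Ri
    using that by (simp_all add: inverse_ops_def)
  have "0 \<le> Inf D"
    by (rule Inf_greatest) (auto simp: D_def intro!: mult_nonneg_nonneg op_norm_nonneg H dest: inv)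
  moreover obtain d where "ereal d \<in> D" using sim by (auto simp: similar_to_contraction_def D_def)
  hence "Inf D \<le> ereal d" by (rule Inf_lower)
  ultimately obtain C where C: "Inf D = ereal C" "0 \<le> C"
    by (cases "Inf D") auto
  have "\<exists>R Ri. inverse_ops H R Ri \<and> op_norm H H (\<lambda>x. R (S (Ri x))) \<le> 1 \<and>
      op_norm H H R * op_norm H H Ri < C + 1 / real (Suc n)" for n
  proof -
    have "Inf D < ereal (C + 1 / real (Suc n))" by (simp add: C)
    then obtain R Ri where "inverse_ops H R Ri" "op_norm H H (\<lambda>x. R (S (Ri x))) \<le> 1"
      "ereal (op_norm H H R * op_norm H H Ri) < ereal (C + 1 / real (Suc n))"
      unfolding Inf_less_iff D_def by blast
    thus ?thesis unfolding less_ereal.simps by blast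
  qed
  hence "\<forall>n. \<exists>RR. inverse_ops H (fst RR) (snd RR) \<and> op_norm H H (\<lambda>x. fst RR (S (snd RR x))) \<le> 1 \<and>
      op_norm H H (fst RR) * op_norm H H (snd RR) < C + 1 / real (Suc n)" by simp
  from choice[OF this] obtain RR where RR: "\<And>n. inverse_ops H (fst (RR n)) (snd (RR n))"
     "\<And>n. op_norm H H (\<lambda>x. fst (RR n) (S (snd (RR n) x))) \<le> 1"
     "\<And>n. op_norm H H (fst (RR n)) * op_norm H H (snd (RR n)) < C + 1 / real (Suc n)"
    by blast
  define R where "R n = fst (RR n)" for n
  define Q where "Q n = snd (RR n)" for n
  define c where "c n = C + 1 / real (Suc n)" for n
  have RQ: "inverse_ops H (R n) (Q n)" and con: "op_norm H H (\<lambda>x. R n (S (Q n x))) \<le> 1"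
    and cn: "op_norm H H (R n) * op_norm H H (Q n) \<le> c n" for n
    using RR[of n] by (simp_all add: R_def Q_def c_def)
  note R = inv(1)[OF RQ] and Q = inv(2)[OF RQ]
  have QR: "Q n (R n x) = x" if "x \<in> V" for n x using RQ[of n] that by (simp add: inverse_ops_def)
  \<comment> \<open>The scaling normalizes the lower bound: x = Q n (R n x) gives
    \<open>nrm x\<close> at most \<open>op_norm H H (Q n) * nrm (R n x)\<close>. The upper bound
    becomes the product of both operator norms, which is at most \<open>c n\<close>.\<close>
  define P where "P n = H\<lparr>hs_inner := \<lambda>x y. of_real ((op_norm H H (Q n))\<^sup>2) * ip (R n x) (R n y)\<rparr>" for n
  define pn where "pn n = hs_inner (P n)" for n
  have P: "pre_hilbert (P n)" for n
    unfolding P_def by (rule pre_hilbert_scaled_pullback[OF H R]) simp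
  have [simp]: "hs_carrier (P n) = V" "hs_add (P n) = hs_add H" "hs_smul (P n) = hs_smul H"
    "hs_zero (P n) = hs_zero H" for n
    by (simp_all add: P_def)
  have Re_pn: "Re (pn n x x) = (op_norm H H (Q n) * nrm (R n x))\<^sup>2" if "x \<in> V" for n x
    using norm_sq[OF bounded_opD(1)[OF R that]] by (simp add: pn_def P_def power_mult_distrib)
  have lo: "(nrm x)\<^sup>2 \<le> Re (pn n x x)" if x: "x \<in> V" for n x
  proof -
    have "nrm (Q n (R n x)) \<le> op_norm H H (Q n) * nrm (R n x)"
      by (intro op_norm_bound H Q bounded_opD(1)[OF R] x)
    thus ?thesis using x by (simp add: Re_pn QR power_mono norm_nonneg)
  qed
  have Qn: "0 \<le> op_norm H H (Q n)" and Rn: "0 \<le> op_norm H H (R n)" for n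
    by (intro op_norm_nonneg H Q R)+
  have hi: "Re (pn n x x) \<le> (c n)\<^sup>2 * (nrm x)\<^sup>2" if x: "x \<in> V" for n x
  proof -
    have "op_norm H H (Q n) * nrm (R n x) \<le> op_norm H H (Q n) * (op_norm H H (R n) * nrm x)"
      by (intro mult_left_mono op_norm_bound H R x Qn)
    also have "\<dots> = (op_norm H H (R n) * op_norm H H (Q n)) * nrm x" by simp
    also have "\<dots> \<le> c n * nrm x" by (intro mult_right_mono cn norm_nonneg x)
    finally show ?thesis using x bounded_opD(1)[OF R x]
      by (simp add: Re_pn power_mult_distrib[symmetric] power_mono norm_nonneg Qn)
  qed
  have contr: "Re (pn n (S x) (S x)) \<le> Re (pn n x x)" if x: "x \<in> V" for n x
  proof -
    have Rx: "R n x \<in> V" by (rule bounded_opD(1)[OF R x])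
    have b: "bounded_op H H (\<lambda>x. R n (S (Q n x)))"
      by (intro bounded_op_compose[OF H H H _ R] bounded_op_compose[OF H H H Q S])
    have "nrm (R n (S (Q n (R n x)))) \<le> op_norm H H (\<lambda>x. R n (S (Q n x))) * nrm (R n x)"
      by (rule op_norm_bound[OF H H b Rx])
    also have "\<dots> \<le> 1 * nrm (R n x)" by (intro mult_right_mono con norm_nonneg Rx)
    finally have "nrm (R n (S x)) \<le> nrm (R n x)" by (simp add: QR x)
    thus ?thesis using x bounded_opD(1)[OF S x] bounded_opD(1)[OF R]
      by (simp add: Re_pn power_mono mult_left_mono Qn norm_nonneg)
  qed
  \<comment> \<open>Extended by 0 outside \<open>V\<close> so that every coordinate stays in a fixed
    disc; its radius uses C + 1, which bounds all \<open>c n\<close>.\<close>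
  define q where "q n = (\<lambda>(x, y). if x \<in> V \<and> y \<in> V then pn n x y else 0)" for n
  define \<beta> where "\<beta> = (\<lambda>(x, y). if x \<in> V \<and> y \<in> V then (C + 1)\<^sup>2 * (nrm x * nrm y) else 0)"
  have c1: "0 \<le> c n" "c n \<le> C + 1" for n using C(2) by (simp_all add: c_def)
  have qin: "q n i \<in> cball 0 (\<beta> i)" for n i
  proof (cases i)
    case (Pair x y)
    have "cmod (pn n x y) \<le> (C + 1)\<^sup>2 * (nrm x * nrm y)" if x: "x \<in> V" and y: "y \<in> V"
    proof -
      have le: "hs_norm (P n) z \<le> (C + 1) * nrm z" if z: "z \<in> V" for z
      proof -
        have "(hs_norm (P n) z)\<^sup>2 \<le> (c n * nrm z)\<^sup>2"
          using hi[OF z, of n] pre_hilbert.norm_sq[OF P, of z n] z by (simp add: pn_def power_mult_distrib)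
        hence "hs_norm (P n) z \<le> c n * nrm z"
          by (rule power2_le_imp_le) (simp add: c1 norm_nonneg z)
        also have "\<dots> \<le> (C + 1) * nrm z" by (intro mult_right_mono c1 norm_nonneg z)
        finally show ?thesis .
      qed
      have "cmod (pn n x y) \<le> hs_norm (P n) x * hs_norm (P n) y"
        using pre_hilbert.cauchy_schwarz[OF P, of x n y] x y by (simp add: pn_def)
      also have "\<dots> \<le> ((C + 1) * nrm x) * ((C + 1) * nrm y)"
        using pre_hilbert.norm_nonneg[OF P, of y n] C(2) x y by (intro mult_mono le) (simp_all add: norm_nonneg)
      finally show ?thesis by (simp add: power2_eq_square algebra_simps)
    qed
    thus ?thesis by (simp add: Pair q_def \<beta>_def)
  qed
  obtain L G where G: "G \<noteq> bot" "G \<le> sequentially" "\<And>i. ((\<lambda>n. q n i) \<longlongrightarrow> L i) G"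
    by (rule compact_cluster_filter[OF compact_cball qin], rule that)
  define p where "p x y = L (x, y)" for x y
  have lim: "((\<lambda>n. pn n x y) \<longlongrightarrow> p x y) G" if "x \<in> V" "y \<in> V" for x y
    using G(3)[of "(x, y)"] that by (simp add: q_def p_def)
  note limRe = tendsto_Re[OF lim]
  note uniq = tendsto_unique[OF G(1)] and le = tendsto_le[OF G(1)]
  have "pre_hilbert (H\<lparr>hs_inner := p\<rparr>)"
  proof (rule pre_hilbert.intro; unfold hs_inner_update_simps)
    fix x y z a assume x: "x \<in> V"
    show "p (hs_zero H) x = 0"
      by (rule uniq[OF lim[OF zero_closed x]])
        (use pre_hilbert.inner_zero_left[OF P, of x] x in \<open>simp add: pn_def\<close>)
    show "0 \<le> Re (p x x)"
      by (rule tendsto_lowerbound[OF limRe[OF x x] _ G(1)])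
        (use pre_hilbert.inner_nonneg[OF P, of x] x in \<open>simp add: pn_def\<close>)
    assume y: "y \<in> V"
    have "(\<lambda>n. pn n x y) = (\<lambda>n. cnj (pn n y x))"
      using pre_hilbert.inner_commute[OF P, of x _ y] x y by (simp add: pn_def)
    thus "p x y = cnj (p y x)" using uniq[OF lim[OF x y]] tendsto_cnj[OF lim[OF y x]] by simp
    have "(\<lambda>n. pn n (hs_smul H a x) y) = (\<lambda>n. a * pn n x y)"
      using pre_hilbert.inner_smul_left[OF P, of x _ y a] x y by (simp add: pn_def)
    thus "p (hs_smul H a x) y = a * p x y"
      using uniq[OF lim[OF smul_closed[OF x] y]] tendsto_mult_left[OF lim[OF x y]] by simp
    assume z: "z \<in> V"
    have "(\<lambda>n. pn n (hs_add H x y) z) = (\<lambda>n. pn n x z + pn n y z)"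
      using pre_hilbert.inner_add_left[OF P, of x _ y z] x y z by (simp add: pn_def)
    thus "p (hs_add H x y) z = p x z + p y z"
      using uniq[OF lim[OF add_closed[OF x y] z]] tendsto_add[OF lim[OF x z] lim[OF y z]] by simp
  qed (simp_all add: closed)
  \<comment> \<open>As G is finer than \<open>sequentially\<close>, c tends to C along G, so the
    limit form satisfies the upper bound with C itself.\<close>
  moreover have "c \<longlonglongrightarrow> C + 0"
    unfolding c_def using LIMSEQ_inverse_real_of_nat
    by (intro tendsto_add tendsto_const) (simp add: inverse_eq_divide)
  hence climG: "(c \<longlongrightarrow> C) G" using G(2) by (simp add: tendsto_mono)
  have "(nrm x)\<^sup>2 \<le> Re (p x x)" if x: "x \<in> V" for x
    by (rule tendsto_lowerbound[OF limRe[OF x x] _ G(1)]) (simp add: lo x)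
  moreover have "Re (p x x) \<le> C\<^sup>2 * (nrm x)\<^sup>2" if x: "x \<in> V" for x
    by (rule le[OF tendsto_mult_right[OF tendsto_power[OF climG]] limRe[OF x x]]) (simp add: hi x)
  moreover have "Re (p (S x) (S x)) \<le> Re (p x x)" if x: "x \<in> V" for x
    by (rule le[OF limRe[OF x x] limRe]) (simp_all add: contr x bounded_opD(1)[OF S])
  moreover have "sim_const H S = ereal C" by (simp add: simD C)
  ultimately show ?thesis using that C(2) by blast
qed

section \<open>The positive definite kernel\<close>

lemma hs_diff_update: "hs_diff (H\<lparr>hs_inner := p\<rparr>) = hs_diff H"
  by (intro ext) (simp add: hs_diff_def)

section \<open>Shifted integrals and Gram sums of kernels\<close>

lemma integral_shifted:
  fixes f :: "real \<Rightarrow> 'a::banach"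
  assumes "continuous_on {a + d..b + d} f"
  shows "integral {a..b} (\<lambda>s. f (s + d)) = integral {a + d..b + d} f"
proof -
  have "(f has_integral integral {a + d..b + d} f) (cbox (a + d) (b + d))"
    using integrable_continuous_interval[of "a + d" "b + d" f] assms by (simp add: integrable_integral)
  from has_integral_affinity'[OF this, of 1 d] show ?thesis by (simp add: integral_unique)
qed

text \<open>Compared with [0, \<tau>], the shifted window loses [0, d] and gains
  [\<tau>, \<tau> + d], where f takes the smaller values \<open>f (s + \<tau>)\<close>. Comparing
  both windows inside [0, \<tau> + d] covers d > \<tau> as well.\<close>

lemma integral_shift_decreasing:
  fixes f :: "real \<Rightarrow> real"
  assumes cont: "\<And>c. continuous_on {0..c} f" and \<tau>: "0 \<le> \<tau>" and d: "0 \<le> d"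
    and dec: "\<And>s. 0 \<le> s \<Longrightarrow> f (s + \<tau>) \<le> f s"
  shows "integral {0..\<tau>} (\<lambda>s. f (s + d)) \<le> integral {0..\<tau>} f"
proof -
  have c: "continuous_on {a..b} f" if "0 \<le> a" for a b
    by (rule continuous_on_subset[OF cont[of b]]) (use that in auto)
  have i: "f integrable_on {a..b}" if "0 \<le> a" for a b
    by (intro integrable_continuous_interval c that)
  have "integral {0..\<tau>} (\<lambda>s. f (s + d)) = integral {d..\<tau> + d} f"
    using integral_shifted[of 0 d \<tau> f] c[OF d] by simp
  moreover have "integral {0..d} f + integral {d..\<tau> + d} f = integral {0..\<tau> + d} f"
    using \<tau> d by (intro Henstock_Kurzweil_Integration.integral_combine i) auto
  moreover have "integral {0..\<tau>} f + integral {\<tau>..\<tau> + d} f = integral {0..\<tau> + d} f"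
    using \<tau> d by (intro Henstock_Kurzweil_Integration.integral_combine i) auto
  moreover have "integral {\<tau>..\<tau> + d} f \<le> integral {0..d} f"
  proof -
    have "continuous_on {0..d} (\<lambda>s. f (s + \<tau>))"
      by (rule continuous_on_compose2[OF c[OF \<tau>, of "\<tau> + d"]]) (auto intro!: continuous_intros)
    hence "integral {0..d} (\<lambda>s. f (s + \<tau>)) \<le> integral {0..d} f"
      by (intro integral_le i integrable_continuous_interval) (auto intro: dec)
    moreover have "integral {0..d} (\<lambda>s. f (s + \<tau>)) = integral {\<tau>..\<tau> + d} f"
      using integral_shifted[of 0 \<tau> d f] c[OF \<tau>] by (simp add: add.commute)
    ultimately show ?thesis by simp
  qed
  ultimately show ?thesis by linarith
qed

text \<open>The form that a kernel on symbols induces on formal sums. Over lists, repeated symbols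
  count with multiplicity.\<close>

definition gram :: "('i \<Rightarrow> 'j \<Rightarrow> complex) \<Rightarrow> 'i list \<Rightarrow> 'j list \<Rightarrow> complex" where
  "gram k l m = (\<Sum>i\<leftarrow>l. \<Sum>j\<leftarrow>m. k i j)"

lemma gram_Nil [simp]: "gram k [] m = 0" "gram k l [] = 0"
  by (simp_all add: gram_def)

lemma gram_Cons_left: "gram k (i # l) m = (\<Sum>j\<leftarrow>m. k i j) + gram k l m"
  by (simp add: gram_def)

lemma gram_Cons_right: "gram k l (j # m) = (\<Sum>i\<leftarrow>l. k i j) + gram k l m"
  by (simp add: gram_def sum_list_addf)

lemma gram_append_left: "gram k (l @ l') m = gram k l m + gram k l' m"
  by (simp add: gram_def)

lemma gram_cnj:
  assumes "\<And>i j. i \<in> set l \<Longrightarrow> j \<in> set m \<Longrightarrow> k i j = cnj (k' j i)"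
  shows "gram k l m = cnj (gram k' m l)"
  using assms
proof (induction l)
  case (Cons i l)
  have "(\<Sum>j\<leftarrow>m'. k i j) = cnj (\<Sum>j\<leftarrow>m'. k' j i)" if "set m' \<subseteq> set m" for m'
    using that Cons.prems[of i] by (induction m') auto
  moreover have "gram k l m = cnj (gram k' m l)" using Cons by simp
  ultimately show ?case by (simp add: gram_Cons_left gram_Cons_right)
qed simp

lemma gram_cong:
  assumes "\<And>i j. i \<in> set l \<Longrightarrow> j \<in> set m \<Longrightarrow> k i j = k' i j"
  shows "gram k l m = gram k' l m"
  unfolding gram_def using assms by (intro arg_cong[where f = sum_list] map_cong refl)

lemma gram_map: "gram k (map f l) (map g m) = gram (\<lambda>i j. k (f i) (g j)) l m"
  by (simp add: gram_def comp_def)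

text \<open>The order of a formal sum is immaterial, which later allows sorting it by time.\<close>

lemma gram_mset:
  assumes "mset l = mset l'" "mset m = mset m'"
  shows "gram k l m = gram k l' m'"
proof -
  have *: "sum_list (map f a) = sum_list (map f b)" if "mset a = mset b" for f :: "'c \<Rightarrow> complex" and a b
    by (metis mset_map sum_mset_sum_list that)
  show ?thesis unfolding gram_def using *[OF assms(2)] *[OF assms(1)] by simp
qed

lemma gram_integral:
  fixes k :: "'i \<Rightarrow> 'j \<Rightarrow> real \<Rightarrow> complex"
  assumes "\<And>i j. i \<in> set l \<Longrightarrow> j \<in> set m \<Longrightarrow> k i j integrable_on S"
  shows "((\<lambda>s. gram (\<lambda>i j. k i j s) l m) has_integral gram (\<lambda>i j. integral S (k i j)) l m) S"
proof -
  have *: "((\<lambda>s. \<Sum>i\<leftarrow>a. f i s) has_integral (\<Sum>i\<leftarrow>a. I i)) S"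
    if "\<And>i. i \<in> set a \<Longrightarrow> (f i has_integral I i) S" for f and I :: "'x \<Rightarrow> complex" and a
    using that by (induction a) (auto intro!: has_integral_add)
  show ?thesis unfolding gram_def by (intro * integrable_integral assms)
qed

lemma continuous_on_gram:
  fixes k :: "'i \<Rightarrow> 'j \<Rightarrow> real \<Rightarrow> complex"
  assumes "\<And>i j. i \<in> set l \<Longrightarrow> j \<in> set m \<Longrightarrow> continuous_on S (k i j)"
  shows "continuous_on S (\<lambda>s. gram (\<lambda>i j. k i j s) l m)"
proof -
  have *: "continuous_on S (\<lambda>s. \<Sum>i\<leftarrow>a. f i s)"
    if "\<And>i. i \<in> set a \<Longrightarrow> continuous_on S (f i)" for f :: "'x \<Rightarrow> real \<Rightarrow> complex" and a
    using that by (induction a) (auto intro!: continuous_on_add)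
  show ?thesis unfolding gram_def by (intro * assms)
qed

text \<open>The output of the renorming for T \<tau>, detached from the similarities behind it. In
  the application C is the similarity constant of T \<tau>.\<close>

locale renormed_semigroup = c0_semi H T for H :: "'h hspace" and T +
  fixes p :: "'h \<Rightarrow> 'h \<Rightarrow> complex" and C \<tau> :: real
  assumes p_pre_hilbert: "pre_hilbert (H\<lparr>hs_inner := p\<rparr>)"
    and C_nonneg: "0 \<le> C" and \<tau>_pos: "0 < \<tau>"
    and p_lower: "\<And>x. x \<in> hs_carrier H \<Longrightarrow> (hs_norm H x)\<^sup>2 \<le> Re (p x x)"
    and p_upper: "\<And>x. x \<in> hs_carrier H \<Longrightarrow> Re (p x x) \<le> C\<^sup>2 * (hs_norm H x)\<^sup>2"
    and p_contr: "\<And>x. x \<in> hs_carrier H \<Longrightarrow> Re (p (T \<tau> x) (T \<tau> x)) \<le> Re (p x x)"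
begin

lemmas p_add_left = pre_hilbert.inner_add_left[OF p_pre_hilbert, unfolded hs_inner_update_simps]
lemmas p_add_right = pre_hilbert.inner_add_right[OF p_pre_hilbert, unfolded hs_inner_update_simps]
lemmas p_smul_left = pre_hilbert.inner_smul_left[OF p_pre_hilbert, unfolded hs_inner_update_simps]
lemmas p_diff_left = pre_hilbert.inner_diff_left[OF p_pre_hilbert, unfolded hs_inner_update_simps hs_diff_update]
lemmas p_diff_right = pre_hilbert.inner_diff_right[OF p_pre_hilbert, unfolded hs_inner_update_simps hs_diff_update]
lemmas p_zero_left = pre_hilbert.inner_zero_left[OF p_pre_hilbert, unfolded hs_inner_update_simps]
lemmas p_commute = pre_hilbert.inner_commute[OF p_pre_hilbert, unfolded hs_inner_update_simps]
lemmas p_nonneg = pre_hilbert.inner_nonneg[OF p_pre_hilbert, unfolded hs_inner_update_simps]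

lemma p_zero_right: "x \<in> V \<Longrightarrow> p x (hs_zero H) = 0"
  using p_commute[of x "hs_zero H"] by (simp add: p_zero_left zero_closed)

lemma p_bound:
  assumes x: "x \<in> V" and y: "y \<in> V"
  shows "cmod (p x y) \<le> C\<^sup>2 * (nrm x * nrm y)"
proof -
  let ?n = "hs_norm (H\<lparr>hs_inner := p\<rparr>)"
  have le: "?n z \<le> C * nrm z" if z: "z \<in> V" for z
  proof -
    have "(?n z)\<^sup>2 \<le> (C * nrm z)\<^sup>2"
      using p_upper[OF z] pre_hilbert.norm_sq[OF p_pre_hilbert, unfolded hs_inner_update_simps, OF z]
      by (simp add: power_mult_distrib)
    thus ?thesis by (rule power2_le_imp_le) (simp add: C_nonneg norm_nonneg z)
  qed
  have "cmod (p x y) \<le> ?n x * ?n y"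
    using pre_hilbert.cauchy_schwarz[OF p_pre_hilbert, unfolded hs_inner_update_simps, OF x y] .
  also have "\<dots> \<le> (C * nrm x) * (C * nrm y)"
    using pre_hilbert.norm_nonneg[OF p_pre_hilbert, unfolded hs_inner_update_simps] C_nonneg x y
    by (intro mult_mono le) (simp_all add: norm_nonneg)
  finally show ?thesis by (simp add: power2_eq_square algebra_simps)
qed

lemma T_tendsto:
  assumes a: "0 \<le> a" and x: "x \<in> V" and t: "t \<in> {0..c}"
  shows "((\<lambda>s. nrm (hs_diff H (T (s + a) x) (T (t + a) x))) \<longlongrightarrow> 0) (at t within {0..c})"
proof (rule tendstoI)
  fix e :: real assume e: "0 < e"
  have ca: "0 \<le> c + a" using a t by simp
  obtain d where d: "0 < d" "\<And>s t. 0 \<le> s \<Longrightarrow> s \<le> c + a \<Longrightarrow> 0 \<le> t \<Longrightarrow> t \<le> c + a \<Longrightarrow> \<bar>s - t\<bar> < d \<Longrightarrow>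
      nrm (hs_diff H (T s x) (T t x)) < e"
    by (rule T_uniformly_continuous[OF ca x e], rule that)
  have "dist (nrm (hs_diff H (T (s + a) x) (T (t + a) x))) 0 < e" if s: "s \<in> {0..c}" "dist s t < d" for s
  proof -
    have "nrm (hs_diff H (T (s + a) x) (T (t + a) x)) < e"
      using a s t by (intro d(2)) (auto simp: dist_real_def)
    moreover have "0 \<le> nrm (hs_diff H (T (s + a) x) (T (t + a) x))"
      using a s t x by (intro norm_nonneg closed T_closed) auto
    ultimately show ?thesis by simp
  qed
  thus "\<forall>\<^sub>F s in at t within {0..c}. dist (nrm (hs_diff H (T (s + a) x) (T (t + a) x))) 0 < e"
    unfolding eventually_at using d(1) by blast
qed

lemma p_T_continuous:
  assumes a: "0 \<le> a" and b: "0 \<le> b" and x: "x \<in> V" and y: "y \<in> V"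
  shows "continuous_on {0..c} (\<lambda>s. p (T (s + a) x) (T (s + b) y))"
  unfolding continuous_on_def
proof
  fix t assume t: "t \<in> {0..c}"
  let ?u = "\<lambda>s. T (s + a) x" and ?v = "\<lambda>s. T (s + b) y"
  let ?du = "\<lambda>s. nrm (hs_diff H (?u s) (?u t))" and ?dv = "\<lambda>s. nrm (hs_diff H (?v s) (?v t))"
  define B where "B = M (c + b) * nrm y"
  have uV: "?u s \<in> V" and vV: "?v s \<in> V" if "s \<in> {0..c}" for s
    using that a b x y by (auto intro: T_closed)
  have est: "norm (p (?u s) (?v s) - p (?u t) (?v t)) \<le> C\<^sup>2 * (?du s * B) + C\<^sup>2 * (nrm (?u t) * ?dv s)"
    if s: "s \<in> {0..c}" for s
  proof -
    have "p (?u s) (?v s) - p (?u t) (?v t)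
        = p (hs_diff H (?u s) (?u t)) (?v s) + p (?u t) (hs_diff H (?v s) (?v t))"
      using uV[OF s] uV[OF t] vV[OF s] vV[OF t] by (simp add: p_diff_left p_diff_right)
    also have "norm \<dots> \<le> cmod (p (hs_diff H (?u s) (?u t)) (?v s)) + cmod (p (?u t) (hs_diff H (?v s) (?v t)))"
      by (rule norm_triangle_ineq)
    also have "\<dots> \<le> C\<^sup>2 * (?du s * nrm (?v s)) + C\<^sup>2 * (nrm (?u t) * ?dv s)"
      by (intro add_mono p_bound closed uV vV s t)
    also have "\<dots> \<le> C\<^sup>2 * (?du s * B) + C\<^sup>2 * (nrm (?u t) * ?dv s)"
    proof -
      have "nrm (?v s) \<le> B" unfolding B_def using s b y by (intro T_norm_le) auto
      thus ?thesis by (intro add_mono mult_left_mono order_refl) (auto intro!: norm_nonneg closed uV s t)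
    qed
    finally show ?thesis .
  qed
  have "((\<lambda>s. C\<^sup>2 * (?du s * B) + C\<^sup>2 * (nrm (?u t) * ?dv s)) \<longlongrightarrow> C\<^sup>2 * (0 * B) + C\<^sup>2 * (nrm (?u t) * 0))
      (at t within {0..c})"
    by (intro tendsto_intros T_tendsto a b x y t)
  hence lim: "((\<lambda>s. C\<^sup>2 * (?du s * B) + C\<^sup>2 * (nrm (?u t) * ?dv s)) \<longlongrightarrow> 0) (at t within {0..c})" by simp
  have "((\<lambda>s. p (?u s) (?v s) - p (?u t) (?v t)) \<longlongrightarrow> 0) (at t within {0..c})"
    by (rule Lim_null_comparison[OF _ lim]) (use est in \<open>auto simp: eventually_at intro: exI[of _ 1]\<close>)
  thus "((\<lambda>s. p (?u s) (?v s)) \<longlongrightarrow> p (?u t) (?v t)) (at t within {0..c})"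
    by (simp add: LIM_zero_iff)
qed

lemma T_zero_vec: "0 \<le> t \<Longrightarrow> T t (hs_zero H) = hs_zero H"
proof (rule eqI)
  assume t: "0 \<le> t"
  show 1: "T t (hs_zero H) \<in> V" "hs_zero H \<in> V" by (intro T_closed zero_closed t)+
  fix z assume z: "z \<in> V"
  have "nrm (T t (hs_zero H)) = 0"
    using T_bound[OF t zero_closed] norm_nonneg[OF 1(1)] by (simp add: norm_zero_hs[OF pre_hilbert_axioms])
  hence "cmod (ip (T t (hs_zero H)) z) \<le> 0" using cauchy_schwarz[OF 1(1) z] by simp
  thus "ip (T t (hs_zero H)) z = ip (hs_zero H) z" using z by (simp add: inner_zero_left)
qed

text \<open>A list \<open>[(r1, x1), ..., (rn, xn)]\<close> stands for the formal sum of the vectors \<open>U(ri) B xi\<close> of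
  the group to be constructed.\<close>

definition orbit :: "real \<Rightarrow> real \<Rightarrow> (real \<times> 'h) list \<Rightarrow> 'h" where
  "orbit q s l = foldr (\<lambda>(r, x) v. hs_add H (T (s + (r - q)) x) v) l (hs_zero H)"

lemma orbit_Nil [simp]: "orbit q s [] = hs_zero H"
  by (simp add: orbit_def)

lemma orbit_Cons [simp]: "orbit q s ((r, x) # l) = hs_add H (T (s + (r - q)) x) (orbit q s l)"
  by (simp add: orbit_def)

lemma orbit_closed: "set l \<subseteq> {q..} \<times> V \<Longrightarrow> 0 \<le> s \<Longrightarrow> orbit q s l \<in> V"
  by (induction l) (auto intro!: closed T_closed)

text \<open>Only s - q enters, so lowering the base q amounts to moving s to the right.\<close>

lemma orbit_shift: "orbit q s l = orbit q' (s + (q' - q)) l"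
  by (induction l) (auto simp: algebra_simps)

lemma orbit_T:
  assumes "set l \<subseteq> {q..} \<times> V" "0 \<le> s" "0 \<le> t"
  shows "T t (orbit q s l) = orbit q (t + s) l"
  using assms
proof (induction l)
  case (Cons i l)
  obtain r x where i: "i = (r, x)" by (cases i)
  have rx: "0 \<le> s + (r - q)" "x \<in> V" using Cons.prems i by auto
  have "T t (T (s + (r - q)) x) = T (t + s + (r - q)) x"
    using T_plus[OF \<open>0 \<le> t\<close> rx] by (simp add: add.assoc)
  thus ?case using Cons orbit_closed[of l q s] rx by (simp add: i T_add T_closed)
qed (simp add: T_zero_vec)

lemma p_orbit:
  assumes "set l \<subseteq> {q..} \<times> V" "set m \<subseteq> {q..} \<times> V" "0 \<le> s"
  shows "p (orbit q s l) (orbit q s m)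
    = gram (\<lambda>i j. p (T (s + (fst i - q)) (snd i)) (T (s + (fst j - q)) (snd j))) l m"
proof -
  have 1: "p v (orbit q s m) = (\<Sum>j\<leftarrow>m. p v (T (s + (fst j - q)) (snd j)))" if v: "v \<in> V" for v
    using assms(2)
  proof (induction m)
    case (Cons i m)
    thus ?case using v assms(3) orbit_closed[of m q s] by (cases i) (simp add: p_add_right T_closed)
  qed (simp add: p_zero_right v)
  show ?thesis using assms(1)
  proof (induction l)
    case Nil
    thus ?case using assms by (simp add: p_zero_left orbit_closed)
  next
    case (Cons i l)
    obtain r x where i: "i = (r, x)" by (cases i)
    have rx: "T (s + (r - q)) x \<in> V" using Cons.prems i assms(3) by (auto intro: T_closed)
    show ?case
      using Cons assms rx 1[OF rx] orbit_closed[of l q s] orbit_closed[of m q s]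
      by (simp add: i p_add_left gram_Cons_left)
  qed
qed

text \<open>The kernel with one base q for all pairs. For a formal sum with all times at least q its
  Gram sum is the integral of \<open>p (orbit q s l) (orbit q s l)\<close>, hence evidently
  nonnegative.\<close>

definition hker :: "real \<Rightarrow> real \<times> 'h \<Rightarrow> real \<times> 'h \<Rightarrow> complex" where
  "hker q i j = integral {0..\<tau>} (\<lambda>s. p (T (s + (fst i - q)) (snd i)) (T (s + (fst j - q)) (snd j)))"

text \<open>This will be the inner product of \<open>U(r) B x\<close> and \<open>U(r') B y\<close>.\<close>

definition gker :: "real \<times> 'h \<Rightarrow> real \<times> 'h \<Rightarrow> complex" where
  "gker i j = hker (min (fst i) (fst j)) i j"

lemma p_T_integrable:
  assumes "0 \<le> a" "0 \<le> b" "x \<in> V" "y \<in> V"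
  shows "(\<lambda>s. p (T (s + a) x) (T (s + b) y)) integrable_on {0..c}"
  by (intro integrable_continuous_interval p_T_continuous assms)

lemma p_orbit_continuous:
  assumes "set l \<subseteq> {q..} \<times> V"
  shows "continuous_on {0..c} (\<lambda>s. p (orbit q s l) (orbit q s l))"
proof -
  have "continuous_on {0..c} (\<lambda>s. gram (\<lambda>i j. p (T (s + (fst i - q)) (snd i)) (T (s + (fst j - q)) (snd j))) l l)"
    using assms by (intro continuous_on_gram) (auto intro!: p_T_continuous)
  thus ?thesis using p_orbit[OF assms assms] by (simp cong: continuous_on_cong_simp)
qed

lemma gram_hker:
  assumes "set l \<subseteq> {q..} \<times> V"
  shows "gram (hker q) l l = integral {0..\<tau>} (\<lambda>s. p (orbit q s l) (orbit q s l))"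
proof -
  let ?k = "\<lambda>i j s. p (T (s + (fst i - q)) (snd i)) (T (s + (fst j - q)) (snd j))"
  have "((\<lambda>s. gram (\<lambda>i j. ?k i j s) l l) has_integral gram (\<lambda>i j. integral {0..\<tau>} (?k i j)) l l) {0..\<tau>}"
    using assms by (intro gram_integral p_T_integrable) auto
  moreover have "gram (\<lambda>i j. integral {0..\<tau>} (?k i j)) l l = gram (hker q) l l"
    by (intro gram_cong) (simp add: hker_def)
  ultimately have "integral {0..\<tau>} (\<lambda>s. gram (\<lambda>i j. ?k i j s) l l) = gram (hker q) l l"
    by (simp add: integral_unique)
  moreover have "integral {0..\<tau>} (\<lambda>s. gram (\<lambda>i j. ?k i j s) l l) = integral {0..\<tau>} (\<lambda>s. p (orbit q s l) (orbit q s l))"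
    by (intro integral_cong) (simp add: p_orbit[OF assms assms])
  ultimately show ?thesis by simp
qed

lemma Re_gram_hker:
  assumes "set l \<subseteq> {q..} \<times> V"
  shows "Re (gram (hker q) l l) = integral {0..\<tau>} (\<lambda>s. Re (p (orbit q s l) (orbit q s l)))"
  unfolding gram_hker[OF assms]
  using integral_linear[OF integrable_continuous_interval[OF p_orbit_continuous[OF assms, of \<tau>]] bounded_linear_Re]
  by (simp add: comp_def)

lemma Re_p_orbit_continuous:
  "set l \<subseteq> {q..} \<times> V \<Longrightarrow> continuous_on {0..c} (\<lambda>s. Re (p (orbit q s l) (orbit q s l)))"
  by (intro continuous_intros p_orbit_continuous)

lemma Re_hker_nonneg:
  assumes "set l \<subseteq> {q..} \<times> V"
  shows "0 \<le> Re (gram (hker q) l l)"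
  unfolding Re_gram_hker[OF assms]
  by (intro integral_nonneg integrable_continuous_interval Re_p_orbit_continuous assms p_nonneg orbit_closed) auto

text \<open>Passing from q' down to q shifts the integrand by q' - q. It falls under translation by
  \<tau> because T \<tau> maps \<open>orbit q' s l\<close> to
  \<open>orbit q' (s + \<tau>) l\<close>; this is where contractivity of T \<tau> under p
  enters.\<close>

lemma Re_hker_mono:
  assumes l: "set l \<subseteq> {q'..} \<times> V" and q: "q \<le> q'"
  shows "Re (gram (hker q) l l) \<le> Re (gram (hker q') l l)"
proof -
  have l': "set l \<subseteq> {q..} \<times> V" using l q by auto
  let ?f = "\<lambda>s. Re (p (orbit q' s l) (orbit q' s l))"
  have "integral {0..\<tau>} (\<lambda>s. ?f (s + (q' - q))) \<le> integral {0..\<tau>} ?f"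
  proof (rule integral_shift_decreasing)
    fix s :: real assume s: "0 \<le> s"
    have "orbit q' (s + \<tau>) l = T \<tau> (orbit q' s l)"
      using orbit_T[OF l s, of \<tau>] \<tau>_pos by (simp add: add.commute)
    thus "?f (s + \<tau>) \<le> ?f s" using p_contr orbit_closed[OF l s] by simp
  qed (use q \<tau>_pos in \<open>auto intro!: Re_p_orbit_continuous l\<close>)
  thus ?thesis unfolding Re_gram_hker[OF l] Re_gram_hker[OF l'] orbit_shift[of q _ l q'] .
qed

text \<open>All Gram entries involving the smallest time coincide in both sums, so they cancel.\<close>

lemma Re_hker_le_gker_sorted:
  "sorted (map fst l) \<Longrightarrow> set l \<subseteq> {q..} \<times> V \<Longrightarrow> Re (gram (hker q) l l) \<le> Re (gram gker l l)"
proof (induction l arbitrary: q)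
  case (Cons i l)
  define q0 where "q0 = fst i"
  have l: "set (i # l) \<subseteq> {q0..} \<times> V" "set l \<subseteq> {q0..} \<times> V" and q: "q \<le> q0"
    using Cons.prems by (auto simp: q0_def)
  \<comment> \<open>As q0 is the smallest time, every minimum taken against the time of i equals
    q0.\<close>
  have s: "(\<Sum>j\<leftarrow>i # l. gker i j) = (\<Sum>j\<leftarrow>i # l. hker q0 i j)" "(\<Sum>j\<leftarrow>l. gker j i) = (\<Sum>j\<leftarrow>l. hker q0 j i)"
    using l by (intro arg_cong[where f = sum_list] map_cong refl; auto simp: gker_def q0_def min_def)+
  \<comment> \<open>The base is raised to the smallest time. The induction hypothesis is then
    applied to l with base q0, which is why q is kept arbitrary.\<close>
  have "Re (gram (hker q) (i # l) (i # l)) \<le> Re (gram (hker q0) (i # l) (i # l))"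
    by (rule Re_hker_mono[OF l(1) q])
  also have "\<dots> = Re (\<Sum>j\<leftarrow>i # l. hker q0 i j) + Re (\<Sum>j\<leftarrow>l. hker q0 j i) + Re (gram (hker q0) l l)"
    unfolding gram_Cons_left[of _ i l] gram_Cons_right[of _ l i] by simp
  also have "\<dots> \<le> Re (\<Sum>j\<leftarrow>i # l. hker q0 i j) + Re (\<Sum>j\<leftarrow>l. hker q0 j i) + Re (gram gker l l)"
    using Cons.IH[OF _ l(2)] Cons.prems by simp
  also have "\<dots> = Re (gram gker (i # l) (i # l))"
    unfolding gram_Cons_left[of _ i l] gram_Cons_right[of _ l i] s[symmetric] by simp
  finally show ?case .
qed simp

text \<open>Both Gram sums are invariant under permutations, so the list may be sorted by
  time.\<close>

lemma Re_hker_le_gker: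
  assumes "set l \<subseteq> {q..} \<times> V"
  shows "Re (gram (hker q) l l) \<le> Re (gram gker l l)"
proof -
  have "gram k (sort_key fst l) (sort_key fst l) = gram k l l" for k :: "real \<times> 'h \<Rightarrow> real \<times> 'h \<Rightarrow> complex"
    by (intro gram_mset) simp_all
  thus ?thesis using Re_hker_le_gker_sorted[of "sort_key fst l" q] assms by simp
qed

lemma gker_nonneg:
  assumes "set l \<subseteq> UNIV \<times> V"
  shows "0 \<le> Re (gram gker l l)"
proof -
  \<comment> \<open>0 is inserted so that the minimum also exists for the empty sum.\<close>
  define q where "q = Min (insert 0 (fst ` set l))"
  have "set l \<subseteq> {q..} \<times> V" using assms by (force simp: q_def intro: Min_le)
  from Re_hker_nonneg[OF this] Re_hker_le_gker[OF this] show ?thesis by linarith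
qed

text \<open>The hypothesis \<sigma> \<le> \<tau> serves twice: M \<tau> bounds T (\<sigma> - s) for
  s in [0, \<sigma>], and [0, \<sigma>] lies in the window [0, \<tau>] of the form. The factor 1 /
  \<sigma> comes from integrating a constant left-hand side.\<close>

lemma orbit_norm_le:
  assumes l: "set l \<subseteq> {\<sigma>..} \<times> V" and \<sigma>: "0 < \<sigma>" "\<sigma> \<le> \<tau>"
  shows "(nrm (orbit 0 0 l))\<^sup>2 \<le> (M \<tau>)\<^sup>2 / \<sigma> * Re (gram gker l l)"
proof -
  let ?f = "\<lambda>s. Re (p (orbit \<sigma> s l) (orbit \<sigma> s l))"
  have l0: "set l \<subseteq> {0..} \<times> V" using l \<sigma>(1) by fastforce
  have le: "(nrm (orbit 0 0 l))\<^sup>2 \<le> (M \<tau>)\<^sup>2 * ?f s" if s: "s \<in> {0..\<sigma>}" for s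
  proof -
    have oV: "orbit \<sigma> s l \<in> V" using s by (intro orbit_closed l) auto
    have "orbit 0 0 l = T (\<sigma> - s) (orbit \<sigma> s l)"
      using orbit_T[OF l, of s "\<sigma> - s"] s orbit_shift[of 0 0 l \<sigma>] by simp
    hence "nrm (orbit 0 0 l) \<le> M \<tau> * nrm (orbit \<sigma> s l)"
      using T_norm_le[of "\<sigma> - s" \<tau>] s \<sigma> oV by simp
    hence "(nrm (orbit 0 0 l))\<^sup>2 \<le> (M \<tau> * nrm (orbit \<sigma> s l))\<^sup>2"
      by (intro power_mono norm_nonneg orbit_closed l0 order_refl)
    also have "\<dots> = (M \<tau>)\<^sup>2 * (nrm (orbit \<sigma> s l))\<^sup>2" by (simp add: power_mult_distrib)
    also have "\<dots> \<le> (M \<tau>)\<^sup>2 * ?f s" by (intro mult_left_mono p_lower oV) simp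
    finally show ?thesis .
  qed
  have int: "?f integrable_on {0..c}" for c
    by (intro integrable_continuous_interval Re_p_orbit_continuous l)
  have "\<sigma> * (nrm (orbit 0 0 l))\<^sup>2 = integral {0..\<sigma>} (\<lambda>s. (nrm (orbit 0 0 l))\<^sup>2)" using \<sigma> by simp
  also have "\<dots> \<le> integral {0..\<sigma>} (\<lambda>s. (M \<tau>)\<^sup>2 * ?f s)"
    by (intro integral_le integrable_continuous_interval continuous_on_mult continuous_on_const
        Re_p_orbit_continuous l le)
  also have "\<dots> = (M \<tau>)\<^sup>2 * integral {0..\<sigma>} ?f" by simp
  also have "integral {0..\<sigma>} ?f \<le> integral {0..\<tau>} ?f"
    using \<sigma> by (intro integral_subset_le int) (auto intro!: p_nonneg orbit_closed l)
  also have "integral {0..\<tau>} ?f \<le> Re (gram gker l l)"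
    using Re_hker_le_gker[OF l] Re_gram_hker[OF l] by simp
  finally have "\<sigma> * (nrm (orbit 0 0 l))\<^sup>2 \<le> (M \<tau>)\<^sup>2 * Re (gram gker l l)" by (simp add: mult_left_mono)
  thus ?thesis using \<sigma>(1) by (simp add: field_simps)
qed

section \<open>Invariance, sesquilinearity and continuity of the kernel\<close>

lemma gker_translate: "gker (t + r, x) (t + r', y) = gker (r, x) (r', y)"
  by (simp add: gker_def hker_def min_add_distrib_right[symmetric])

lemma gker_commute:
  assumes "snd i \<in> V" "snd j \<in> V"
  shows "gker i j = cnj (gker j i)"
proof -
  obtain r x r' y where ij: "i = (r, x)" "j = (r', y)" by (cases i, cases j)
  let ?m = "min r r'"
  have "integral {0..\<tau>} (\<lambda>s. p (T (s + (r - ?m)) x) (T (s + (r' - ?m)) y))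
      = integral {0..\<tau>} (\<lambda>s. cnj (p (T (s + (r' - ?m)) y) (T (s + (r - ?m)) x)))"
    by (intro integral_cong p_commute T_closed) (use assms ij in auto)
  thus ?thesis by (simp add: ij gker_def hker_def integral_cnj min.commute)
qed

lemma gker_add_left:
  assumes "x \<in> V" "y \<in> V" "snd j \<in> V"
  shows "gker (r, hs_add H x y) j = gker (r, x) j + gker (r, y) j"
proof -
  obtain r' z where j: "j = (r', z)" by (cases j)
  let ?a = "r - min r r'" and ?b = "r' - min r r'"
  have ab: "0 \<le> ?a" "0 \<le> ?b" by auto
  have "integral {0..\<tau>} (\<lambda>s. p (T (s + ?a) (hs_add H x y)) (T (s + ?b) z))
      = integral {0..\<tau>} (\<lambda>s. p (T (s + ?a) x) (T (s + ?b) z) + p (T (s + ?a) y) (T (s + ?b) z))"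
    by (intro integral_cong) (use assms j ab in \<open>simp add: T_add p_add_left T_closed\<close>)
  also have "\<dots> = integral {0..\<tau>} (\<lambda>s. p (T (s + ?a) x) (T (s + ?b) z)) + integral {0..\<tau>} (\<lambda>s. p (T (s + ?a) y) (T (s + ?b) z))"
    by (intro integral_add p_T_integrable ab) (use assms j in auto)
  finally show ?thesis by (simp add: j gker_def hker_def)
qed

lemma gker_smul_left:
  assumes "x \<in> V" "snd j \<in> V"
  shows "gker (r, hs_smul H a x) j = a * gker (r, x) j"
proof -
  obtain r' z where j: "j = (r', z)" by (cases j)
  let ?a = "r - min r r'" and ?b = "r' - min r r'"
  have ab: "0 \<le> ?a" "0 \<le> ?b" by auto
  have "integral {0..\<tau>} (\<lambda>s. p (T (s + ?a) (hs_smul H a x)) (T (s + ?b) z))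
      = integral {0..\<tau>} (\<lambda>s. a * p (T (s + ?a) x) (T (s + ?b) z))"
    by (intro integral_cong) (use assms j ab in \<open>simp add: T_smul p_smul_left T_closed\<close>)
  thus ?thesis by (simp add: j gker_def hker_def)
qed

text \<open>C enters through the upper bound on p, M \<tau> through T s on the window, \<tau> as its
  length. The right-hand side is the square of the bound for B.\<close>

lemma gker_diag_le:
  assumes x: "x \<in> V"
  shows "Re (gker (r, x) (r, x)) \<le> \<tau> * (C * M \<tau> * nrm x)\<^sup>2"
proof -
  have "cmod (gker (r, x) (r, x)) \<le> (C * M \<tau> * nrm x)\<^sup>2 * (\<tau> - 0)"
    unfolding gker_def hker_def fst_conv snd_conv
  proof (rule integral_bound)
    show "continuous_on {0..\<tau>} (\<lambda>s. p (T (s + (r - min r r)) x) (T (s + (r - min r r)) x))"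
      by (intro p_T_continuous x) auto
    fix s assume s: "s \<in> {0..\<tau>}"
    have "cmod (p (T s x) (T s x)) \<le> C\<^sup>2 * (nrm (T s x) * nrm (T s x))"
      using s by (intro p_bound T_closed x) auto
    also have "\<dots> \<le> C\<^sup>2 * ((M \<tau> * nrm x) * (M \<tau> * nrm x))"
      using s M_nonneg[of \<tau>] \<tau>_pos norm_nonneg[OF x]
      by (intro mult_left_mono mult_mono T_norm_le x) (auto intro!: norm_nonneg T_closed x)
    finally show "cmod (p (T (s + (r - min r r)) x) (T (s + (r - min r r)) x)) \<le> (C * M \<tau> * nrm x)\<^sup>2"
      by (simp add: power2_eq_square algebra_simps)
  qed (use \<tau>_pos in simp)
  thus ?thesis using complex_Re_le_cmod[of "gker (r, x) (r, x)"] by (simp add: mult.commute)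
qed

text \<open>For t \<ge> 0 both kernels have base r, so their difference integrates
  \<open>p (T s (T t x - x)) (T s x)\<close>. The estimate provides strong continuity of the
  group.\<close>

lemma gker_near_diag_nonneg:
  assumes x: "x \<in> V" and t: "0 \<le> t"
  shows "cmod (gker (t + r, x) (r, x) - gker (r, x) (r, x))
    \<le> C\<^sup>2 * (M \<tau> * nrm (hs_diff H (T t x) x) * (M \<tau> * nrm x)) * \<tau>"
proof -
  let ?g = "\<lambda>s. p (T (s + t) x) (T (s + 0) x)" and ?h = "\<lambda>s. p (T (s + 0) x) (T (s + 0) x)"
  have ci: "?g integrable_on {0..\<tau>}" "?h integrable_on {0..\<tau>}"
    by (intro p_T_integrable x t order_refl)+
  have "gker (t + r, x) (r, x) - gker (r, x) (r, x) = integral {0..\<tau>} (\<lambda>s. ?g s - ?h s)"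
    using t by (simp add: gker_def hker_def min_def integral_diff[OF ci, simplified])
  also have "cmod \<dots> \<le> C\<^sup>2 * (M \<tau> * nrm (hs_diff H (T t x) x) * (M \<tau> * nrm x)) * (\<tau> - 0)"
  proof (rule integral_bound)
    show "continuous_on {0..\<tau>} (\<lambda>s. ?g s - ?h s)"
      by (intro continuous_on_diff p_T_continuous x t order_refl)
    fix s assume s: "s \<in> {0..\<tau>}"
    have V: "T s x \<in> V" "T t x \<in> V" "hs_diff H (T t x) x \<in> V" "T s (hs_diff H (T t x) x) \<in> V"
      using s t x by (auto intro!: T_closed closed)
    have "?g s - ?h s = p (T s (hs_diff H (T t x) x)) (T s x)"
      using s t x V T_plus[of s t x] by (simp add: T_diff p_diff_left T_closed)
    hence "cmod (?g s - ?h s) \<le> C\<^sup>2 * (nrm (T s (hs_diff H (T t x) x)) * nrm (T s x))"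
      using p_bound[OF V(4,1)] by simp
    also have "\<dots> \<le> C\<^sup>2 * ((M \<tau> * nrm (hs_diff H (T t x) x)) * (M \<tau> * nrm x))"
      using s M_nonneg[of \<tau>] \<tau>_pos V x
      by (intro mult_left_mono mult_mono T_norm_le) (auto intro!: norm_nonneg mult_nonneg_nonneg)
    finally show "norm (?g s - ?h s) \<le> C\<^sup>2 * (M \<tau> * nrm (hs_diff H (T t x) x) * (M \<tau> * nrm x))" .
  qed (use \<tau>_pos in simp)
  finally show ?thesis by simp
qed

text \<open>For negative t, symmetry and translation show that the entry for t is the conjugate of
  the entry for -t.\<close>

lemma gker_near_diag:
  assumes x: "x \<in> V"
  shows "cmod (gker (t + r, x) (r, x) - gker (r, x) (r, x))
    \<le> C\<^sup>2 * (M \<tau> * nrm (hs_diff H (T \<bar>t\<bar> x) x) * (M \<tau> * nrm x)) * \<tau>"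
proof (cases "0 \<le> t")
  case True
  thus ?thesis using gker_near_diag_nonneg[OF x True] by simp
next
  case False
  have "gker (t + r, x) (r, x) = cnj (gker (r, x) (t + r, x))"
    by (rule gker_commute) (simp_all add: x)
  also have "gker (r, x) (t + r, x) = gker (- t + r, x) (r, x)"
    using gker_translate[of t "- t + r" x r x] by simp
  finally have "gker (t + r, x) (r, x) - gker (r, x) (r, x) = cnj (gker (- t + r, x) (r, x) - gker (r, x) (r, x))"
    using gker_commute[of "(r, x)" "(r, x)"] x by simp
  hence "cmod (gker (t + r, x) (r, x) - gker (r, x) (r, x)) = cmod (gker (- t + r, x) (r, x) - gker (r, x) (r, x))"
    by (simp only: complex_mod_cnj)
  thus ?thesis using gker_near_diag_nonneg[OF x, of "- t" r] False by simp
qed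

end

section \<open>The unitary group\<close>

context pre_hilbert
begin

lemma norm_add_diff_le:
  assumes "a \<in> V" "b \<in> V" "c \<in> V" "d \<in> V"
  shows "nrm (hs_diff E (hs_add E a b) (hs_add E c d)) \<le> nrm (hs_diff E a c) + nrm (hs_diff E b d)"
proof -
  have "nrm (hs_diff E (hs_add E a b) (hs_add E c d)) = nrm (hs_add E (hs_diff E a c) (hs_diff E b d))"
    using assms by (simp add: hs_norm_def inner_simps closed algebra_simps)
  thus ?thesis using norm_triangle[of "hs_diff E a c" "hs_diff E b d"] assms by (simp add: closed)
qed

text \<open>Polarization: real parts come from norms of sums, imaginary parts from replacing y by
  \<i> y.\<close>

lemma isometry_inner:
  assumes u: "\<And>x. x \<in> V \<Longrightarrow> u x \<in> V" "\<And>x. x \<in> V \<Longrightarrow> nrm (u x) = nrm x"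
    and lin: "\<And>x y. x \<in> V \<Longrightarrow> y \<in> V \<Longrightarrow> u (hs_add E x y) = hs_add E (u x) (u y)"
      "\<And>a x. x \<in> V \<Longrightarrow> u (hs_smul E a x) = hs_smul E a (u x)"
    and x: "x \<in> V" and y: "y \<in> V"
  shows "ip (u x) (u y) = ip x y"
proof -
  have re: "Re (ip (u x) (u z)) = Re (ip x z)" if z: "z \<in> V" for z
  proof -
    have "(nrm (hs_add E (u x) (u z)))\<^sup>2 = (nrm (hs_add E x z))\<^sup>2"
      using u(2)[OF add_closed[OF x z]] lin(1)[OF x z] by simp
    thus ?thesis using x z u by (simp add: norm_add_sq)
  qed
  have "Re (ip (u x) (hs_smul E \<i> (u y))) = Re (ip x (hs_smul E \<i> y))"
    using re[OF smul_closed[OF y], of \<i>] lin(2)[OF y, of \<i>] by simp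
  hence "Im (ip (u x) (u y)) = Im (ip x y)"
    using x y u by (simp add: inner_smul_right)
  thus ?thesis using re[OF y] by (simp add: complex_eq_iff)
qed

end

context renormed_semigroup
begin

text \<open>S is the set of admissible times: all reals give the space of the group, the half line
  from \<sigma> the part on which A is prescribed. Addition is concatenation, with no relations
  imposed between formal sums.\<close>

definition pre_space :: "real set \<Rightarrow> (real \<times> 'h) list hspace" where
  "pre_space S = \<lparr>hs_carrier = {l. set l \<subseteq> S \<times> V}, hs_zero = [], hs_add = (@),
     hs_smul = (\<lambda>a. map (\<lambda>(r, x). (r, hs_smul H a x))), hs_inner = gram gker\<rparr>"

lemma pre_space_simps:
  "hs_carrier (pre_space S) = {l. set l \<subseteq> S \<times> V}" "hs_zero (pre_space S) = []"
  "hs_add (pre_space S) = (@)" "hs_smul (pre_space S) a = map (\<lambda>(r, x). (r, hs_smul H a x))"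
  "hs_inner (pre_space S) = gram gker"
  by (simp_all add: pre_space_def)

lemma gram_smul_left:
  assumes "set l \<subseteq> UNIV \<times> V" "set m \<subseteq> UNIV \<times> V"
  shows "gram gker (map (\<lambda>(r, x). (r, hs_smul H a x)) l) m = a * gram gker l m"
  using assms(1)
proof (induction l)
  case (Cons i l)
  obtain r x where i: "i = (r, x)" by (cases i)
  have "(\<Sum>j\<leftarrow>m. gker (r, hs_smul H a x) j) = (\<Sum>j\<leftarrow>m. a * gker (r, x) j)"
    using assms(2) Cons.prems i
    by (intro arg_cong[where f = sum_list] map_cong refl gker_smul_left) auto
  thus ?case using Cons i by (simp add: gram_Cons_left sum_list_const_mult algebra_simps)
qed simp

lemma pre_space_pre_hilbert: "pre_hilbert (pre_space S)"
proof (rule pre_hilbert.intro; unfold pre_space_simps mem_Collect_eq)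
  fix l m n :: "(real \<times> 'h) list" and a :: complex
  assume l: "set l \<subseteq> S \<times> V"
  hence l': "set l \<subseteq> UNIV \<times> V" by auto
  show "set (map (\<lambda>(r, x). (r, hs_smul H a x)) l) \<subseteq> S \<times> V" using l by (auto intro: smul_closed)
  show "0 \<le> Re (gram gker l l)" by (rule gker_nonneg[OF l'])
  assume m: "set m \<subseteq> S \<times> V"
  hence m': "set m \<subseteq> UNIV \<times> V" by auto
  show "gram gker l m = cnj (gram gker m l)"
    by (intro gram_cnj gker_commute) (use l m in auto)
  show "gram gker (map (\<lambda>(r, x). (r, hs_smul H a x)) l) m = a * gram gker l m"
    by (rule gram_smul_left[OF l' m'])
  show "gram gker (l @ m) n = gram gker l n + gram gker m n" by (rule gram_append_left)
qed auto

definition shift :: "real \<Rightarrow> (real \<times> 'h) list \<Rightarrow> (real \<times> 'h) list" where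
  "shift t = map (\<lambda>(r, x). (t + r, x))"

lemma shift_simps [simp]:
  "shift t [] = []" "shift t ((r, x) # l) = (t + r, x) # shift t l" "shift t (l @ m) = shift t l @ shift t m"
  by (simp_all add: shift_def)

lemma shift_shift: "shift s (shift t l) = shift (s + t) l"
  by (simp add: shift_def comp_def split_beta add.assoc)

lemma shift_zero: "shift 0 l = l"
  by (simp add: shift_def split_beta)

lemma shift_closed_iff: "set (shift t l) \<subseteq> UNIV \<times> V \<longleftrightarrow> set l \<subseteq> UNIV \<times> V"
  by (auto simp: shift_def)

lemma shift_smul: "shift t (map (\<lambda>(r, x). (r, hs_smul H a x)) l) = map (\<lambda>(r, x). (r, hs_smul H a x)) (shift t l)"
  by (simp add: shift_def comp_def split_beta)

lemma gram_shift: "gram gker (shift t l) (shift t m) = gram gker l m"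
  by (simp add: shift_def gram_map split_beta gker_translate)

section \<open>The translation group on the completion\<close>

interpretation E: pre_hilbert "pre_space UNIV"
  by (rule pre_space_pre_hilbert)

interpretation K: pre_hilbert E.completion
  by (rule E.completion_pre_hilbert)

text \<open>F stands for the vector k with \<open>F l = <k, l>\<close>, and a unitary group
  satisfies \<open><U(t) k, l> = <k, U(-t) l>\<close>; hence the sign.\<close>

definition Uop :: "real \<Rightarrow> ((real \<times> 'h) list \<Rightarrow> complex) \<Rightarrow> (real \<times> 'h) list \<Rightarrow> complex" where
  "Uop t F = (\<lambda>l. F (shift (- t) l))"

lemma shift_in_carrier: "shift t l \<in> E.V \<longleftrightarrow> l \<in> E.V"
  by (simp add: pre_space_simps shift_closed_iff)

lemma norm_shift: "E.nrm (shift t l) = E.nrm l"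
  by (simp add: hs_norm_def pre_space_simps gram_shift)

lemma Uop_in_norm:
  assumes F: "F \<in> E.dual_set"
  shows "Uop t F \<in> E.dual_set" "E.cnrm (Uop t F) \<le> E.cnrm F"
proof -
  have b: "cmod (Uop t F l) \<le> E.cnrm F * E.nrm l" if "l \<in> E.V" for l
    using E.completion_bound[OF F, of "shift (- t) l"] that by (simp add: Uop_def shift_in_carrier norm_shift)
  have "E.antilinear (Uop t F)"
    unfolding E.antilinear_def
  proof (intro conjI ballI allI)
    fix l m a assume l: "l \<in> E.V"
    note anti = E.dual_setD(2)[OF F]
    show "Uop t F (hs_smul (pre_space UNIV) a l) = cnj a * Uop t F l"
      using E.antilinear_smul[OF anti, of "shift (- t) l" a] l
      by (simp add: Uop_def shift_in_carrier) (simp add: pre_space_simps shift_smul)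
    assume m: "m \<in> E.V"
    show "Uop t F (hs_add (pre_space UNIV) l m) = Uop t F l + Uop t F m"
      using E.antilinear_add[OF anti, of "shift (- t) l" "shift (- t) m"] l m
      by (simp add: Uop_def shift_in_carrier) (simp add: pre_space_simps)
  qed
  thus 1: "Uop t F \<in> E.dual_set"
    using b E.dual_setD(1)[OF F] by (intro E.dual_setI) (auto simp: Uop_def shift_in_carrier)
  show "E.cnrm (Uop t F) \<le> E.cnrm F"
    by (rule E.completion_norm_le[OF 1 E.completion_norm_nonneg[OF F] b])
qed

lemma Uop_Uop: "Uop s (Uop t F) = Uop (s + t) F"
  by (simp add: Uop_def shift_shift add.commute)

lemma Uop_zero: "Uop 0 F = F"
  by (simp add: Uop_def shift_zero)

text \<open>U(t) and its inverse U(-t) are both contractive, hence isometric.\<close>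

lemma Uop_norm:
  assumes F: "F \<in> E.dual_set"
  shows "E.cnrm (Uop t F) = E.cnrm F"
  using Uop_in_norm(2)[OF F, of t] Uop_in_norm(2)[OF Uop_in_norm(1)[OF F, of t], of "- t"]
  by (simp add: Uop_Uop Uop_zero)

lemma Uop_embed: "Uop t (E.embed l) = E.embed (shift t l)"
proof
  fix m
  have "gram gker l (shift (- t) m) = gram gker (shift t l) m"
    using gram_shift[of t l "shift (- t) m"] by (simp add: shift_shift shift_zero)
  thus "Uop t (E.embed l) m = E.embed (shift t l) m"
    unfolding Uop_def E.embed_def shift_in_carrier by (simp add: pre_space_simps)
qed

text \<open>Induction reduces to a single symbol v, for which invariance gives
  \<open>||U(t) v - v||^2 = 2 Re (<v, v> - <U(t) v, v>)\<close>. The bound near the diagonal applies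
  to this, which explains the square root in the estimate.\<close>

lemma shift_continuous:
  assumes "l \<in> E.V"
  shows "((\<lambda>t. E.nrm (hs_diff (pre_space UNIV) (shift t l) l)) \<longlongrightarrow> 0) (at 0)"
  using assms
proof (induction l)
  case Nil
  have [simp]: "gram gker [] m = 0" for m by simp
  show ?case by (simp add: hs_norm_def hs_diff_def pre_space_simps)
next
  case (Cons i l)
  obtain r x where i: "i = (r, x)" by (cases i)
  have x: "x \<in> V" and l: "l \<in> E.V" and V: "[(s, x)] \<in> E.V" for s
    using Cons.prems i by (auto simp: pre_space_simps)
  let ?d = "\<lambda>t. E.nrm (hs_diff (pre_space UNIV) [(t + r, x)] [(r, x)])"
  let ?D = "\<lambda>t. nrm (hs_diff H (T \<bar>t\<bar> x) x)"
  have D: "(?D \<longlongrightarrow> 0) (at 0)"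
  proof (rule tendstoI)
    fix e :: real assume e: "0 < e"
    obtain d where d: "0 < d" "\<And>t. 0 \<le> t \<Longrightarrow> t < d \<Longrightarrow> nrm (hs_diff H (T t x) x) < e"
      by (rule T_right_continuous[OF x e], rule that)
    have "dist (?D t) 0 < e" if "dist t 0 < d" for t
      using d(2)[of "\<bar>t\<bar>"] that norm_nonneg[of "hs_diff H (T \<bar>t\<bar> x) x"] x
      by (simp add: closed T_closed dist_real_def)
    thus "\<forall>\<^sub>F t in at 0. dist (?D t) 0 < e" unfolding eventually_at using d(1) by blast
  qed
  define c where "c = 2 * (C\<^sup>2 * (M \<tau> * (M \<tau> * nrm x)) * \<tau>)"
  have d_le: "?d t \<le> sqrt (c * ?D t)" for t
  proof (rule real_le_rsqrt)
    have "gker (t + r, x) (t + r, x) = gker (r, x) (r, x)" by (rule gker_translate)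
    hence "(?d t)\<^sup>2 = 2 * Re (gker (r, x) (r, x) - gker (t + r, x) (r, x))"
      unfolding E.norm_diff_sq[OF V V] E.norm_sq[OF V]
      by (simp add: pre_space_simps gram_def)
    also have "\<dots> \<le> 2 * cmod (gker (t + r, x) (r, x) - gker (r, x) (r, x))"
      using complex_Re_le_cmod[of "gker (r, x) (r, x) - gker (t + r, x) (r, x)"]
      by (simp add: norm_minus_commute)
    also have "\<dots> \<le> 2 * (C\<^sup>2 * (M \<tau> * ?D t * (M \<tau> * nrm x)) * \<tau>)"
      by (intro mult_left_mono gker_near_diag x) simp
    finally show "(?d t)\<^sup>2 \<le> c * ?D t" by (simp add: c_def algebra_simps)
  qed
  have sq: "((\<lambda>t. sqrt (c * ?D t)) \<longlongrightarrow> 0) (at 0)"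
    using tendsto_real_sqrt[OF tendsto_mult_left[OF D, of c]] by simp
  have sum: "((\<lambda>t. sqrt (c * ?D t) + E.nrm (hs_diff (pre_space UNIV) (shift t l) l)) \<longlongrightarrow> 0) (at 0)"
    using tendsto_add[OF sq Cons.IH[OF l]] by simp
  have "norm (E.nrm (hs_diff (pre_space UNIV) (shift t (i # l)) (i # l)))
      \<le> sqrt (c * ?D t) + E.nrm (hs_diff (pre_space UNIV) (shift t l) l)" for t
  proof -
    have "shift t (i # l) = hs_add (pre_space UNIV) [(t + r, x)] (shift t l)"
      "i # l = hs_add (pre_space UNIV) [(r, x)] l"
      by (simp_all add: i pre_space_simps)
    moreover have "shift t l \<in> E.V" using l by (simp add: shift_in_carrier)
    ultimately have "E.nrm (hs_diff (pre_space UNIV) (shift t (i # l)) (i # l))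
        \<le> ?d t + E.nrm (hs_diff (pre_space UNIV) (shift t l) l)"
      using E.norm_add_diff_le[OF V _ V l] by simp
    moreover have "0 \<le> E.nrm (hs_diff (pre_space UNIV) (shift t (i # l)) (i # l))"
      by (intro E.norm_nonneg E.diff_closed Cons.prems) (simp add: shift_in_carrier Cons.prems)
    ultimately show ?thesis using d_le[of t] by simp
  qed
  thus ?case by (intro Lim_null_comparison[OF _ sum]) simp
qed

lemma embed_diff: "l \<in> E.V \<Longrightarrow> m \<in> E.V \<Longrightarrow> (\<lambda>n. E.embed l n - E.embed m n) = E.embed (hs_diff (pre_space UNIV) l m)"
  by (rule ext) (simp add: E.embed_def E.inner_diff_left)

text \<open>F is within e/4 of an embedded formal sum, and the isometry U(t) preserves this error;
  with the displacement of the formal sum, three terms of size e/4 stay below e.\<close>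

lemma Uop_continuous:
  assumes F: "F \<in> E.dual_set" and e: "0 < e"
  shows "\<exists>d>0. \<forall>t. \<bar>t\<bar> < d \<longrightarrow> E.cnrm (\<lambda>l. Uop t F l - F l) < e"
proof -
  have "e / 4 > 0" using e by simp
  obtain l where l: "l \<in> E.V" "E.cnrm (\<lambda>m. F m - E.embed l m) \<le> e / 4"
    by (rule E.embed_dense[OF F \<open>e / 4 > 0\<close>], rule that)
  note eV = E.embed_in[OF l(1)]
  from tendstoD[OF shift_continuous[OF l(1)] \<open>e / 4 > 0\<close>]
  obtain d where d: "d > 0" "\<And>t. t \<noteq> 0 \<Longrightarrow> dist t 0 < d \<Longrightarrow>
      dist (E.nrm (hs_diff (pre_space UNIV) (shift t l) l)) 0 < e / 4"
    unfolding eventually_at by blast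
  have "E.cnrm (\<lambda>m. Uop t F m - F m) < e" if t: "\<bar>t\<bar> < d" for t
  proof -
    have sV: "shift t l \<in> E.V" using l(1) by (simp add: shift_in_carrier)
    have small: "E.cnrm (\<lambda>m. E.embed (shift t l) m - E.embed l m) < e / 4"
    proof (cases "t = 0")
      case True
      have "E.cnrm (\<lambda>m. 0) = 0" using norm_zero_hs[OF K.pre_hilbert_axioms] by simp
      thus ?thesis using True e by (simp add: shift_zero)
    next
      case False
      have "E.cnrm (\<lambda>m. E.embed (shift t l) m - E.embed l m) = E.nrm (hs_diff (pre_space UNIV) (shift t l) l)"
        unfolding embed_diff[OF sV l(1)] by (rule E.norm_embed[OF E.diff_closed[OF sV l(1)]])
      thus ?thesis using d(2)[OF False] t by (simp add: dist_real_def)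
    qed
    have UF: "Uop t F \<in> K.V" "F \<in> K.V" "E.embed (shift t l) \<in> K.V" "E.embed l \<in> K.V"
      using Uop_in_norm(1)[OF F] F E.embed_in[OF sV] eV by simp_all
    have "K.nrm (hs_diff E.completion (Uop t F) F)
        \<le> K.nrm (hs_diff E.completion (Uop t F) (E.embed (shift t l))) + K.nrm (hs_diff E.completion (E.embed (shift t l)) F)"
      by (rule K.dist_triangle_hs[OF UF(1,3,2)])
    moreover have "K.nrm (hs_diff E.completion (E.embed (shift t l)) F)
        \<le> K.nrm (hs_diff E.completion (E.embed (shift t l)) (E.embed l)) + K.nrm (hs_diff E.completion (E.embed l) F)"
      by (rule K.dist_triangle_hs[OF UF(3,4,2)])
    moreover have "K.nrm (hs_diff E.completion (E.embed l) F) = K.nrm (hs_diff E.completion F (E.embed l))"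
      by (rule K.norm_diff_commute[OF UF(4,2)])
    moreover have "hs_diff E.completion (Uop t F) (E.embed (shift t l)) = Uop t (hs_diff E.completion F (E.embed l))"
      unfolding Uop_embed[symmetric] by (simp add: Uop_def)
    moreover have "K.nrm (Uop t (hs_diff E.completion F (E.embed l))) = K.nrm (hs_diff E.completion F (E.embed l))"
      using K.diff_closed[OF UF(2,4)] by (intro Uop_norm) simp
    ultimately show ?thesis using small l(2) e by simp
  qed
  thus ?thesis using d(1) by blast
qed

lemma Uop_group: "unitary_c0_group E.completion Uop"
proof -
  have in_V: "Uop t F \<in> K.V" if "F \<in> K.V" for t F using Uop_in_norm(1) that by simp
  have lin: "Uop t (hs_add E.completion F G) = hs_add E.completion (Uop t F) (Uop t G)"
    "Uop t (hs_smul E.completion a F) = hs_smul E.completion a (Uop t F)" for t F G a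
    by (simp_all add: Uop_def)
  have nrm_eq: "K.nrm (Uop t F) = K.nrm F" if "F \<in> K.V" for t F using Uop_norm that by simp
  have "unitary_op E.completion (Uop t)" for t
    unfolding unitary_op_def bounded_op_def
  proof (intro conjI ballI allI)
    show "\<exists>c. \<forall>F\<in>K.V. K.nrm (Uop t F) \<le> c * K.nrm F"
      by (intro exI[of _ 1]) (simp add: nrm_eq del: E.completion_simps)
    show "Uop t ` K.V = K.V"
    proof
      show "K.V \<subseteq> Uop t ` K.V"
      proof
        fix F assume "F \<in> K.V"
        moreover have "F = Uop t (Uop (- t) F)" by (simp add: Uop_Uop Uop_zero)
        ultimately show "F \<in> Uop t ` K.V" using in_V by blast
      qed
    qed (use in_V in blast)
    fix F G assume "F \<in> K.V" "G \<in> K.V"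
    thus "K.ip (Uop t F) (Uop t G) = K.ip F G"
      by (intro K.isometry_inner in_V nrm_eq lin)
  qed (rule in_V lin; assumption?)+
  thus ?thesis
    unfolding unitary_c0_group_def using Uop_continuous by (simp add: Uop_zero Uop_Uop)
qed

section \<open>The operator B\<close>

definition Bop :: "'h \<Rightarrow> (real \<times> 'h) list \<Rightarrow> complex" where
  "Bop x = E.embed [(0, x)]"

lemma single_in: "x \<in> V \<Longrightarrow> [(r, x)] \<in> E.V"
  by (simp add: pre_space_simps)

lemma embed_single_add:
  assumes "x \<in> V" "y \<in> V"
  shows "E.embed [(r, hs_add H x y)] = (\<lambda>l. E.embed [(r, x)] l + E.embed [(r, y)] l)"
proof
  fix l
  have "(\<Sum>j\<leftarrow>l. gker (r, hs_add H x y) j) = (\<Sum>j\<leftarrow>l. gker (r, x) j + gker (r, y) j)" if "l \<in> E.V"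
    using that assms
    by (intro arg_cong[where f = sum_list] map_cong refl gker_add_left) (auto simp: pre_space_simps)
  thus "E.embed [(r, hs_add H x y)] l = E.embed [(r, x)] l + E.embed [(r, y)] l"
    by (simp add: E.embed_def pre_space_simps gram_def sum_list_addf)
qed

lemma embed_single_smul:
  assumes "x \<in> V"
  shows "E.embed [(r, hs_smul H a x)] = (\<lambda>l. a * E.embed [(r, x)] l)"
proof
  fix l
  have "gram gker (map (\<lambda>(r, x). (r, hs_smul H a x)) [(r, x)]) l = a * gram gker [(r, x)] l" if "l \<in> E.V"
    using that assms by (intro gram_smul_left) (auto simp: pre_space_simps)
  thus "E.embed [(r, hs_smul H a x)] l = a * E.embed [(r, x)] l"
    by (simp add: E.embed_def pre_space_simps)
qed

lemma norm_single_le: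
  assumes x: "x \<in> V"
  shows "E.nrm [(r, x)] \<le> sqrt \<tau> * C * M \<tau> * nrm x"
proof -
  have "E.nrm [(r, x)] \<le> sqrt (\<tau> * (C * M \<tau> * nrm x)\<^sup>2)"
    unfolding hs_norm_def pre_space_simps using gker_diag_le[OF x, of r] by (simp add: gram_def hs_norm_def)
  also have "\<dots> = sqrt \<tau> * C * M \<tau> * nrm x"
    using C_nonneg M_nonneg[of \<tau>] \<tau>_pos norm_nonneg[OF x] by (simp add: real_sqrt_mult)
  finally show ?thesis .
qed

lemma Bop_bounded: "bounded_op H E.completion Bop" "op_norm H E.completion Bop \<le> sqrt \<tau> * C * M \<tau>"
proof -
  have b: "K.nrm (Bop x) \<le> sqrt \<tau> * C * M \<tau> * nrm x" if "x \<in> V" for x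
    unfolding Bop_def using norm_single_le[OF that, of 0] E.norm_embed[OF single_in[OF that]] by simp
  show "op_norm H E.completion Bop \<le> sqrt \<tau> * C * M \<tau>"
    using C_nonneg M_nonneg[of \<tau>] \<tau>_pos by (intro op_norm_le[OF pre_hilbert_axioms _ b]) auto
  show "bounded_op H E.completion Bop"
    unfolding bounded_op_def using b
    by (auto simp: Bop_def embed_single_add embed_single_smul intro!: E.embed_in single_in exI[of _ "sqrt \<tau> * C * M \<tau>"])
qed

lemma Uop_Bop: "Uop t (Bop x) = E.embed [(t, x)]"
  by (simp add: Bop_def Uop_embed)

section \<open>The factorization\<close>

lemma inner_orbit:
  assumes y: "y \<in> V" and l: "set l \<subseteq> {0..} \<times> V"
  shows "ip y (orbit 0 0 l) = (\<Sum>(r, x)\<leftarrow>l. ip y (T r x))"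
  using l
proof (induction l)
  case Nil
  show ?case using inner_commute[OF y zero_closed] by (simp add: inner_zero_left y)
next
  case (Cons i l)
  thus ?case using y orbit_closed[of l 0 0] by (cases i) (simp add: inner_add_right T_closed)
qed

text \<open>On the vectors \<open>U(r) B x\<close> with \<open>r \<ge> \<sigma>\<close> the operator \<open>A\<close> is prescribed; it is extended by zero to
  the orthogonal complement by passing to the restriction of a functional.\<close>

lemma exists_Aop:
  assumes \<sigma>: "0 < \<sigma>" "\<sigma> \<le> \<tau>"
  shows "\<exists>A. bounded_op E.completion H A \<and> op_norm E.completion H A \<le> M \<tau> / sqrt \<sigma> \<and>
    (\<forall>t\<ge>\<sigma>. \<forall>x\<in>V. A (E.embed [(t, x)]) = T t x)"
proof -
  interpret P: pre_hilbert "pre_space {\<sigma>..}" by (rule pre_space_pre_hilbert)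
  interpret KP: pre_hilbert P.completion by (rule P.completion_pre_hilbert)
  define a where "a = M \<tau> / sqrt \<sigma>"
  have a0: "0 \<le> a" using M_nonneg[of \<tau>] \<tau>_pos \<sigma> by (simp add: a_def)
  have PE: "P.V \<subseteq> E.V" by (auto simp: pre_space_simps)
  have P0: "set l \<subseteq> {0..} \<times> V" if "l \<in> P.V" for l using that \<sigma> by (force simp: pre_space_simps)
  have nrm_eq: "P.nrm l = E.nrm l" for l by (simp add: hs_norm_def pre_space_simps)
  \<comment> \<open>Restriction to formal sums with times at least \<sigma>. In terms of vectors
    this is the orthogonal projection onto their closed span, so norms do not increase.\<close>
  define \<rho> where "\<rho> F = (\<lambda>l. if l \<in> P.V then F l else (0::complex))" for F
  have \<rho>: "\<rho> F \<in> P.dual_set" "P.cnrm (\<rho> F) \<le> E.cnrm F" if F: "F \<in> E.dual_set" for F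
  proof -
    have b: "cmod (\<rho> F l) \<le> E.cnrm F * P.nrm l" if "l \<in> P.V" for l
      using E.completion_bound[OF F, of l] that PE by (auto simp: \<rho>_def nrm_eq)
    have "P.antilinear (\<rho> F)"
      unfolding P.antilinear_def
    proof (intro conjI ballI allI)
      fix l m c assume l: "l \<in> P.V"
      note anti = E.dual_setD(2)[OF F]
      have "hs_smul (pre_space {\<sigma>..}) c l = hs_smul (pre_space UNIV) c l" by (simp add: pre_space_simps)
      thus "\<rho> F (hs_smul (pre_space {\<sigma>..}) c l) = cnj c * \<rho> F l"
        using E.antilinear_smul[OF anti subsetD[OF PE l], of c] P.smul_closed[OF l, of c] l by (simp add: \<rho>_def)
      assume m: "m \<in> P.V"
      have "hs_add (pre_space {\<sigma>..}) l m = hs_add (pre_space UNIV) l m" by (simp add: pre_space_simps)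
      thus "\<rho> F (hs_add (pre_space {\<sigma>..}) l m) = \<rho> F l + \<rho> F m"
        using E.antilinear_add[OF anti subsetD[OF PE l] subsetD[OF PE m]] P.add_closed[OF l m] l m
        by (simp add: \<rho>_def)
    qed
    thus 1: "\<rho> F \<in> P.dual_set" using b by (intro P.dual_setI) (auto simp: \<rho>_def)
    show "P.cnrm (\<rho> F) \<le> E.cnrm F"
      by (rule P.completion_norm_le[OF 1 E.completion_norm_nonneg[OF F] b])
  qed
  \<comment> \<open>The adjoint of the prescribed map \<open>l \<mapsto> orbit 0 0 l\<close>,
    applied to y and written as a functional. Its bound rests on
    \<open>orbit_norm_le\<close>.\<close>
  define Y where "Y y = (\<lambda>l. if l \<in> P.V then ip y (orbit 0 0 l) else 0)" for y
  have Y: "Y y \<in> P.dual_set" "P.cnrm (Y y) \<le> a * nrm y" if y: "y \<in> V" for y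
  proof -
    have b: "cmod (Y y l) \<le> (a * nrm y) * P.nrm l" if l: "l \<in> P.V" for l
    proof -
      have o: "orbit 0 0 l \<in> V" by (intro orbit_closed P0 l order_refl)
      have "(nrm (orbit 0 0 l))\<^sup>2 \<le> (M \<tau>)\<^sup>2 / \<sigma> * (P.nrm l)\<^sup>2"
        using orbit_norm_le[of l \<sigma>] l \<sigma> P.norm_sq[OF l] by (simp add: pre_space_simps)
      also have "\<dots> = (a * P.nrm l)\<^sup>2"
        using \<sigma> by (simp add: a_def power_mult_distrib power_divide)
      finally have "nrm (orbit 0 0 l) \<le> a * P.nrm l"
        by (rule power2_le_imp_le) (simp add: a0 P.norm_nonneg l)
      hence "nrm y * nrm (orbit 0 0 l) \<le> nrm y * (a * P.nrm l)"
        by (intro mult_left_mono norm_nonneg y)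
      with cauchy_schwarz[OF y o] show ?thesis using l by (simp add: Y_def mult_ac)
    qed
    have "P.antilinear (Y y)"
      unfolding P.antilinear_def
    proof (intro conjI ballI allI)
      fix l m c assume l: "l \<in> P.V"
      have sum: "(\<Sum>(r, x)\<leftarrow>map (\<lambda>(r, x). (r, hs_smul H c x)) l. ip y (T r x)) = cnj c * (\<Sum>(r, x)\<leftarrow>l. ip y (T r x))"
        using P0[OF l] by (induction l) (auto simp: T_smul T_closed inner_smul_right y algebra_simps)
      have cl: "hs_smul (pre_space {\<sigma>..}) c l \<in> P.V" by (rule P.smul_closed[OF l])
      show "Y y (hs_smul (pre_space {\<sigma>..}) c l) = cnj c * Y y l"
        using inner_orbit[OF y P0[OF cl]] inner_orbit[OF y P0[OF l]] sum cl l
        by (simp add: Y_def) (simp add: pre_space_simps)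
      assume m: "m \<in> P.V"
      have lm: "hs_add (pre_space {\<sigma>..}) l m \<in> P.V" by (rule P.add_closed[OF l m])
      show "Y y (hs_add (pre_space {\<sigma>..}) l m) = Y y l + Y y m"
        using inner_orbit[OF y P0[OF lm]] inner_orbit[OF y P0[OF l]] inner_orbit[OF y P0[OF m]] lm l m
        by (simp add: Y_def) (simp add: pre_space_simps)
    qed
    thus 1: "Y y \<in> P.dual_set" using b by (intro P.dual_setI) (auto simp: Y_def)
    show "P.cnrm (Y y) \<le> a * nrm y"
      by (rule P.completion_norm_le[OF 1 _ b]) (simp_all add: a0 norm_nonneg y)
  qed
  have Y_add: "Y (hs_add H y z) = (\<lambda>l. Y y l + Y z l)" if "y \<in> V" "z \<in> V" for y z
    using that P0 by (auto simp: Y_def inner_add_left orbit_closed)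
  have Y_smul: "Y (hs_smul H c y) = (\<lambda>l. c * Y y l)" if "y \<in> V" for y c
    using that P0 by (auto simp: Y_def inner_smul_left orbit_closed)
  have \<rho>V: "\<rho> F \<in> KP.V" if "F \<in> E.dual_set" for F using \<rho>(1)[OF that] by simp
  have YV: "Y y \<in> KP.V" if "y \<in> V" for y using Y(1)[OF that] by simp
  have bound: "cmod (KP.ip (\<rho> F) (Y y)) \<le> (E.cnrm F * a) * nrm y" if F: "F \<in> E.dual_set" and y: "y \<in> V" for F y
  proof -
    have "cmod (KP.ip (\<rho> F) (Y y)) \<le> KP.nrm (\<rho> F) * KP.nrm (Y y)"
      by (rule KP.cauchy_schwarz[OF \<rho>V[OF F] YV[OF y]])
    also have "\<dots> \<le> E.cnrm F * (a * nrm y)"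
      by (intro mult_mono \<rho>(2) Y(2) F y E.completion_norm_nonneg KP.norm_nonneg YV)
    finally show ?thesis by (simp add: mult.assoc)
  qed
  \<comment> \<open>A is defined through \<open><A F, y> = <\<rho> F, Y y>\<close>, that is, as the
    adjoint of Y after the projection \<rho>.\<close>
  have "\<exists>h\<in>V. \<forall>y\<in>V. ip h y = KP.ip (\<rho> F) (Y y)" if F: "F \<in> E.dual_set" for F
  proof (rule riesz)
    show "antilinear (\<lambda>y. KP.ip (\<rho> F) (Y y))"
      unfolding antilinear_def
    proof (intro conjI ballI allI)
      fix y z c assume y: "y \<in> V"
      show "KP.ip (\<rho> F) (Y (hs_smul H c y)) = cnj c * KP.ip (\<rho> F) (Y y)"
        using KP.inner_smul_right[OF \<rho>V[OF F] YV[OF y], of c] Y_smul[OF y] by simp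
      assume z: "z \<in> V"
      show "KP.ip (\<rho> F) (Y (hs_add H y z)) = KP.ip (\<rho> F) (Y y) + KP.ip (\<rho> F) (Y z)"
        using KP.inner_add_right[OF YV[OF y] YV[OF z] \<rho>V[OF F]] Y_add[OF y z] by simp
    qed
    show "cmod (KP.ip (\<rho> F) (Y x)) \<le> (E.cnrm F * a) * nrm x" if "x \<in> V" for x
      by (rule bound[OF F that])
  qed
  hence "\<forall>F\<in>E.dual_set. \<exists>h. h \<in> V \<and> (\<forall>y\<in>V. ip h y = KP.ip (\<rho> F) (Y y))" by blast
  from bchoice[OF this] obtain A where A: "\<And>F. F \<in> E.dual_set \<Longrightarrow> A F \<in> V"
    "\<And>F y. F \<in> E.dual_set \<Longrightarrow> y \<in> V \<Longrightarrow> ip (A F) y = KP.ip (\<rho> F) (Y y)" by blast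
  have A_norm: "nrm (A F) \<le> a * E.cnrm F" if F: "F \<in> E.dual_set" for F
  proof -
    have "(nrm (A F))\<^sup>2 \<le> cmod (ip (A F) (A F))"
      unfolding norm_sq[OF A(1)[OF F]] by (rule complex_Re_le_cmod)
    also have "\<dots> \<le> (E.cnrm F * a) * nrm (A F)"
      unfolding A(2)[OF F A(1)[OF F]] by (rule bound[OF F A(1)[OF F]])
    finally have "nrm (A F) * nrm (A F) \<le> (a * E.cnrm F) * nrm (A F)" by (simp add: power2_eq_square mult.commute)
    thus ?thesis
      using norm_nonneg[OF A(1)[OF F]] a0 E.completion_norm_nonneg[OF F]
      by (cases "nrm (A F) = 0") auto
  qed
  have A_add: "A (\<lambda>l. F l + G l) = hs_add H (A F) (A G)" if F: "F \<in> E.dual_set" and G: "G \<in> E.dual_set" for F G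
  proof (rule eqI)
    note FG = E.dual_set_add[OF F G]
    show "A (\<lambda>l. F l + G l) \<in> V" "hs_add H (A F) (A G) \<in> V" by (intro A FG add_closed F G)+
    fix y assume y: "y \<in> V"
    have "\<rho> (\<lambda>l. F l + G l) = hs_add P.completion (\<rho> F) (\<rho> G)" by (auto simp: \<rho>_def)
    hence "ip (A (\<lambda>l. F l + G l)) y = KP.ip (\<rho> F) (Y y) + KP.ip (\<rho> G) (Y y)"
      using KP.inner_add_left[OF \<rho>V[OF F] \<rho>V[OF G] YV[OF y]] by (simp only: A(2)[OF FG y])
    thus "ip (A (\<lambda>l. F l + G l)) y = ip (hs_add H (A F) (A G)) y"
      using F G y A by (simp add: inner_add_left)
  qed
  have A_smul: "A (\<lambda>l. c * F l) = hs_smul H c (A F)" if F: "F \<in> E.dual_set" for F c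
  proof (rule eqI)
    note cF = E.dual_set_smul[OF F, of c]
    show "A (\<lambda>l. c * F l) \<in> V" "hs_smul H c (A F) \<in> V" by (intro A cF smul_closed F)+
    fix y assume y: "y \<in> V"
    have "\<rho> (\<lambda>l. c * F l) = hs_smul P.completion c (\<rho> F)" by (auto simp: \<rho>_def)
    hence "ip (A (\<lambda>l. c * F l)) y = c * KP.ip (\<rho> F) (Y y)"
      using KP.inner_smul_left[OF \<rho>V[OF F] YV[OF y], of c] by (simp only: A(2)[OF cF y])
    thus "ip (A (\<lambda>l. c * F l)) y = ip (hs_smul H c (A F)) y"
      using F y A by (simp add: inner_smul_left)
  qed
  have A_embed: "A (E.embed [(t, x)]) = T t x" if t: "\<sigma> \<le> t" and x: "x \<in> V" for t x
  proof (rule eqI)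
    have t0: "0 \<le> t" using t \<sigma> by simp
    have e: "[(t, x)] \<in> P.V" using t x by (simp add: pre_space_simps)
    hence E: "E.embed [(t, x)] \<in> E.dual_set" using PE by (intro E.embed_in) auto
    show "A (E.embed [(t, x)]) \<in> V" "T t x \<in> V" by (intro A E T_closed t0 x)+
    fix y assume y: "y \<in> V"
    \<comment> \<open>For t \<ge> \<sigma> the restriction is again an embedded symbol, so the
      reproducing property evaluates \<open>Y y\<close> at that symbol.\<close>
    have "\<rho> (E.embed [(t, x)]) = P.embed [(t, x)]"
    proof
      fix l
      show "\<rho> (E.embed [(t, x)]) l = P.embed [(t, x)] l"
        using PE by (cases "l \<in> P.V") (auto simp: \<rho>_def E.embed_def P.embed_def pre_space_simps(5))
    qed
    hence "ip (A (E.embed [(t, x)])) y = KP.ip (P.embed [(t, x)]) (Y y)" using A(2)[OF E y] by simp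
    also have "\<dots> = cnj (KP.ip (Y y) (P.embed [(t, x)]))"
      using P.embed_in[OF e] YV[OF y] by (intro KP.inner_commute) simp_all
    also have "KP.ip (Y y) (P.embed [(t, x)]) = ip y (orbit 0 0 [(t, x)])"
      using e by (simp only: P.inner_embed[OF Y(1)[OF y] e]) (simp add: Y_def)
    also have "\<dots> = ip y (T t x)"
      using inner_orbit[OF y P0[OF e]] by simp
    finally show "ip (A (E.embed [(t, x)])) y = ip (T t x) y"
      using inner_commute[OF T_closed[OF t0 x] y] by simp
  qed
  have "bounded_op E.completion H A"
    unfolding bounded_op_def using A(1) A_add A_smul A_norm
    by (intro conjI ballI allI exI[of _ a]) simp_all
  moreover have "op_norm E.completion H A \<le> a"
    using a0 A_norm by (intro op_norm_le[OF E.completion_pre_hilbert]) simp_all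
  ultimately show ?thesis using A_embed unfolding a_def by blast
qed

text \<open>An element of \<open>K\<close> is determined by its inner products with the \<open>U(r) B x\<close>, hence by the
  function \<open>r \<mapsto> B* U(r)* F\<close> with values in \<open>H\<close>.\<close>

lemma exists_inj_on_completion: "\<exists>\<phi> :: _ \<Rightarrow> real \<Rightarrow> 'h. inj_on \<phi> E.dual_set"
proof -
  have "\<exists>h\<in>V. \<forall>x\<in>V. ip h x = F [(r, x)]" if F: "F \<in> E.dual_set" for F r
  proof (rule riesz)
    \<comment> \<open>Written as an inner product, F [(r, x)] is antilinear in x, although the
      formal sums \<open>[(r, hs_add H x y)]\<close> and \<open>[(r, x)] @ [(r, y)]\<close> are
      different lists.\<close>
    have Fx: "F [(r, x)] = K.ip F (E.embed [(r, x)])" if "x \<in> V" for x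
      by (rule E.inner_embed[OF F single_in[OF that], symmetric])
    have eV: "E.embed [(r, x)] \<in> K.V" if "x \<in> V" for x using E.embed_in[OF single_in[OF that]] by simp
    have FV: "F \<in> K.V" using F by simp
    show "antilinear (\<lambda>x. F [(r, x)])"
      unfolding antilinear_def
    proof (intro conjI ballI allI)
      fix x y c assume x: "x \<in> V"
      show "F [(r, hs_smul H c x)] = cnj c * F [(r, x)]"
        using K.inner_smul_right[OF FV eV[OF x], of c]
        by (simp add: Fx x smul_closed embed_single_smul)
      assume y: "y \<in> V"
      show "F [(r, hs_add H x y)] = F [(r, x)] + F [(r, y)]"
        using K.inner_add_right[OF eV[OF x] eV[OF y] FV]
        by (simp add: Fx x y add_closed embed_single_add)
    qed
    show "cmod (F [(r, x)]) \<le> (E.cnrm F * (sqrt \<tau> * C * M \<tau>)) * nrm x" if x: "x \<in> V" for x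
    proof -
      have "cmod (F [(r, x)]) \<le> E.cnrm F * E.nrm [(r, x)]"
        by (rule E.completion_bound[OF F single_in[OF x]])
      also have "\<dots> \<le> E.cnrm F * (sqrt \<tau> * C * M \<tau> * nrm x)"
        by (intro mult_left_mono norm_single_le x E.completion_norm_nonneg F)
      finally show ?thesis by (simp add: mult.assoc)
    qed
  qed
  hence "\<forall>F\<in>E.dual_set. \<exists>h. \<forall>r. h r \<in> V \<and> (\<forall>x\<in>V. ip (h r) x = F [(r, x)])"
    by (intro ballI choice) blast
  from bchoice[OF this] obtain \<phi>
    where \<phi>: "\<And>F r x. F \<in> E.dual_set \<Longrightarrow> x \<in> V \<Longrightarrow> ip (\<phi> F r) x = F [(r, x)]" by blast
  have "inj_on \<phi> E.dual_set"
  proof (rule inj_onI)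
    fix F G assume F: "F \<in> E.dual_set" and G: "G \<in> E.dual_set" and eq: "\<phi> F = \<phi> G"
    have single: "F [(r, x)] = G [(r, x)]" if "x \<in> V" for r x
      using \<phi>[OF F that, of r] \<phi>[OF G that, of r] eq by simp
    \<comment> \<open>\<open>[] @ [] = []\<close> forces the value 0. A list being a concatenation
      of singletons, a functional is determined by its values on those.\<close>
    have nil: "L [] = 0" if "L \<in> E.dual_set" for L
      using E.antilinear_add[OF E.dual_setD(2)[OF that], of "[]" "[]"] by (simp add: pre_space_simps)
    have cons: "L (i # l) = L [i] + L l" if "L \<in> E.dual_set" "i # l \<in> E.V" for L i l
      using E.antilinear_add[OF E.dual_setD(2)[OF that(1)], of "[i]" l] that(2) by (simp add: pre_space_simps)
    have "F l = G l" if "l \<in> E.V" for l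
      using that
    proof (induction l)
      case Nil
      show ?case by (simp add: nil F G)
    next
      case (Cons i l)
      have "l \<in> E.V" "snd i \<in> V" using Cons.prems by (auto simp: pre_space_simps)
      thus ?case using Cons.IH single[of "snd i" "fst i"] by (simp add: cons[OF F Cons.prems] cons[OF G Cons.prems])
    qed
    moreover have "F l = G l" if "l \<notin> E.V" for l
      using E.dual_setD(1)[OF F that] E.dual_setD(1)[OF G that] by simp
    ultimately show "F = G" by blast
  qed
  thus ?thesis by blast
qed

theorem exists_unitary_factorization:
  assumes "0 < \<sigma>" "\<sigma> \<le> \<tau>"
  shows "\<exists>(K :: ((real \<times> 'h) list \<Rightarrow> complex) hspace) A B U. hilbert_space K \<and> bounded_op K H A \<and>
    bounded_op H K B \<and> unitary_c0_group K U \<and> (\<forall>t\<ge>\<sigma>. \<forall>x\<in>V. T t x = A (U t (B x))) \<and>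
    op_norm K H A \<le> M \<tau> / sqrt \<sigma> \<and> op_norm H K B \<le> sqrt \<tau> * C * M \<tau> \<and>
    (\<exists>\<phi> :: _ \<Rightarrow> real \<Rightarrow> 'h. inj_on \<phi> (hs_carrier K))"
proof -
  obtain A where A: "bounded_op E.completion H A" "op_norm E.completion H A \<le> M \<tau> / sqrt \<sigma>"
    "\<And>t x. \<sigma> \<le> t \<Longrightarrow> x \<in> V \<Longrightarrow> A (E.embed [(t, x)]) = T t x"
    using exists_Aop[OF assms] by blast
  have "\<forall>t\<ge>\<sigma>. \<forall>x\<in>V. T t x = A (Uop t (Bop x))" by (simp add: Uop_Bop A(3))
  moreover have "\<exists>\<phi> :: _ \<Rightarrow> real \<Rightarrow> 'h. inj_on \<phi> K.V"
    using exists_inj_on_completion by simp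
  ultimately show ?thesis
    using E.completion_hilbert A(1,2) Bop_bounded Uop_group by blast
qed

end

section \<open>Transport of a Hilbert space along an injection\<close>

definition transport :: "('a \<Rightarrow> 'b) \<Rightarrow> 'a hspace \<Rightarrow> 'b hspace" where
  "transport \<phi> K = (let \<psi> = inv_into (hs_carrier K) \<phi> in
     \<lparr>hs_carrier = \<phi> ` hs_carrier K, hs_zero = \<phi> (hs_zero K),
      hs_add = (\<lambda>x y. \<phi> (hs_add K (\<psi> x) (\<psi> y))), hs_smul = (\<lambda>a x. \<phi> (hs_smul K a (\<psi> x))),
      hs_inner = (\<lambda>x y. hs_inner K (\<psi> x) (\<psi> y))\<rparr>)"

text \<open>The completion consists of functionals on lists, whereas the theorem asks for a carrier
  of functions \<open>real \<Rightarrow> 'h\<close>. As \<phi> need not be onto, its image is the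
  new carrier, and operators are composed with \<phi> and its inverse there.\<close>

locale hilbert_transport =
  fixes K :: "'a hspace" and \<phi> :: "'a \<Rightarrow> 'b"
  assumes K: "hilbert_space K" and inj: "inj_on \<phi> (hs_carrier K)"
begin

interpretation K: pre_hilbert K by (rule hilbert_space_pre_hilbert[OF K])

abbreviation "K' \<equiv> transport \<phi> K"
abbreviation "\<psi> \<equiv> inv_into (hs_carrier K) \<phi>"

lemma \<psi>_\<phi>: "x \<in> K.V \<Longrightarrow> \<psi> (\<phi> x) = x"
  by (rule inv_into_f_f[OF inj])

lemma sel:
  "hs_carrier K' = \<phi> ` K.V" "hs_zero K' = \<phi> (hs_zero K)"
  "x \<in> K.V \<Longrightarrow> y \<in> K.V \<Longrightarrow> hs_add K' (\<phi> x) (\<phi> y) = \<phi> (hs_add K x y)"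
  "x \<in> K.V \<Longrightarrow> hs_smul K' a (\<phi> x) = \<phi> (hs_smul K a x)"
  "x \<in> K.V \<Longrightarrow> y \<in> K.V \<Longrightarrow> hs_inner K' (\<phi> x) (\<phi> y) = hs_inner K x y"
  "x \<in> K.V \<Longrightarrow> y \<in> K.V \<Longrightarrow> hs_diff K' (\<phi> x) (\<phi> y) = \<phi> (hs_diff K x y)"
  "x \<in> K.V \<Longrightarrow> hs_norm K' (\<phi> x) = hs_norm K x"
  by (simp_all add: transport_def Let_def hs_diff_def hs_norm_def \<psi>_\<phi> K.closed)

lemma transport_hilbert: "hilbert_space K'"
proof -
  note H = K[unfolded hilbert_space_def Let_def]
  have ax: "\<forall>x\<in>K.V. \<forall>y\<in>K.V. \<forall>w\<in>K.V. hs_add K (hs_add K x y) w = hs_add K x (hs_add K y w)"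
    "\<forall>x\<in>K.V. \<forall>y\<in>K.V. hs_add K x y = hs_add K y x"
    "\<forall>x\<in>K.V. hs_add K (hs_zero K) x = x"
    "\<forall>x\<in>K.V. \<exists>y\<in>K.V. hs_add K x y = hs_zero K"
    "\<forall>a. \<forall>x\<in>K.V. \<forall>y\<in>K.V. hs_smul K a (hs_add K x y) = hs_add K (hs_smul K a x) (hs_smul K a y)"
    "\<forall>a b. \<forall>x\<in>K.V. hs_smul K (a + b) x = hs_add K (hs_smul K a x) (hs_smul K b x)"
    "\<forall>a b. \<forall>x\<in>K.V. hs_smul K (a * b) x = hs_smul K a (hs_smul K b x)"
    "\<forall>x\<in>K.V. hs_smul K 1 x = x"
    "\<forall>x\<in>K.V. Im (K.ip x x) = 0 \<and> Re (K.ip x x) \<ge> 0"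
    "\<forall>x\<in>K.V. K.ip x x = 0 \<longrightarrow> x = hs_zero K"
    and compl: "\<forall>s :: nat \<Rightarrow> 'a. (\<forall>n. s n \<in> K.V) \<longrightarrow>
          (\<forall>e>0. \<exists>N. \<forall>m\<ge>N. \<forall>n\<ge>N. K.nrm (hs_diff K (s m) (s n)) < e) \<longrightarrow>
          (\<exists>l\<in>K.V. \<forall>e>0. \<exists>N. \<forall>n\<ge>N. K.nrm (hs_diff K (s n) l) < e)"
    using H by - (elim conjE; assumption)+
  \<comment> \<open>Quantifiers over the image are rewritten as quantifiers over \<open>K.V\<close>,
    so that each axiom is read off from the one for K.\<close>
  show ?thesis
    unfolding hilbert_space_def Let_def sel(1,2) ball_simps(9)
  proof (intro conjI allI ballI impI)
    fix x assume x: "x \<in> K.V"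
    show "\<exists>y\<in>\<phi> ` K.V. hs_add K' (\<phi> x) y = \<phi> (hs_zero K)"
    proof -
      obtain y where "y \<in> K.V" "hs_add K x y = hs_zero K" using ax(4) x by blast
      thus ?thesis using x by (intro bexI[of _ "\<phi> y"]) (simp_all add: sel)
    qed
    show "Im (hs_inner K' (\<phi> x) (\<phi> x)) = 0" "0 \<le> Re (hs_inner K' (\<phi> x) (\<phi> x))"
      using ax(9) x by (simp_all add: sel)
    show "\<phi> x = \<phi> (hs_zero K)" if "hs_inner K' (\<phi> x) (\<phi> x) = 0"
      using ax(10)[rule_format, OF x] that x by (simp add: sel)
    show "hs_add K' (\<phi> (hs_zero K)) (\<phi> x) = \<phi> x" "hs_smul K' 1 (\<phi> x) = \<phi> x"
      using ax(3,8) x by (simp_all add: sel K.closed)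
    fix a b
    show "hs_smul K' a (\<phi> x) \<in> \<phi> ` K.V" using x by (simp add: sel K.closed)
    show "hs_smul K' (a + b) (\<phi> x) = hs_add K' (hs_smul K' a (\<phi> x)) (hs_smul K' b (\<phi> x))"
      using ax(6)[rule_format, OF x, of a b] x by (simp add: sel K.closed)
    show "hs_smul K' (a * b) (\<phi> x) = hs_smul K' a (hs_smul K' b (\<phi> x))"
      using ax(7)[rule_format, OF x, of a b] x by (simp add: sel K.closed)
    fix y assume y: "y \<in> K.V"
    show "hs_add K' (\<phi> x) (\<phi> y) \<in> \<phi> ` K.V" using x y by (simp add: sel K.closed)
    show "hs_add K' (\<phi> x) (\<phi> y) = hs_add K' (\<phi> y) (\<phi> x)"
      using ax(2)[rule_format, OF x y] x y by (simp add: sel)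
    show "hs_smul K' a (hs_add K' (\<phi> x) (\<phi> y)) = hs_add K' (hs_smul K' a (\<phi> x)) (hs_smul K' a (\<phi> y))"
      using ax(5)[rule_format, OF x y, of a] x y by (simp add: sel K.closed)
    show "hs_inner K' (\<phi> x) (\<phi> y) = cnj (hs_inner K' (\<phi> y) (\<phi> x))"
      using K.inner_commute[OF x y] x y by (simp add: sel)
    show "hs_inner K' (hs_smul K' a (\<phi> x)) (\<phi> y) = a * hs_inner K' (\<phi> x) (\<phi> y)"
      using x y by (simp add: sel K.closed K.inner_smul_left)
    fix w assume w: "w \<in> K.V"
    show "hs_add K' (hs_add K' (\<phi> x) (\<phi> y)) (\<phi> w) = hs_add K' (\<phi> x) (hs_add K' (\<phi> y) (\<phi> w))"
      using ax(1)[rule_format, OF x y w] x y w by (simp add: sel K.closed)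
    show "hs_inner K' (hs_add K' (\<phi> x) (\<phi> y)) (\<phi> w) = hs_inner K' (\<phi> x) (\<phi> w) + hs_inner K' (\<phi> y) (\<phi> w)"
      using x y w by (simp add: sel K.closed K.inner_add_left)
  next
    fix s :: "nat \<Rightarrow> 'b"
    assume s: "\<forall>n. s n \<in> \<phi> ` K.V"
      and cau: "\<forall>e>0. \<exists>N. \<forall>m\<ge>N. \<forall>n\<ge>N. hs_norm K' (hs_diff K' (s m) (s n)) < e"
    have "\<forall>n. \<exists>x. x \<in> K.V \<and> s n = \<phi> x" using s by blast
    from choice[OF this] obtain u where u: "\<And>n. u n \<in> K.V" "\<And>n. s n = \<phi> (u n)" by blast
    have "\<forall>e>0. \<exists>N. \<forall>m\<ge>N. \<forall>n\<ge>N. K.nrm (hs_diff K (u m) (u n)) < e"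
      using cau by (simp add: u sel K.closed)
    then obtain l where l: "l \<in> K.V" "\<forall>e>0. \<exists>N. \<forall>n\<ge>N. K.nrm (hs_diff K (u n) l) < e"
      using compl[THEN spec, of u] u(1) by blast
    thus "\<exists>l\<in>\<phi> ` K.V. \<forall>e>0. \<exists>N. \<forall>n\<ge>N. hs_norm K' (hs_diff K' (s n) l) < e"
      by (intro bexI[of _ "\<phi> l"]) (simp_all add: u sel K.closed)
  qed (rule imageI[OF K.zero_closed])
qed

lemma transport_bounded_op_from:
  assumes "bounded_op K H A"
  shows "bounded_op K' H (\<lambda>x. A (\<psi> x))"
  using assms unfolding bounded_op_def sel(1) ball_simps(9) by (simp add: sel K.closed \<psi>_\<phi>)

lemma transport_op_norm_from: "op_norm K' H (\<lambda>x. A (\<psi> x)) = op_norm K H A"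
proof -
  have "{hs_norm H (A (\<psi> x)) | x. x \<in> \<phi> ` K.V \<and> hs_norm K' x \<le> 1} = {hs_norm H (A x) | x. x \<in> K.V \<and> K.nrm x \<le> 1}"
    by (auto simp: sel \<psi>_\<phi>) (metis \<psi>_\<phi> image_eqI sel(7))
  thus ?thesis by (simp add: op_norm_def sel)
qed

lemma transport_bounded_op_to:
  assumes "bounded_op H K B"
  shows "bounded_op H K' (\<lambda>x. \<phi> (B x))"
  using assms unfolding bounded_op_def by (simp add: sel)

lemma transport_op_norm_to:
  assumes "bounded_op H K B"
  shows "op_norm H K' (\<lambda>x. \<phi> (B x)) = op_norm H K B"
proof -
  have "hs_norm K' (\<phi> (B x)) = K.nrm (B x)" if "x \<in> hs_carrier H" for x
    using bounded_opD(1)[OF assms that] by (simp add: sel)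
  hence "{hs_norm K' (\<phi> (B x)) | x. x \<in> hs_carrier H \<and> hs_norm H x \<le> 1}
      = {K.nrm (B x) | x. x \<in> hs_carrier H \<and> hs_norm H x \<le> 1}"
    by force
  thus ?thesis by (simp add: op_norm_def)
qed

lemma transport_unitary_c0_group:
  assumes U: "unitary_c0_group K U"
  shows "unitary_c0_group K' (\<lambda>t x. \<phi> (U t (\<psi> x)))"
proof -
  have un: "unitary_op K (U t)" for t using U by (simp add: unitary_c0_group_def)
  have b: "bounded_op K K (U t)" and im: "U t ` K.V = K.V"
    and ip': "\<forall>x\<in>K.V. \<forall>y\<in>K.V. K.ip (U t x) (U t y) = K.ip x y" for t
    using un[of t] unfolding unitary_op_def by - (elim conjE; assumption)+
  note ipU = ip'[rule_format]
  note UV = bounded_opD(1)[OF b]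
  have "unitary_op K' (\<lambda>x. \<phi> (U t (\<psi> x)))" for t
    unfolding unitary_op_def
  proof (intro conjI)
    show "bounded_op K' K' (\<lambda>x. \<phi> (U t (\<psi> x)))"
      by (rule transport_bounded_op_from[OF transport_bounded_op_to[OF b]])
    have "(\<lambda>x. \<phi> (U t (\<psi> x))) ` \<phi> ` K.V = \<phi> ` (U t ` K.V)"
      by (simp add: image_image \<psi>_\<phi> cong: image_cong)
    thus "(\<lambda>x. \<phi> (U t (\<psi> x))) ` hs_carrier K' = hs_carrier K'" by (simp add: sel im)
    show "\<forall>x\<in>hs_carrier K'. \<forall>y\<in>hs_carrier K'. hs_inner K' (\<phi> (U t (\<psi> x))) (\<phi> (U t (\<psi> y))) = hs_inner K' x y"
      unfolding sel(1) ball_simps(9) by (simp add: sel \<psi>_\<phi> UV ipU)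
  qed
  moreover have "\<phi> (U 0 (\<psi> x)) = x" if "x \<in> hs_carrier K'" for x
  proof -
    obtain y where y: "x = \<phi> y" "y \<in> K.V" using \<open>x \<in> hs_carrier K'\<close> sel(1) by blast
    have "\<forall>x\<in>K.V. U 0 x = x" using U unfolding unitary_c0_group_def by (elim conjE)
    thus ?thesis using y by (simp add: \<psi>_\<phi>)
  qed
  moreover have "\<phi> (U (s + t) (\<psi> x)) = \<phi> (U s (\<psi> (\<phi> (U t (\<psi> x)))))" if "x \<in> hs_carrier K'" for s t x
  proof -
    obtain y where y: "x = \<phi> y" "y \<in> K.V" using \<open>x \<in> hs_carrier K'\<close> sel(1) by blast
    have "\<forall>s t. \<forall>x\<in>K.V. U (s + t) x = U s (U t x)" using U unfolding unitary_c0_group_def by (elim conjE)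
    hence "U (s + t) y = U s (U t y)" using y(2) by blast
    thus ?thesis using y by (simp add: \<psi>_\<phi> UV)
  qed
  moreover have "\<exists>d>0. \<forall>t. \<bar>t\<bar> < d \<longrightarrow> hs_norm K' (hs_diff K' (\<phi> (U t (\<psi> x))) x) < e"
    if x: "x \<in> hs_carrier K'" and e: "0 < e" for x e
  proof -
    obtain y where y: "x = \<phi> y" "y \<in> K.V" using x sel(1) by blast
    have "\<forall>x\<in>K.V. \<forall>e>0. \<exists>d>0. \<forall>t. \<bar>t\<bar> < d \<longrightarrow> K.nrm (hs_diff K (U t x) x) < e"
      using U unfolding unitary_c0_group_def by (elim conjE)
    from this[rule_format, OF y(2) e] show ?thesis
      using y by (simp add: \<psi>_\<phi> sel UV K.closed)
  qed
  ultimately show ?thesis unfolding unitary_c0_group_def by (intro conjI allI ballI impI) simp_all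
qed

end

section \<open>The factorization with the stated constant on the prescribed carrier type\<close>

theorem theorem4p9:
  fixes H :: "'h hspace" and T :: "real \<Rightarrow> 'h \<Rightarrow> 'h" and \<tau>1 \<tau>2 :: real
  assumes "hilbert_space H" and "c0_semigroup H T"
    and "\<tau>1 > 0" and "similar_to_contraction H (T \<tau>1)"
    and "0 < \<tau>2" and "\<tau>2 \<le> \<tau>1"
  shows "\<exists>(K :: (real \<Rightarrow> 'h) hspace) A B U.
           hilbert_space K \<and> bounded_op K H A \<and> bounded_op H K B \<and> unitary_c0_group K U \<and>
           (\<forall>t\<ge>\<tau>2. \<forall>x\<in>hs_carrier H. T t x = A (U t (B x))) \<and>
           ereal (op_norm K H A * op_norm H K B)
             \<le> sim_const H (T \<tau>1) *
                ereal ((SUP t\<in>{0..\<tau>1}. op_norm H H (T t))\<^sup>2 * sqrt (\<tau>1 / \<tau>2))"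
proof -
  interpret c0_semi H T
    by (intro c0_semi.intro c0_semi_axioms.intro hilbert_space_hilbert assms)
  have Tb: "bounded_op H H (T \<tau>1)" using assms(3) by (intro T_bounded_op) simp
  \<comment> \<open>Similarity makes \<open>sim_const\<close> finite; its exact value C, not an
    approximation, is the constant of the renorming.\<close>
  obtain p C where p: "pre_hilbert (H\<lparr>hs_inner := p\<rparr>)" "0 \<le> C" "sim_const H (T \<tau>1) = ereal C"
    "\<And>x. x \<in> V \<Longrightarrow> (nrm x)\<^sup>2 \<le> Re (p x x)"
    "\<And>x. x \<in> V \<Longrightarrow> Re (p x x) \<le> C\<^sup>2 * (nrm x)\<^sup>2"
    "\<And>x. x \<in> V \<Longrightarrow> Re (p (T \<tau>1 x) (T \<tau>1 x)) \<le> Re (p x x)"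
    by (rule contractive_renorming[OF pre_hilbert_axioms Tb assms(4)], rule that)
  interpret renormed_semigroup H T p C \<tau>1
    by (intro renormed_semigroup.intro renormed_semigroup_axioms.intro c0_semi_axioms p assms(3))
  obtain K :: "((real \<times> 'h) list \<Rightarrow> complex) hspace" and A B U and \<phi> :: "_ \<Rightarrow> real \<Rightarrow> 'h"
    where K: "hilbert_space K" "bounded_op K H A" "bounded_op H K B" "unitary_c0_group K U"
      and fac: "\<forall>t\<ge>\<tau>2. \<forall>x\<in>V. T t x = A (U t (B x))"
      and bd: "op_norm K H A \<le> M \<tau>1 / sqrt \<tau>2" "op_norm H K B \<le> sqrt \<tau>1 * C * M \<tau>1"
      and \<phi>: "inj_on \<phi> (hs_carrier K)"
    using exists_unitary_factorization[OF assms(5,6)] by blast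
  interpret tr: hilbert_transport K \<phi> by (intro hilbert_transport.intro K \<phi>)
  have M0: "0 \<le> M \<tau>1" using M_nonneg assms(3) by simp
  have "op_norm K H A * op_norm H K B \<le> (M \<tau>1 / sqrt \<tau>2) * (sqrt \<tau>1 * C * M \<tau>1)"
    using M0 assms(5)
    by (intro mult_mono bd op_norm_nonneg[OF pre_hilbert_axioms hilbert_space_pre_hilbert[OF K(1)] K(3)]) simp
  also have "\<dots> = C * ((M \<tau>1)\<^sup>2 * sqrt (\<tau>1 / \<tau>2))"
    by (simp add: real_sqrt_divide power2_eq_square)
  finally have norm_le: "op_norm K H A * op_norm H K B \<le> C * ((M \<tau>1)\<^sup>2 * sqrt (\<tau>1 / \<tau>2))" .
  have "T t x = A (inv_into (hs_carrier K) \<phi> (\<phi> (U t (inv_into (hs_carrier K) \<phi> (\<phi> (B x))))))"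
    if t: "\<tau>2 \<le> t" and x: "x \<in> V" for t x
  proof -
    have Bx: "B x \<in> hs_carrier K" by (rule bounded_opD(1)[OF K(3) x])
    have "bounded_op K K (U t)" using K(4) by (simp add: unitary_c0_group_def unitary_op_def)
    hence "U t (B x) \<in> hs_carrier K" using Bx by (rule bounded_opD(1))
    thus ?thesis using Bx fac t x by (simp add: tr.\<psi>_\<phi>)
  qed
  moreover have "ereal (op_norm (transport \<phi> K) H (\<lambda>x. A (inv_into (hs_carrier K) \<phi> x))
        * op_norm H (transport \<phi> K) (\<lambda>x. \<phi> (B x)))
      \<le> sim_const H (T \<tau>1) * ereal ((SUP t\<in>{0..\<tau>1}. op_norm H H (T t))\<^sup>2 * sqrt (\<tau>1 / \<tau>2))"
    using norm_le by (simp add: p(3) tr.transport_op_norm_from tr.transport_op_norm_to[OF K(3)] M_def)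
  ultimately show ?thesis
    using tr.transport_hilbert tr.transport_bounded_op_from[OF K(2)] tr.transport_bounded_op_to[OF K(3)]
      tr.transport_unitary_c0_group[OF K(4)] by blast
qed

end
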